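(* Let $\gamma$ be a closed strong spacelike curve in the 3-dimensional Lorentz space $\mathbb{R}^3_1$ with index $2$. Suppose that $\gamma$ is a nontrivial knot. Then its total curvature satisfies $\int_\gamma k\,\mathrm{d}s<4\pi$.
   Context: $\mathbb{R}^3_1$ is $\mathbb{R}^3$ with the Lorentz inner product $\langle X,Y\rangle=x_1y_1+x_2y_2-x_3y_3$. A vector $X$ is spacelike if $\langle X,X\rangle>0$; a linear subspace is spacelike if $\langle\cdot,\cdot\rangle$ restricts to a positive definite form on it. A curve is spacelike if its tangent line at each point is spacelike; it then has an arc-length parameter $s$ with unit tangent vector $T=\gamma'(s)$, $\langle T,T\rangle=1$. A strong spacelike curve is a (smooth, regular) spacelike curve such that at each point the curvature vector $T'(s)$ is nonzero and the osculating plane, i.e. the plane spanned by $T$ and $T'(s)$, is a spacelike 2-plane. Since $\langle T,T'\rangle=0$, $T'$ is then spacelike, and one writes $T'(s)=kN$ with $\langle N,N\rangle=1$ and curvature $k=\sqrt{\langle T',T'\rangle}>0$. A closed curve means a smoothly closed (periodic) one. The total curvature is $\int_\gamma k\,\mathrm{d}s$, the integral over one period. The de Sitter sphere is $\mathbb{S}^2_1=\{X\in\mathbb{R}^3_1:\langle X,X\rangle=1\}$, parametrized by latitude and longitude as $(\cosh\varphi\cos\theta,\cosh\varphi\sin\theta,\sinh\varphi)$. The tangent indicatrix of $\gamma$ is the closed curve $s\mapsto T(s)\in\mathbb{S}^2_1$. The index $I$ of $\gamma$ is the winding number of the tangent indicatrix around $\mathbb{S}^2_1$ (which is homotopy equivalent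 to a circle), i.e. $\frac{1}{2\pi}$ times the total change of a continuous choice of the longitude $\theta$ along $T$ over one period; it is an integer, and $\gamma$ is always oriented so that it is positive. A nontrivial knot is a simple closed curve in $\mathbb{R}^3$ (the underlying space of $\mathbb{R}^3_1$) that is not isotopic to the unknot, equivalently does not bound an embedded disc. *)

theory Defs
  imports "HOL-Analysis.Analysis"
begin

section \<open>Lorentz 3-space\<close>

definition lorentz :: "real^3 \<Rightarrow> real^3 \<Rightarrow> real" where
  "lorentz x y = x$1 * y$1 + x$2 * y$2 - x$3 * y$3"

definition spacelike_subspace :: "(real^3) set \<Rightarrow> bool" where
  "spacelike_subspace V \<longleftrightarrow> subspace V \<and> (\<forall>x\<in>V. x \<noteq> 0 \<longrightarrow> lorentz x x > 0)"

definition de_sitter_point :: "real \<Rightarrow> real \<Rightarrow> real^3" where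
  "de_sitter_point \<phi> \<theta> = vector [cosh \<phi> * cos \<theta>, cosh \<phi> * sin \<theta>, sinh \<phi>]"

section \<open>Strong spacelike curves\<close>

text \<open>
  Curves are regular curves with an arbitrary smooth parameter \<open>t\<close>, not necessarily arc length.
  The arc-length parameter \<open>s\<close> satisfies \<open>ds/dt = speed \<gamma> t\<close>, so that \<open>d/ds = (1 / speed) d/dt\<close>.
\<close>

definition velocity :: "(real \<Rightarrow> real^3) \<Rightarrow> real \<Rightarrow> real^3" where
  "velocity \<gamma> t = vector_derivative \<gamma> (at t)"

definition smooth_curve :: "(real \<Rightarrow> real^3) \<Rightarrow> bool" where
  "smooth_curve \<gamma> \<longleftrightarrow> (\<forall>n. (velocity ^^ n) \<gamma> differentiable_on UNIV)"

definition spacelike_curve :: "(real \<Rightarrow> real^3) \<Rightarrow> bool" where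
  "spacelike_curve \<gamma> \<longleftrightarrow> smooth_curve \<gamma> \<and>
     (\<forall>t. velocity \<gamma> t \<noteq> 0 \<and> spacelike_subspace (span {velocity \<gamma> t}))"

definition speed :: "(real \<Rightarrow> real^3) \<Rightarrow> real \<Rightarrow> real" where
  "speed \<gamma> t = sqrt (lorentz (velocity \<gamma> t) (velocity \<gamma> t))"

definition unit_tangent :: "(real \<Rightarrow> real^3) \<Rightarrow> real \<Rightarrow> real^3" where
  "unit_tangent \<gamma> t = velocity \<gamma> t /\<^sub>R speed \<gamma> t"

text \<open>The vector \<open>dT/ds\<close>.\<close>

definition curvature_vector :: "(real \<Rightarrow> real^3) \<Rightarrow> real \<Rightarrow> real^3" where
  "curvature_vector \<gamma> t = vector_derivative (unit_tangent \<gamma>) (at t) /\<^sub>R speed \<gamma> t"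

definition osculating_plane :: "(real \<Rightarrow> real^3) \<Rightarrow> real \<Rightarrow> (real^3) set" where
  "osculating_plane \<gamma> t = span {unit_tangent \<gamma> t, curvature_vector \<gamma> t}"

definition strong_spacelike_curve :: "(real \<Rightarrow> real^3) \<Rightarrow> bool" where
  "strong_spacelike_curve \<gamma> \<longleftrightarrow> spacelike_curve \<gamma> \<and>
     (\<forall>t. curvature_vector \<gamma> t \<noteq> 0 \<and>
          dim (osculating_plane \<gamma> t) = 2 \<and> spacelike_subspace (osculating_plane \<gamma> t))"

definition curvature :: "(real \<Rightarrow> real^3) \<Rightarrow> real \<Rightarrow> real" where
  "curvature \<gamma> t = sqrt (lorentz (curvature_vector \<gamma> t) (curvature_vector \<gamma> t))"

section \<open>Closed curves, total curvature and index\<close>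

text \<open>For a smooth curve, being periodic is the same as being smoothly closed.\<close>

definition closed_curve :: "(real \<Rightarrow> real^3) \<Rightarrow> real \<Rightarrow> bool" where
  "closed_curve \<gamma> P \<longleftrightarrow> P > 0 \<and> (\<forall>t. \<gamma> (t + P) = \<gamma> t)"

definition total_curvature :: "(real \<Rightarrow> real^3) \<Rightarrow> real \<Rightarrow> real" where
  "total_curvature \<gamma> P = integral {0..P} (\<lambda>t. curvature \<gamma> t * speed \<gamma> t)"

definition longitude_along :: "(real \<Rightarrow> real^3) \<Rightarrow> real \<Rightarrow> (real \<Rightarrow> real) \<Rightarrow> bool" where
  "longitude_along T P \<theta> \<longleftrightarrow> continuous_on {0..P} \<theta> \<and>
     (\<forall>t\<in>{0..P}. \<exists>\<phi>. T t = de_sitter_point \<phi> (\<theta> t))"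

definition has_index :: "(real \<Rightarrow> real^3) \<Rightarrow> real \<Rightarrow> int \<Rightarrow> bool" where
  "has_index \<gamma> P I \<longleftrightarrow>
     (\<exists>\<theta>. longitude_along (unit_tangent \<gamma>) P \<theta> \<and> (\<theta> P - \<theta> 0) / (2 * pi) = of_int I)"

lemma has_index_unique:
  assumes "P \<ge> 0" "has_index \<gamma> P I" "has_index \<gamma> P J"
  shows "I = J"
proof -
  obtain \<theta> where th: "longitude_along (unit_tangent \<gamma>) P \<theta>" "(\<theta> P - \<theta> 0) / (2 * pi) = of_int I"
    using assms(2) unfolding has_index_def by blast
  obtain \<psi> where ps: "longitude_along (unit_tangent \<gamma>) P \<psi>" "(\<psi> P - \<psi> 0) / (2 * pi) = of_int J"
    using assms(3) unfolding has_index_def by blast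
  define d where "d t = (\<theta> t - \<psi> t) / (2 * pi)" for t
  have cont: "continuous_on {0..P} d"
    unfolding d_def using th(1) ps(1) unfolding longitude_along_def by (auto intro!: continuous_intros)
  have int: "d t \<in> \<int>" if t: "t \<in> {0..P}" for t
  proof -
    obtain a b where "de_sitter_point a (\<theta> t) = de_sitter_point b (\<psi> t)"
      using th(1) ps(1) t unfolding longitude_along_def by metis
    then have e: "cosh a * cos (\<theta> t) = cosh b * cos (\<psi> t)" "cosh a * sin (\<theta> t) = cosh b * sin (\<psi> t)"
        "sinh a = sinh b"
      by (auto simp: de_sitter_point_def vec_eq_iff forall_3)
    have "a = b" using e(3) by simp
    then have "cos (\<theta> t) = cos (\<psi> t)" "sin (\<theta> t) = sin (\<psi> t)" using e by auto
    then obtain n where "\<theta> t = \<psi> t + 2 * pi * of_int n"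
      using sin_cos_eq_iff[of "\<theta> t" "\<psi> t"] by (auto simp: algebra_simps)
    then have "d t = of_int n" unfolding d_def by simp
    then show ?thesis by simp
  qed
  have "d constant_on {0..P}"
  proof (rule continuous_discrete_range_constant[OF _ cont])
    fix x assume x: "x \<in> {0..P}"
    have "1 \<le> norm (d y - d x)" if "y \<in> {0..P}" "d y \<noteq> d x" for y
      using int[OF x] int[OF that(1)] that(2) by (auto elim!: Ints_cases simp flip: of_int_diff)
    then show "\<exists>e>0. \<forall>y. y \<in> {0..P} \<and> d y \<noteq> d x \<longrightarrow> e \<le> norm (d y - d x)"
      using zero_less_one by blast
  qed simp
  then have "d P = d 0" using assms(1) unfolding constant_on_def by auto
  then have "real_of_int I = of_int J"
    unfolding th(2)[symmetric] ps(2)[symmetric] d_def by (simp add: field_simps)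
  then show ?thesis by simp
qed

section \<open>Knots\<close>

text \<open>
  Isotopy of knots is ambient isotopy; an isotopy through embeddings alone would shrink every
  knotted arc to a point and identify every smooth knot with the unknot.
\<close>

definition ambient_isotopic :: "(real^3) set \<Rightarrow> (real^3) set \<Rightarrow> bool" where
  "ambient_isotopic K L \<longleftrightarrow>
     (\<exists>h. homotopic_with_canon (\<lambda>f. \<exists>g. homeomorphism UNIV UNIV f g) UNIV UNIV id h \<and> h ` K = L)"

definition unknot :: "(real^3) set" where
  "unknot = {x. (x$1)\<^sup>2 + (x$2)\<^sup>2 = 1 \<and> x$3 = 0}"

definition nontrivial_knot :: "(real \<Rightarrow> real^3) \<Rightarrow> real \<Rightarrow> bool" where
  "nontrivial_knot \<gamma> P \<longleftrightarrow>
     inj_on \<gamma> {0..<P} \<and> \<not> ambient_isotopic (\<gamma> ` {0..P}) unknot"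

end

theory Submission
  imports Defs
begin

text \<open>
  Write the velocity as \<open>r (cos \<theta>, sin \<theta>, h)\<close> with \<open>r > 0\<close>. Since the osculating planes are spacelike,
  \<open>\<theta>' > 0\<close>, and with \<open>h' = \<theta>' p\<close> one has \<open>h\<^sup>2 + p\<^sup>2 < 1\<close> and total curvature
  \<open>\<integral> \<theta>' sqrt (1 - h\<^sup>2 - p\<^sup>2) / (1 - h\<^sup>2)\<close>; the index condition says that \<open>\<theta>\<close> grows by \<open>4 \<pi>\<close>.
  A point \<open>v = (a, b)\<close> of the unit disc (the Klein model of the hyperbolic plane) stands for a timelike
  direction, and the height \<open>z - a x - b y\<close> has critical points along \<open>\<gamma>\<close> at the zeros of
  \<open>f\<^sub>v = h - a cos \<theta> - b sin \<theta>\<close>. A Crofton formula for the hyperbolic measure on the disc shows that the total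
  curvature is \<open>4 \<pi>\<close> minus a positive multiple of the integral of (number of zeros of \<open>f\<^sub>v\<close>) - 4.

  If some \<open>f\<^sub>v\<close> had only two sign changes, the height would be monotone on two complementary arcs of \<open>\<gamma>\<close>, and
  a level-preserving isotopy would unknot \<open>\<gamma>\<close>; hence there are at least 4 zeros. For strictness, choose \<open>v\<close>
  such that \<open>f\<^sub>v\<close> has a double zero: pushing \<open>v\<close> slightly to one side creates two additional sign changes, so
  that an open set of \<open>v\<close> yields at least 6 zeros. Such a \<open>v\<close> exists unless the tangent indicatrix is a great
  circle; then \<open>\<gamma>\<close> would be a simple plane curve of turning number 2, which is impossible.
\<close>

section \<open>Level-preserving isotopies\<close>

text \<open>The disc has infinite hyperbolic area, so the Crofton formula is cut off at a radius
  \<open>R\<close> < 1 that bounds all points (\<open>h t\<close>, \<open>p t\<close>). With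
  \<open>s = sqrt (1 - R\<^sup>2)\<close> the Crofton side is at most
  \<open>pi * (8 * pi / s - 2 * L)\<close>, while four zeros for almost every \<open>v\<close>
  contribute \<open>4 * pi * (2 * pi * (1 / s - 1))\<close>. The parts that blow up as R tends to 1
  are equal, and what remains is L <= 4 pi minus the area of the open set on which there are six
  zeros. Zeros are never counted as such. Their number is replaced by the total variation of arctan
  ((n + 1) f_v), whose weighted integral over v has a computable limit and whose lower limit for
  fixed v is at least pi per sign change; Fatou's lemma gives the inequality in the right direction.
  This avoids any discussion of finite zero sets or of a measurable counting function. A parameter v
  for which f_v vanishes on an interval would spoil the strict monotonicity of the height. Such v
  lie in a countable set, hence in a null set.\<close>

definition isotopic_sets :: "'a::topological_space set \<Rightarrow> 'a set \<Rightarrow> bool" where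
  "isotopic_sets K L \<longleftrightarrow>
     (\<exists>h. homotopic_with_canon (\<lambda>f. \<exists>g. homeomorphism UNIV UNIV f g) UNIV UNIV id h \<and> h ` K = L)"

text \<open>The relation is restated for an arbitrary space because the isotopies are built on
  \<open>complex \<times> real\<close>, where horizontal levels are complex planes, and are carried
  to \<open>real^3\<close> only at the end.\<close>

lemma ambient_isotopic_eq: "ambient_isotopic = isotopic_sets"
  by (intro ext) (simp add: ambient_isotopic_def isotopic_sets_def)

section \<open>Constructing, composing and transporting ambient isotopies\<close>

lemma isotopic_setsI:
  fixes H G :: "real \<Rightarrow> 'a::topological_space \<Rightarrow> 'a"
  assumes H: "continuous_on ({0..1} \<times> UNIV) (\<lambda>z. H (fst z) (snd z))"
    and G: "\<And>t. t \<in> {0..1} \<Longrightarrow> continuous_on UNIV (G t)"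
    and inv: "\<And>t x. t \<in> {0..1} \<Longrightarrow> H t (G t x) = x" "\<And>t x. t \<in> {0..1} \<Longrightarrow> G t (H t x) = x"
    and H0: "\<And>x. H 0 x = x"
    and K: "H 1 ` K = L"
  shows "isotopic_sets K L"
proof -
  have hom: "\<exists>g. homeomorphism UNIV UNIV (H t) g" if t: "t \<in> {0..1}" for t
  proof (intro exI[of _ "G t"] homeomorphismI)
    show "continuous_on UNIV (H t)"
      by (rule continuous_on_compose2[OF H, of UNIV "\<lambda>x. (t, x)", simplified])
         (use t in \<open>auto intro!: continuous_intros\<close>)
  qed (use G[OF t] inv t in auto)
  show ?thesis
    unfolding isotopic_sets_def homotopic_with_def
    using hom H H0 K
    by (intro exI[of _ "H 1"] conjI exI[of _ "\<lambda>z. H (fst z) (snd z)"])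
       (auto simp flip: subtopology_UNIV simp: prod_topology_subtopology_eu simp del: subtopology_UNIV)
qed

text \<open>Precomposing the second isotopy with the end map \<open>h\<close> of the first makes it
  start where the first one stops.\<close>

lemma isotopic_sets_trans:
  assumes "isotopic_sets K L" "isotopic_sets L M"
  shows "isotopic_sets K M"
proof -
  let ?P = "\<lambda>f::'a \<Rightarrow> 'a. \<exists>g. homeomorphism UNIV UNIV f g"
  obtain h where h: "homotopic_with_canon ?P UNIV UNIV id h" "h ` K = L"
    using assms(1) unfolding isotopic_sets_def by blast
  obtain k where k: "homotopic_with_canon ?P UNIV UNIV id k" "k ` L = M"
    using assms(2) unfolding isotopic_sets_def by blast
  have "?P h" using homotopic_with_imp_property[OF h(1)] by blast
  then obtain h' where h': "homeomorphism UNIV UNIV h h'" by blast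
  then have ch: "continuous_on UNIV h" by (rule homeomorphism_cont1)
  have "homotopic_with_canon ?P UNIV UNIV (id \<circ> h) (k \<circ> h)"
  proof (rule homotopic_with_compose_continuous_right[OF _ ch])
    show "homotopic_with_canon (\<lambda>f. ?P (f \<circ> h)) UNIV UNIV id k"
      by (rule homotopic_with_mono[OF k(1)]) (use homeomorphism_compose[OF h'] in blast)
  qed auto
  then have "homotopic_with_canon ?P UNIV UNIV id (k \<circ> h)"
    using h(1) homotopic_with_trans by auto
  then show ?thesis
    unfolding isotopic_sets_def using h(2) k(2) by (metis image_comp)
qed

lemma isotopic_sets_transport:
  fixes J :: "'a::topological_space \<Rightarrow> 'b::topological_space"
  assumes J: "homeomorphism UNIV UNIV J J'" and KL: "isotopic_sets K L"
  shows "isotopic_sets (J ` K) (J ` L)"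
proof -
  let ?P = "\<lambda>f::'a \<Rightarrow> 'a. \<exists>g. homeomorphism UNIV UNIV f g"
  let ?Q = "\<lambda>f::'b \<Rightarrow> 'b. \<exists>g. homeomorphism UNIV UNIV f g"
  obtain h where h: "homotopic_with_canon ?P UNIV UNIV id h" "h ` K = L"
    using KL unfolding isotopic_sets_def by blast
  have JJ: "J' (J x) = x" "J (J' y) = y" for x y using J by (auto simp: homeomorphism_def)
  have PQ: "?Q (J \<circ> f \<circ> J')" if "?P f" for f
    using that homeomorphism_compose[OF homeomorphism_compose[OF homeomorphism_symD[OF J]] J]
    by (metis comp_assoc)
  have "homotopic_with_canon ?Q UNIV UNIV (J \<circ> (id \<circ> J')) (J \<circ> (h \<circ> J'))"
    using J PQ
    by (intro homotopic_with_compose_continuous_left[where Y = UNIV]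
        homotopic_with_compose_continuous_right[where X = UNIV] homotopic_with_mono[OF h(1)])
       (auto simp: homeomorphism_def comp_assoc)
  moreover have "J \<circ> (id \<circ> J') = id" using JJ by auto
  moreover have "(J \<circ> (h \<circ> J')) ` (J ` K) = J ` L" using JJ h(2) by (auto simp: image_iff)
  ultimately show ?thesis
    unfolding isotopic_sets_def by (intro exI[of _ "J \<circ> (h \<circ> J')"] conjI) metis+
qed

text \<open>Squeezing by \<open>B\<close> at the points outside \<open>U\<close>. The twist and
  stretch maps divide by a width that vanishes at the top and bottom levels; their displacement is
  bounded by that width, and this is all that is available there.\<close>

lemma continuous_on_extend_zero:
  fixes F :: "'a::t2_space \<Rightarrow> 'b::real_normed_vector"
  assumes U: "open U" and F: "continuous_on U F" and B: "continuous_on UNIV B"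
    and le: "\<And>x. norm (F x) \<le> B x" and 0: "\<And>x. x \<notin> U \<Longrightarrow> B x = 0"
  shows "continuous_on UNIV F"
proof -
  have "isCont F x" for x
  proof (cases "x \<in> U")
    case True
    then show ?thesis using F U by (simp add: continuous_on_eq_continuous_at)
  next
    case False
    have Bx: "(B \<longlongrightarrow> 0) (at x)"
      using B 0[OF False] by (metis UNIV_I continuous_on_def)
    have "F x = 0" using le[of x] 0[OF False] by simp
    moreover have "(F \<longlongrightarrow> 0) (at x)"
      by (rule Lim_null_comparison[OF _ Bx]) (simp add: le)
    ultimately show ?thesis by (simp add: isCont_def)
  qed
  then show ?thesis by (simp add: continuous_at_imp_continuous_on)
qed

section \<open>Elementary isotopies: shear, translation of levels, twist, stretch, round
  circle\<close>

lemma isotopic_sets_shear: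
  fixes l :: "'a::real_normed_vector \<Rightarrow> real"
  assumes l: "continuous_on UNIV l"
  shows "isotopic_sets K ((\<lambda>(w, z). (w, z - l w)) ` K)"
proof (rule isotopic_setsI[where H = "\<lambda>t (w, z). (w, z - t * l w)" and G = "\<lambda>t (w, z). (w, z + t * l w)"])
  note [continuous_intros] = continuous_on_compose2[OF l, OF _ subset_UNIV]
  show "continuous_on ({0..1} \<times> UNIV) (\<lambda>z. case snd z of (w, za) \<Rightarrow> (w, za - fst z * l w))"
    by (simp add: case_prod_unfold) (intro continuous_intros)
  show "continuous_on UNIV (\<lambda>(w, z). (w, z + t * l w))" for t
    by (simp add: case_prod_unfold) (intro continuous_intros)
qed auto

lemma isotopic_sets_level_translation:
  fixes m :: "real \<Rightarrow> 'a::real_normed_vector"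
  assumes m: "continuous_on UNIV m"
  shows "isotopic_sets K ((\<lambda>(w, z). (w - m z, z)) ` K)"
proof (rule isotopic_setsI[where H = "\<lambda>t (w, z). (w - t *\<^sub>R m z, z)" and G = "\<lambda>t (w, z). (w + t *\<^sub>R m z, z)"])
  note [continuous_intros] = continuous_on_compose2[OF m, OF _ subset_UNIV]
  show "continuous_on ({0..1} \<times> UNIV) (\<lambda>z. case snd z of (w, za) \<Rightarrow> (w - fst z *\<^sub>R m za, za))"
    by (simp add: case_prod_unfold) (intro continuous_intros)
  show "continuous_on UNIV (\<lambda>(w, z). (w + t *\<^sub>R m z, z))" for t
    by (simp add: case_prod_unfold) (intro continuous_intros)
qed auto

text \<open>The rotation of the level \<open>z\<close> by the angle \<open>s * \<alpha> z\<close> is cut off outside the disc of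
  radius \<open>r z\<close>; since these discs shrink to points at both ends, no limit of \<open>\<alpha>\<close> is needed.\<close>

definition twist :: "(real \<Rightarrow> real) \<Rightarrow> (real \<Rightarrow> real) \<Rightarrow> real \<Rightarrow> complex \<times> real \<Rightarrow> complex \<times> real" where
  "twist \<alpha> r s = (\<lambda>(w, z). (w * cis (s * \<alpha> z * max 0 (min 1 (2 - 2 * cmod w / r z))), z))"

lemma twist_inverse: "twist \<alpha> r s (twist \<alpha> r (- s) x) = x"
  by (cases x) (simp add: twist_def norm_mult cis_mult mult.assoc)

lemma continuous_twist:
  assumes r: "continuous_on UNIV r" and \<alpha>: "continuous_on {a<..<b} \<alpha>"
    and r0: "\<And>z. z \<in> {a<..<b} \<Longrightarrow> r z > 0" "\<And>z. z \<notin> {a<..<b} \<Longrightarrow> r z = 0 \<and> \<alpha> z = 0"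
  shows "continuous_on UNIV (\<lambda>x. twist \<alpha> r (fst x) (snd x))"
proof -
  \<comment> \<open>\<open>?d\<close> is the displacement of the twist. It is zero where
    \<open>cmod w \<ge> r z\<close>, by the cutoff, and elsewhere at most 2 \<open>r z\<close>,
    since a rotation moves \<open>w\<close> by at most twice its modulus. So it dies out as the
    discs shrink.\<close>
  let ?d = "\<lambda>x::real \<times> complex \<times> real. fst (snd x) *
     (cis (fst x * \<alpha> (snd (snd x)) * max 0 (min 1 (2 - 2 * cmod (fst (snd x)) / r (snd (snd x))))) - 1)"
  let ?U = "UNIV \<times> UNIV \<times> {a<..<b} :: (real \<times> complex \<times> real) set"
  have d: "continuous_on UNIV ?d"
  proof (rule continuous_on_extend_zero[of ?U _ "\<lambda>x. 2 * r (snd (snd x))"])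
    have *: "continuous_on ?U (\<lambda>x. \<alpha> (snd (snd x)))" "continuous_on ?U (\<lambda>x. r (snd (snd x)))"
      by (rule continuous_on_compose2[OF \<alpha>] continuous_on_compose2[OF r]; auto intro!: continuous_intros)+
    have **: "r (snd (snd x)) \<noteq> 0" if "x \<in> ?U" for x
      using r0(1)[of "snd (snd x)"] that by auto
    show "continuous_on ?U ?d"
      by (intro continuous_intros continuous_on_cis * ballI **)
    show "continuous_on UNIV (\<lambda>x. 2 * r (snd (snd x)))"
      by (intro continuous_intros continuous_on_compose2[OF r]) auto
    show "open ?U" by (intro open_Times) auto
    show "2 * r (snd (snd x)) = 0" if "x \<notin> ?U" for x
      using that r0(2)[of "snd (snd x)"] by (cases x) auto
    show "norm (?d x) \<le> 2 * r (snd (snd x))" for x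
    proof (cases "snd (snd x) \<in> {a<..<b}")
      case True
      then have rp: "r (snd (snd x)) > 0" using r0(1) by blast
      show ?thesis
      proof (cases "cmod (fst (snd x)) \<ge> r (snd (snd x))")
        case True
        then have "2 - 2 * cmod (fst (snd x)) / r (snd (snd x)) \<le> 0" using rp by (simp add: field_simps)
        then show ?thesis using rp by simp
      next
        case False
        have "cmod (cis y - 1) \<le> 2" for y
          using norm_triangle_ineq4[of "cis y" 1] by simp
        then have "norm (?d x) \<le> r (snd (snd x)) * 2"
          unfolding norm_mult using False rp by (intro mult_mono) auto
        then show ?thesis by simp
      qed
    qed (use r0(2)[of "snd (snd x)"] in auto)
  qed
  have "continuous_on UNIV (\<lambda>x. (fst (snd x) + ?d x, snd (snd x)))"
    by (intro continuous_on_Pair continuous_on_add d continuous_on_fst continuous_on_snd continuous_on_id)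
  then show ?thesis by (simp add: twist_def case_prod_unfold algebra_simps)
qed

lemma isotopic_sets_twist:
  assumes "continuous_on UNIV r" "continuous_on {a<..<b} \<alpha>"
    and "\<And>z. z \<in> {a<..<b} \<Longrightarrow> r z > 0" "\<And>z. z \<notin> {a<..<b} \<Longrightarrow> r z = 0 \<and> \<alpha> z = 0"
  shows "isotopic_sets K (twist \<alpha> r (- 1) ` K)"
proof (rule isotopic_setsI[where H = "\<lambda>t. twist \<alpha> r (- t)" and G = "twist \<alpha> r"])
  note c = continuous_twist[OF assms]
  show "continuous_on ({0..1} \<times> UNIV) (\<lambda>z. twist \<alpha> r (- fst z) (snd z))"
  proof -
    have "continuous_on ({0..1::real} \<times> (UNIV :: (complex \<times> real) set)) (\<lambda>z. (- fst z, snd z))"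
      by (intro continuous_intros)
    from continuous_on_compose2[OF c this] show ?thesis by simp
  qed
  show "continuous_on UNIV (twist \<alpha> r t)" for t
  proof -
    have "continuous_on (UNIV :: (complex \<times> real) set) (\<lambda>z. (t, z))"
      by (intro continuous_intros)
    from continuous_on_compose2[OF c this] show ?thesis by simp
  qed
  show "twist \<alpha> r (- t) (twist \<alpha> r t x) = x" for t x
    using twist_inverse[of \<alpha> r "- t"] by simp
  show "twist \<alpha> r (- 0) x = x" for x
    by (cases x) (simp add: twist_def)
qed (use twist_inverse in auto)

text \<open>The piecewise linear homeomorphism of the line that takes [-A, A] onto [-B, B] and
  shifts both outer rays. Its displacement is at most \<open>\<bar>B - A\<bar>\<close>, so it
  extends continuously to levels where both widths are zero; there division by zero makes it the
  identity.\<close>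

definition stretch :: "real \<Rightarrow> real \<Rightarrow> real \<Rightarrow> real" where
  "stretch A B x = x + (B - A) * max (- 1) (min 1 (x / A))"

lemma stretch_inverse:
  assumes "A > 0" "B > 0"
  shows "stretch B A (stretch A B x) = x"
proof -
  consider "x > A" | "x < - A" | "- A \<le> x" "x \<le> A" by linarith
  then show ?thesis
  proof cases
    case 1
    then have "min 1 (x / A) = 1" "min 1 ((x + (B - A)) / B) = 1" using assms by (auto simp: field_simps)
    then show ?thesis by (simp add: stretch_def)
  next
    case 2
    then have "max (- 1) (min 1 (x / A)) = - 1" "max (- 1) (min 1 ((x + (A - B)) / B)) = - 1"
      using assms by (auto simp: field_simps min_def max_def)
    then show ?thesis by (simp add: stretch_def)
  next
    case 3
    then have "max (- 1) (min 1 (x / A)) = x / A" using assms by (auto simp: field_simps min_def max_def)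
    moreover have "x + (B - A) * (x / A) = x / A * B" using assms by (simp add: field_simps)
    ultimately show ?thesis using assms by (simp add: stretch_def) (simp add: field_simps)
  qed
qed

lemma stretch_self: "stretch A A x = x" and stretch_end: "A > 0 \<Longrightarrow> stretch A B A = B"
  "A > 0 \<Longrightarrow> stretch A B (- A) = - B"
  by (auto simp: stretch_def)

lemma continuous_stretch:
  fixes A B f :: "'a::t2_space \<Rightarrow> real"
  assumes U: "open U" and A: "continuous_on UNIV A" and B: "continuous_on UNIV B"
    and f: "continuous_on UNIV f"
    and pos: "\<And>x. x \<in> U \<Longrightarrow> A x > 0" and zero: "\<And>x. x \<notin> U \<Longrightarrow> A x = 0 \<and> B x = 0"
  shows "continuous_on UNIV (\<lambda>x. stretch (A x) (B x) (f x))"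
proof -
  let ?d = "\<lambda>x. (B x - A x) * max (- 1) (min 1 (f x / A x))"
  have "continuous_on UNIV ?d"
  proof (rule continuous_on_extend_zero[OF U, of _ "\<lambda>x. \<bar>B x - A x\<bar>"])
    have "A x \<noteq> 0" if "x \<in> U" for x using pos[OF that] by simp
    then show "continuous_on U ?d"
      by (intro continuous_intros ballI continuous_on_subset[OF A] continuous_on_subset[OF B]
          continuous_on_subset[OF f]) auto
    show "norm (?d x) \<le> \<bar>B x - A x\<bar>" for x
      by (auto simp: abs_mult intro!: mult_left_le)
  qed (use A B zero in \<open>auto intro!: continuous_intros\<close>)
  then show ?thesis unfolding stretch_def by (intro continuous_on_add f)
qed

lemma isotopic_sets_stretch:
  fixes A B :: "real \<Rightarrow> real"
  assumes A: "continuous_on UNIV A" and B: "continuous_on UNIV B"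
    and pos: "\<And>z. z \<in> {a<..<b} \<Longrightarrow> A z > 0 \<and> B z > 0"
    and zero: "\<And>z. z \<notin> {a<..<b} \<Longrightarrow> A z = 0 \<and> B z = 0"
  shows "isotopic_sets K ((\<lambda>(w, z). (Complex (stretch (A z) (B z) (Re w)) (Im w), z)) ` K)"
proof (rule isotopic_setsI[where
      H = "\<lambda>t (w, z). (Complex (stretch (A z) (A z + t * (B z - A z)) (Re w)) (Im w), z)" and
      G = "\<lambda>t (w, z). (Complex (stretch (A z + t * (B z - A z)) (A z) (Re w)) (Im w), z)"])
  note [continuous_intros] = continuous_on_compose2[OF A, OF _ subset_UNIV] continuous_on_compose2[OF B, OF _ subset_UNIV]
  have mid: "A z + t * (B z - A z) > 0" if "z \<in> {a<..<b}" "t \<in> {0..1}" for z t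
  proof -
    have "A z + t * (B z - A z) = (1 - t) * A z + t * B z" by (simp add: algebra_simps)
    moreover have "(1 - t) * A z \<ge> 0" "t * B z \<ge> 0" using that pos[OF that(1)] by auto
    moreover have "(1 - t) * A z > 0 \<or> t * B z > 0" using that pos[OF that(1)] by (cases "t = 0") auto
    ultimately show ?thesis by linarith
  qed
  have "continuous_on UNIV (\<lambda>x::real \<times> complex \<times> real.
      stretch (A (snd (snd x))) (A (snd (snd x)) + fst x * (B (snd (snd x)) - A (snd (snd x)))) (Re (fst (snd x))))"
  proof (rule continuous_stretch[of "UNIV \<times> UNIV \<times> {a<..<b}"])
    show "open (UNIV \<times> UNIV \<times> {a<..<b} :: (real \<times> complex \<times> real) set)"
      by (intro open_Times) auto
    show "A (snd (snd x)) > 0" if "x \<in> UNIV \<times> UNIV \<times> {a<..<b}" for x :: "real \<times> complex \<times> real"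
      using that pos[of "snd (snd x)"] by (cases x) auto
    show "A (snd (snd x)) = 0 \<and> A (snd (snd x)) + fst x * (B (snd (snd x)) - A (snd (snd x))) = 0"
      if "x \<notin> UNIV \<times> UNIV \<times> {a<..<b}" for x :: "real \<times> complex \<times> real"
      using that zero[of "snd (snd x)"] by (cases x) auto
  qed (intro continuous_intros)+
  then have "continuous_on UNIV (\<lambda>x::real \<times> complex \<times> real.
      (Complex (stretch (A (snd (snd x))) (A (snd (snd x)) + fst x * (B (snd (snd x)) - A (snd (snd x)))) (Re (fst (snd x)))) (Im (fst (snd x))), snd (snd x)))"
    unfolding Complex_eq by (intro continuous_intros)
  then show "continuous_on ({0..1} \<times> UNIV) (\<lambda>x. (\<lambda>(w, z). (Complex (stretch (A z) (A z + fst x * (B z - A z)) (Re w)) (Im w), z)) (snd x))"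
    by (auto simp: case_prod_unfold elim: continuous_on_subset)
  show "continuous_on UNIV (\<lambda>(w, z). (Complex (stretch (A z + t * (B z - A z)) (A z) (Re w)) (Im w), z))"
    if t: "t \<in> {0..1}" for t
  proof -
    have "continuous_on UNIV (\<lambda>x::complex \<times> real.
        stretch (A (snd x) + t * (B (snd x) - A (snd x))) (A (snd x)) (Re (fst x)))"
    proof (rule continuous_stretch[of "UNIV \<times> {a<..<b}"])
      show "open (UNIV \<times> {a<..<b} :: (complex \<times> real) set)"
        by (intro open_Times) auto
      show "0 < A (snd x) + t * (B (snd x) - A (snd x))" if "x \<in> UNIV \<times> {a<..<b}" for x :: "complex \<times> real"
        using mid[OF _ t, of "snd x"] that by auto
      show "A (snd x) + t * (B (snd x) - A (snd x)) = 0 \<and> A (snd x) = 0"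
        if "x \<notin> UNIV \<times> {a<..<b}" for x :: "complex \<times> real"
        using that zero[of "snd x"] by (cases x) auto
    qed (intro continuous_intros)+
    then show ?thesis unfolding Complex_eq case_prod_unfold by (intro continuous_intros)
  qed
  fix t :: real and x :: "complex \<times> real" assume t: "t \<in> {0..1}"
  obtain w z where x: "x = (w, z)" by force
  show "(\<lambda>(w, z). (Complex (stretch (A z) (A z + t * (B z - A z)) (Re w)) (Im w), z))
      ((\<lambda>(w, z). (Complex (stretch (A z + t * (B z - A z)) (A z) (Re w)) (Im w), z)) x) = x"
    unfolding x using mid[OF _ t, of z] pos[of z] zero[of z]
    by (cases "z \<in> {a<..<b}") (simp_all add: stretch_inverse stretch_self)
  show "(\<lambda>(w, z). (Complex (stretch (A z + t * (B z - A z)) (A z) (Re w)) (Im w), z))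
      ((\<lambda>(w, z). (Complex (stretch (A z) (A z + t * (B z - A z)) (Re w)) (Im w), z)) x) = x"
    unfolding x using mid[OF _ t, of z] pos[of z] zero[of z]
    by (cases "z \<in> {a<..<b}") (simp_all add: stretch_inverse stretch_self)
qed (auto simp: stretch_self)

text \<open>Three motions run at once in \<open>H\<close>: the centre is translated to the origin,
  the vertical plane is turned by a right angle about the real axis, and everything is scaled by
  \<open>l\<close>, which goes linearly from 1 to 1 / \<open>\<rho>\<close>.\<close>

lemma isotopic_sets_circle:
  fixes c \<rho> :: real
  assumes \<rho>: "\<rho> > 0"
  shows "isotopic_sets {(w, z). Im w = 0 \<and> (Re w)\<^sup>2 + (z - c)\<^sup>2 = \<rho>\<^sup>2} {(w, z). (Re w)\<^sup>2 + (Im w)\<^sup>2 = 1 \<and> z = 0}"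
proof -
  define l where "l t = 1 + t * (1 / \<rho> - 1)" for t
  have l: "l t > 0" if "t \<in> {0..1}" for t
  proof -
    have "l t = (1 - t) + t / \<rho>" by (simp add: l_def algebra_simps)
    moreover have "1 - t > 0 \<or> t / \<rho> > 0" "1 - t \<ge> 0" "t / \<rho> \<ge> 0" using that \<rho> by (cases "t = 0"; auto)+
    ultimately show ?thesis by linarith
  qed
  have l1: "l 1 = 1 / \<rho>" by (simp add: l_def)
  define H where "H t = (\<lambda>(w, z). (Complex (l t * Re w) (l t * (Im w * cos (t * (pi / 2)) - (z - t * c) * sin (t * (pi / 2)))),
      l t * (Im w * sin (t * (pi / 2)) + (z - t * c) * cos (t * (pi / 2)))))" for t
  define G where "G t = (\<lambda>(w, z). (Complex (Re w / l t) ((Im w * cos (t * (pi / 2)) + z * sin (t * (pi / 2))) / l t),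
      (z * cos (t * (pi / 2)) - Im w * sin (t * (pi / 2))) / l t + t * c))" for t
  have rot0: "(y * c + x * s) * c - (x * c - y * s) * s = y"
    "(y * c + x * s) * s + (x * c - y * s) * c = x"
    "(y * c - x * s) * c + (y * s + x * c) * s = y"
    "(y * s + x * c) * c - (y * c - x * s) * s = x"
    if "c * c + s * s = 1" for x y c s :: real
  proof -
    have "(y * c + x * s) * c - (x * c - y * s) * s = y * (c * c + s * s)" by (simp add: algebra_simps)
    then show "(y * c + x * s) * c - (x * c - y * s) * s = y" by (simp add: that)
    have "(y * c + x * s) * s + (x * c - y * s) * c = x * (c * c + s * s)" by (simp add: algebra_simps)
    then show "(y * c + x * s) * s + (x * c - y * s) * c = x" by (simp add: that)
    have "(y * c - x * s) * c + (y * s + x * c) * s = y * (c * c + s * s)" by (simp add: algebra_simps)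
    then show "(y * c - x * s) * c + (y * s + x * c) * s = y" by (simp add: that)
    have "(y * s + x * c) * c - (y * c - x * s) * s = x * (c * c + s * s)" by (simp add: algebra_simps)
    then show "(y * s + x * c) * c - (y * c - x * s) * s = x" by (simp add: that)
  qed
  note rot = rot0[OF sin_cos_squared_add3]
  show ?thesis
  proof (rule isotopic_setsI[where H = H and G = G])
    show "continuous_on ({0..1} \<times> UNIV) (\<lambda>z. H (fst z) (snd z))"
      unfolding H_def l_def case_prod_unfold Complex_eq by (intro continuous_intros)
    show "continuous_on UNIV (G t)" if "t \<in> {0..1}" for t
      unfolding G_def case_prod_unfold Complex_eq using l[OF that] by (intro continuous_intros) auto
    show "H t (G t x) = x" if "t \<in> {0..1}" for t x
    proof -
      have "l t * (p / l t * q - r / l t * s) = p * q - r * s" "l t * (p / l t * q + r / l t * s) = p * q + r * s" "l t * (p / l t) = p" for p q r s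
        using l[OF that] by (auto simp: algebra_simps)
      then show ?thesis
        using less_imp_neq[OF l[OF that]] by (cases x) (simp add: H_def G_def complex_eq_iff rot del: times_divide_eq_right)
    qed
    show "G t (H t x) = x" if "t \<in> {0..1}" for t x
    proof -
      have "(l t * p * q + l t * r * s) / l t = p * q + r * s" "(l t * p * q - l t * r * s) / l t = p * q - r * s" for p q r s
        using l[OF that] by (auto simp: field_simps)
      then show ?thesis
        using less_imp_neq[OF l[OF that]] by (cases x) (simp add: H_def G_def complex_eq_iff rot del: times_divide_eq_right)
    qed
    show "H 0 x = x" for x by (cases x) (simp add: H_def l_def)
    show "H 1 ` {(w, z). Im w = 0 \<and> (Re w)\<^sup>2 + (z - c)\<^sup>2 = \<rho>\<^sup>2} = {(w, z). (Re w)\<^sup>2 + (Im w)\<^sup>2 = 1 \<and> z = 0}" (is "H 1 ` ?K = ?L")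
    proof
      show "H 1 ` ?K \<subseteq> ?L"
        using \<rho> by (auto simp: H_def l1 power_divide power2_commute[of c] field_simps)
      show "?L \<subseteq> H 1 ` ?K"
      proof
        fix x assume "x \<in> ?L"
        then obtain w where w: "x = (w, 0)" "(Re w)\<^sup>2 + (Im w)\<^sup>2 = 1" by auto
        have "x = H 1 (Complex (\<rho> * Re w) 0, c - \<rho> * Im w)"
          using \<rho> by (simp add: w(1) H_def l1 complex_eq_iff)
        moreover have "(\<rho> * Re w)\<^sup>2 + (\<rho> * Im w)\<^sup>2 = \<rho>\<^sup>2"
          using w(2) by (metis distrib_left mult.right_neutral power_mult_distrib)
        ultimately show "x \<in> H 1 ` ?K" by auto
      qed
    qed
  qed
qed

text \<open>A closed braid-like pair of strands unwinds level by level: the midpoint is moved to the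
  axis (\<open>K1\<close>), the connecting segment is rotated into the real direction
  (\<open>K2\<close>), and its length is adjusted to that of a chord of a round circle
  (\<open>K3\<close>). The number of windings may be infinite near the ends, which is why the twist
  has to be cut off.\<close>

lemma isotopic_sets_two_strands:
  fixes p q :: "real \<Rightarrow> complex"
  assumes ab: "a < b" and p: "continuous_on {a..b} p" and q: "continuous_on {a..b} q"
    and ends: "p a = q a" "p b = q b" and ne: "\<And>z. z \<in> {a<..<b} \<Longrightarrow> p z \<noteq> q z"
  shows "isotopic_sets ((\<lambda>z. (p z, z)) ` {a..b} \<union> (\<lambda>z. (q z, z)) ` {a..b})
           {(w, z). (Re w)\<^sup>2 + (Im w)\<^sup>2 = 1 \<and> z = 0}"
proof -
  let ?S = "{1, -1} \<times> {a..b} :: (real \<times> real) set"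
  \<comment> \<open>Clamping the level to [a, b] extends both strands to all levels. Since they
    agree at both ends, their difference \<open>d\<close> is zero outside the open interval.\<close>
  define k where "k z = max a (min b z)" for z
  have k: "k z \<in> {a..b}" "z \<in> {a..b} \<Longrightarrow> k z = z" "z \<notin> {a<..<b} \<Longrightarrow> k z = a \<or> k z = b" for z
    using ab by (auto simp: k_def)
  have ck: "continuous_on UNIV k" unfolding k_def by (intro continuous_intros)
  have cp: "continuous_on UNIV (\<lambda>z. p (k z))" and cq: "continuous_on UNIV (\<lambda>z. q (k z))"
    using k(1) by (auto intro!: continuous_on_compose2[OF p ck] continuous_on_compose2[OF q ck])
  define m where "m z = (p (k z) + q (k z)) / 2" for z
  define d where "d z = q (k z) - p (k z)" for z
  define r where "r z = cmod (d z)" for z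
  have cm: "continuous_on UNIV m" and cd: "continuous_on UNIV d"
    unfolding m_def d_def
    by (intro continuous_on_divide continuous_on_add continuous_on_diff continuous_on_const cp cq; simp)+
  then have cr: "continuous_on UNIV r" unfolding r_def by (intro continuous_intros)
  have dne: "d z \<noteq> 0" if "z \<in> {a<..<b}" for z
    using ne[OF that] k(2)[of z] that by (simp add: d_def)
  have r0: "r z = 0" if "z \<notin> {a<..<b}" for z
    using k(3)[OF that] ends by (auto simp: r_def d_def)
  have rp: "r z > 0" if "z \<in> {a<..<b}" for z using dne[OF that] by (simp add: r_def)
  \<comment> \<open>A continuous logarithm of \<open>d\<close> supplies a continuous angle. It
    exists only on the open interval, because \<open>d\<close> vanishes at the ends and the angle
    may diverge there.\<close>
  obtain g where g: "continuous_on {a<..<b} g" "\<And>z. z \<in> {a<..<b} \<Longrightarrow> d z = exp (g z)"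
    using continuous_logarithm_on_contractible[OF continuous_on_subset[OF cd subset_UNIV]
        convex_imp_contractible[of "{a<..<b}"]] dne by (metis convex_real_interval(8))
  define \<alpha> where "\<alpha> z = (if z \<in> {a<..<b} then Im (g z) else 0)" for z
  have c\<alpha>: "continuous_on {a<..<b} \<alpha>"
    using continuous_on_Im[OF g(1)] by (rule continuous_on_eq) (simp add: \<alpha>_def)
  have r\<alpha>0: "r z = 0 \<and> \<alpha> z = 0" if "z \<notin> {a<..<b}" for z
    using r0[OF that] that by (auto simp: \<alpha>_def)
  have d_polar: "d z = of_real (r z) * cis (\<alpha> z)" if "z \<in> {a<..<b}" for z
    using g(2)[OF that] that by (simp add: r_def \<alpha>_def exp_eq_polar norm_mult)
  \<comment> \<open>Half the chord at level z of the circle with diameter [a, b].\<close>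
  define B where "B z = sqrt (max 0 ((z - a) * (b - z)))" for z
  have cB: "continuous_on UNIV B" unfolding B_def by (intro continuous_intros)
  have Bp: "B z > 0" if "z \<in> {a<..<b}" for z using that by (simp add: B_def)
  have B0: "B z = 0" if "z \<notin> {a<..<b}" for z
    using that ab by (auto simp: B_def max_def zero_le_mult_iff)
  let ?K = "(\<lambda>z. (p z, z)) ` {a..b} \<union> (\<lambda>z. (q z, z)) ` {a..b}"
  have K: "?K = (\<lambda>(e, z). (m z + of_real e * d z / 2, z)) ` ?S" (is "_ = ?K0")
  proof -
    have "m z + d z / 2 = q z" "m z - d z / 2 = p z" if "z \<in> {a..b}" for z
      using k(2)[OF that] by (simp_all add: m_def d_def field_simps)
    then show ?thesis by (force simp: image_iff)
  qed
  define K1 where "K1 = (\<lambda>(e, z). (of_real e * d z / 2, z)) ` ?S"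
  define K2 where "K2 = (\<lambda>(e, z). (of_real (e * r z / 2) :: complex, z)) ` ?S"
  define K3 where "K3 = (\<lambda>(e, z). (of_real (e * B z) :: complex, z)) ` ?S"
  have "(\<lambda>(w, z). (w - m z, z)) ` ?K0 = K1"
    unfolding K1_def image_image by (intro image_cong) auto
  then have 1: "isotopic_sets ?K0 K1"
    using isotopic_sets_level_translation[OF cm, of ?K0] by simp
  have "twist \<alpha> r (- 1) ` K1 = K2"
    unfolding K1_def K2_def image_image
  proof (intro image_cong refl, clarify)
    fix e z :: real assume e: "e \<in> {1, -1}" and z: "z \<in> {a..b}"
    show "twist \<alpha> r (- 1) (complex_of_real e * d z / 2, z) = (complex_of_real (e * r z / 2), z)"
    proof (cases "z \<in> {a<..<b}")
      case True
      \<comment> \<open>At modulus \<open>r z / 2\<close> the cutoff factor in \<open>twist\<close>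
        is exactly 1, so the strands are rotated by the full angle.\<close>
      have "cmod (complex_of_real e * d z / 2) = r z / 2"
        using e by (auto simp: r_def norm_mult norm_divide)
      then show ?thesis
        using rp[OF True] by (simp add: twist_def d_polar[OF True] cis_mult)
    next
      case False
      then have "d z = 0" using r0 by (simp add: r_def)
      then show ?thesis using r0[OF False] by (simp add: twist_def)
    qed
  qed
  then have 2: "isotopic_sets K1 K2"
    using isotopic_sets_twist[OF cr c\<alpha> rp, of K1] r\<alpha>0 by simp
  have "(\<lambda>(w, z). (Complex (stretch (r z / 2) (B z) (Re w)) (Im w), z)) ` K2 = K3"
    unfolding K2_def K3_def image_image
  proof (intro image_cong refl)
    fix x :: "real \<times> real" assume "x \<in> ?S"
    then obtain e z where x: "x = (e, z)" and e: "e \<in> {1, -1}" by blast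
    have "stretch (r z / 2) (B z) (e * r z / 2) = e * B z"
    proof (cases "z \<in> {a<..<b}")
      case True
      then show ?thesis using e rp[OF True] stretch_end[of "r z / 2" "B z"] by auto
    next
      case False
      then show ?thesis using r0 B0 by (simp add: stretch_self)
    qed
    then show "(\<lambda>(w, z). (Complex (stretch (r z / 2) (B z) (Re w)) (Im w), z)) ((\<lambda>(e, z). (of_real (e * r z / 2), z)) x)
        = (\<lambda>(e, z). (of_real (e * B z), z)) x"
      by (simp add: x complex_eq_iff)
  qed
  then have 3: "isotopic_sets K2 K3"
    using isotopic_sets_stretch[of "\<lambda>z. r z / 2" B a b K2] cr cB rp Bp r0 B0
    by (simp add: continuous_intros)
  have "K3 = {(w, z). Im w = 0 \<and> (Re w)\<^sup>2 + (z - (a + b) / 2)\<^sup>2 = ((b - a) / 2)\<^sup>2}" (is "_ = ?C")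
  proof
    have sq: "(B z)\<^sup>2 = (z - a) * (b - z)" if "z \<in> {a..b}" for z
      using that by (simp add: B_def max_def)
    have id: "(z - a) * (b - z) + (z - (a + b) / 2)\<^sup>2 = ((b - a) / 2)\<^sup>2" for z
      by (simp add: power2_eq_square field_simps)
    show "K3 \<subseteq> ?C"
      using sq id by (auto simp: K3_def)
    show "?C \<subseteq> K3"
    proof clarify
      fix w z assume w: "Im w = 0" and eq: "(Re w)\<^sup>2 + (z - (a + b) / 2)\<^sup>2 = ((b - a) / 2)\<^sup>2"
      have rw: "(Re w)\<^sup>2 = (z - a) * (b - z)" using eq id[of z] by linarith
      have "(z - a) * (b - z) \<ge> 0" unfolding rw[symmetric] by simp
      then have z: "z \<in> {a..b}" using ab by (auto simp: zero_le_mult_iff)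
      have "(Re w)\<^sup>2 = (B z)\<^sup>2" using rw sq[OF z] by simp
      then have "Re w = B z \<or> Re w = - B z" by (simp add: power2_eq_iff)
      then have "w = of_real (1 * B z) \<or> w = of_real ((- 1) * B z)" using w by (auto simp: complex_eq_iff)
      then show "(w, z) \<in> K3"
      proof
        assume "w = of_real (1 * B z)"
        then show ?thesis unfolding K3_def using z by (intro image_eqI[of _ _ "(1, z)"]) auto
      next
        assume "w = of_real ((- 1) * B z)"
        then show ?thesis unfolding K3_def using z by (intro image_eqI[of _ _ "(- 1, z)"]) auto
      qed
    qed
  qed
  then have 4: "isotopic_sets K3 {(w, z). (Re w)\<^sup>2 + (Im w)\<^sup>2 = 1 \<and> z = 0}"
    using isotopic_sets_circle[of "(b - a) / 2" "(a + b) / 2"] ab by simp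
  show ?thesis
    unfolding K by (rule isotopic_sets_trans[OF 1 isotopic_sets_trans[OF 2 isotopic_sets_trans[OF 3 4]]])
qed

text \<open>A monotone arc is a graph over its height: \<open>X\<close> is \<open>x\<close> composed
  with the inverse of \<open>y\<close>, which is continuous by compactness. In this form two arcs
  can be compared level by level.\<close>

lemma strict_mono_strand:
  fixes y :: "real \<Rightarrow> real" and x :: "real \<Rightarrow> 'a::topological_space"
  assumes "a \<le> b" "continuous_on {a..b} y" "continuous_on {a..b} x" "strict_mono_on {a..b} y"
  obtains X where "continuous_on {y a..y b} X" "\<And>t. t \<in> {a..b} \<Longrightarrow> X (y t) = x t" "y ` {a..b} = {y a..y b}"
proof -
  have im: "y ` {a..b} = {y a..y b}"
  proof
    show "y ` {a..b} \<subseteq> {y a..y b}"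
      using assms(1,4) by (auto simp: strict_mono_on_leD)
    show "{y a..y b} \<subseteq> y ` {a..b}"
      using IVT'[OF _ _ assms(1,2)] by force
  qed
  obtain g where g: "homeomorphism {a..b} {y a..y b} y g"
    using homeomorphism_compact[OF compact_Icc assms(2) im strict_mono_on_imp_inj_on[OF assms(4)]] by blast
  show ?thesis
  proof
    show "continuous_on {y a..y b} (x \<circ> g)"
      using g assms(3) by (metis continuous_on_compose homeomorphism_def)
    show "(x \<circ> g) (y t) = x t" if "t \<in> {a..b}" for t
      using g that by (auto simp: homeomorphism_def)
  qed (rule im)
qed

lemma strict_antimono_strand:
  fixes y :: "real \<Rightarrow> real" and x :: "real \<Rightarrow> 'a::topological_space"
  assumes "a \<le> b" "continuous_on {a..b} y" "continuous_on {a..b} x"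
    and "strict_mono_on {a..b} (\<lambda>t. - y t)"
  obtains X where "continuous_on {y b..y a} X" "\<And>t. t \<in> {a..b} \<Longrightarrow> X (y t) = x t" "y ` {a..b} = {y b..y a}"
proof -
  obtain X where X: "continuous_on {- y a..- y b} X" "\<And>t. t \<in> {a..b} \<Longrightarrow> X (- y t) = x t"
      "(\<lambda>t. - y t) ` {a..b} = {- y a..- y b}"
    using strict_mono_strand[OF assms(1) continuous_on_minus[OF assms(2)] assms(3,4)] by blast
  show ?thesis
  proof
    show "continuous_on {y b..y a} (\<lambda>z. X (- z))"
      by (rule continuous_on_compose2[OF X(1)]) (auto intro!: continuous_intros)
    have "y ` {a..b} = uminus ` ((\<lambda>t. - y t) ` {a..b})" by (simp add: image_image)
    then show "y ` {a..b} = {y b..y a}" unfolding X(3) by simp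
  qed (use X(2) in auto)
qed

section \<open>Periodic functions and injectivity over one period\<close>

lemma periodic_int:
  fixes f :: "real \<Rightarrow> 'a"
  assumes "\<And>t. f (t + P) = f t"
  shows "f (t + of_int k * P) = f t"
proof -
  have n: "f (t + of_nat n * P) = f t" for n t
  proof (induction n arbitrary: t)
    case (Suc n)
    have "f (t + of_nat (Suc n) * P) = f ((t + of_nat n * P) + P)" by (simp add: algebra_simps)
    then show ?case using Suc assms by simp
  qed simp
  show ?thesis
  proof (cases k)
    case (neg n)
    then have "real_of_int k = - of_nat (Suc n)" by simp
    then have "t + of_int k * P + of_nat (Suc n) * P = t" by (simp add: left_diff_distrib distrib_right)
    then show ?thesis using n[of "t + of_int k * P" "Suc n"] by metis
  qed (use n in simp)
qed

lemma inj_on_periodic: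
  fixes f :: "real \<Rightarrow> 'a"
  assumes per: "\<And>t. f (t + P) = f t" and P: "P > 0" and inj: "inj_on f {0..<P}"
    and eq: "f s = f t" and st: "\<bar>s - t\<bar> < P"
  shows "s = t"
proof -
  define red where "red t = t + of_int (- \<lfloor>t / P\<rfloor>) * P" for t
  have red: "red t \<in> {0..<P}" "f (red t) = f t" for t
  proof -
    show "f (red t) = f t" unfolding red_def by (rule periodic_int) (rule per)
    have "of_int \<lfloor>t / P\<rfloor> * P \<le> t / P * P" using P by (intro mult_right_mono) auto
    moreover have "t / P * P < (of_int \<lfloor>t / P\<rfloor> + 1) * P" using P by (intro mult_strict_right_mono) auto
    ultimately show "red t \<in> {0..<P}" using P by (auto simp: red_def algebra_simps)
  qed
  have "f (red s) = f (red t)" using red(2) eq by simp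
  then have "red s = red t" by (rule inj_onD[OF inj _ red(1) red(1)])
  then have e: "s - t = of_int (\<lfloor>s / P\<rfloor> - \<lfloor>t / P\<rfloor>) * P" by (simp add: red_def algebra_simps)
  then have "\<bar>of_int (\<lfloor>s / P\<rfloor> - \<lfloor>t / P\<rfloor>)\<bar> * P < 1 * P" using st P by (simp add: abs_mult)
  then have "\<bar>of_int (\<lfloor>s / P\<rfloor> - \<lfloor>t / P\<rfloor>)\<bar> < (1::real)" using P by (simp only: mult_less_cancel_right_pos)
  then have "\<lfloor>s / P\<rfloor> - \<lfloor>t / P\<rfloor> = 0" by linarith
  then show ?thesis using e by simp
qed

lemma periodic_image:
  fixes f :: "real \<Rightarrow> 'a"
  assumes per: "\<And>t. f (t + P) = f t" and P: "P > 0"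
  shows "f ` {m..m + P} = range f"
proof -
  have "f t \<in> f ` {m..m + P}" for t
  proof -
    define k where "k = - \<lfloor>(t - m) / P\<rfloor>"
    have "of_int \<lfloor>(t - m) / P\<rfloor> * P \<le> (t - m) / P * P" using P by (intro mult_right_mono) auto
    moreover have "(t - m) / P * P < (of_int \<lfloor>(t - m) / P\<rfloor> + 1) * P" using P by (intro mult_strict_right_mono) auto
    moreover have "(t - m) / P * P = t - m" using P by simp
    ultimately have "t + of_int k * P \<in> {m..m + P}"
      using P by (simp add: k_def distrib_right)
    moreover have "f t = f (t + of_int k * P)" using periodic_int[of f P t k] per by simp
    ultimately show ?thesis by blast
  qed
  then show ?thesis by auto
qed

text \<open>A shear turns the tilted height \<open>L\<close> into the vertical coordinate. The
  ascending and the descending arc then become graphs over the same interval of levels, and by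
  injectivity of the curve they meet only at the two ends, so that the lemma on two strands
  applies.\<close>

lemma unknot_of_monotone_height:
  fixes \<gamma> :: "real \<Rightarrow> real^3" and a b m M P :: real
  defines "L \<equiv> \<lambda>t. \<gamma> t $ 3 - (a * \<gamma> t $ 1 + b * \<gamma> t $ 2)"
  assumes cont: "continuous_on UNIV \<gamma>" and per: "\<And>t. \<gamma> (t + P) = \<gamma> t" and P: "P > 0"
    and inj: "inj_on \<gamma> {0..<P}" and M: "m < M" "M < m + P"
    and up: "strict_mono_on {m..M} L" and down: "strict_mono_on {M..m + P} (\<lambda>t. - L t)"
  shows "ambient_isotopic (\<gamma> ` {0..P}) unknot"
proof -
  define w where "w t = Complex (\<gamma> t $ 1) (\<gamma> t $ 2)" for t
  have cw: "continuous_on UNIV w" unfolding w_def Complex_eq by (intro continuous_intros cont)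
  have cL: "continuous_on UNIV L" unfolding L_def by (intro continuous_intros cont)
  have eqI: "s = t" if "w s = w t" "L s = L t" "\<bar>s - t\<bar> < P" for s t
  proof (rule inj_on_periodic[of \<gamma>, OF per P inj _ that(3)])
    show "\<gamma> s = \<gamma> t" using that(1,2) by (simp add: w_def L_def vec_eq_iff forall_3)
  qed
  have Lper: "L (m + P) = L m" and wper: "w (m + P) = w m" by (simp_all add: L_def w_def per)
  obtain p where p: "continuous_on {L m..L M} p" "\<And>t. t \<in> {m..M} \<Longrightarrow> p (L t) = w t" "L ` {m..M} = {L m..L M}"
    using strict_mono_strand[OF _ continuous_on_subset[OF cL subset_UNIV] continuous_on_subset[OF cw subset_UNIV] up] M by auto
  obtain q where q: "continuous_on {L m..L M} q" "\<And>t. t \<in> {M..m + P} \<Longrightarrow> q (L t) = w t" "L ` {M..m + P} = {L m..L M}"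
    using strict_antimono_strand[OF _ continuous_on_subset[OF cL subset_UNIV] continuous_on_subset[OF cw subset_UNIV] down] M Lper by auto
  let ?J = "\<lambda>(w, z). vector [Re w, Im w, z] :: real^3"
  let ?J' = "\<lambda>x::real^3. (Complex (x $ 1) (x $ 2), x $ 3)"
  have vec: "vector [u, v, z] = u *\<^sub>R axis 1 1 + v *\<^sub>R axis 2 1 + z *\<^sub>R (axis 3 1 :: real^3)" for u v z :: real
    by (simp add: vec_eq_iff forall_3 axis_def)
  have J: "homeomorphism UNIV UNIV ?J ?J'"
  proof (rule homeomorphismI)
    show "continuous_on UNIV ?J" unfolding case_prod_unfold vec by (intro continuous_intros)
    show "continuous_on UNIV ?J'" unfolding Complex_eq by (intro continuous_intros)
  qed (auto simp: vec_eq_iff forall_3)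
  define K0 where "K0 = (\<lambda>t. (w t, \<gamma> t $ 3)) ` {0..P}"
  let ?D = "{(w, z). (Re w)\<^sup>2 + (Im w)\<^sup>2 = 1 \<and> z = (0::real)}"
  have JK: "?J ` K0 = \<gamma> ` {0..P}"
    unfolding K0_def image_image by (intro image_cong) (auto simp: w_def vec_eq_iff forall_3)
  have JD: "?J ` ?D = unknot"
  proof
    show "?J ` ?D \<subseteq> unknot" by (auto simp: unknot_def)
    show "unknot \<subseteq> ?J ` ?D"
    proof
      fix x assume "x \<in> unknot"
      then have "?J' x \<in> ?D" "x = ?J (?J' x)" by (auto simp: unknot_def vec_eq_iff forall_3)
      then show "x \<in> ?J ` ?D" by blast
    qed
  qed
  let ?l = "\<lambda>w. a * Re w + b * Im w"
  have 1: "isotopic_sets K0 ((\<lambda>(w, z). (w, z - ?l w)) ` K0)"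
    by (rule isotopic_sets_shear) (intro continuous_intros)
  have "(\<lambda>(w, z). (w, z - ?l w)) ` K0 = (\<lambda>t. (w t, L t)) ` {0..P}"
    unfolding K0_def image_image by (intro image_cong) (auto simp: L_def w_def)
  \<comment> \<open>The period window is moved from [0, P] to [m, m + P], which is cut by
    \<open>M\<close> into the two monotone arcs.\<close>
  also have "\<dots> = (\<lambda>t. (w t, L t)) ` {m..m + P}"
    using periodic_image[of "\<lambda>t. (w t, L t)" P 0] periodic_image[of "\<lambda>t. (w t, L t)" P m] P
    by (simp add: w_def L_def per)
  also have "{m..m + P} = {m..M} \<union> {M..m + P}" using M by auto
  also have "(\<lambda>t. (w t, L t)) ` \<dots> = (\<lambda>t. (p (L t), L t)) ` {m..M} \<union> (\<lambda>t. (q (L t), L t)) ` {M..m + P}"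
    unfolding image_Un using p(2) q(2) by (intro arg_cong2[where f = "(\<union>)"] image_cong) auto
  also have "\<dots> = (\<lambda>z. (p z, z)) ` {L m..L M} \<union> (\<lambda>z. (q z, z)) ` {L m..L M}"
    using image_image[of "\<lambda>z. (p z, z)" L "{m..M}"] image_image[of "\<lambda>z. (q z, z)" L "{M..m + P}"] p(3) q(3)
    by simp
  finally have img: "(\<lambda>(w, z). (w, z - ?l w)) ` K0 = \<dots>" .
  have "isotopic_sets ((\<lambda>(w, z). (w, z - ?l w)) ` K0) ?D"
    unfolding img
  proof (rule isotopic_sets_two_strands[OF _ p(1) q(1)])
    show "L m < L M" using up M by (auto simp: strict_mono_on_def)
    show "p (L m) = q (L m)" using p(2)[of m] q(2)[of "m + P"] M Lper wper by simp
    show "p (L M) = q (L M)" using p(2)[of M] q(2)[of M] M by simp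
    fix z assume z: "z \<in> {L m<..<L M}"
    then obtain s where s: "s \<in> {m..M}" "z = L s" using p(3) by (metis greaterThanLessThan_subseteq_atLeastAtMost_iff imageE less_eq_real_def subsetD)
    obtain t where t: "t \<in> {M..m + P}" "z = L t" using z q(3) by (metis greaterThanLessThan_subseteq_atLeastAtMost_iff imageE less_eq_real_def subsetD)
    have "s \<noteq> m" "s \<noteq> M" "t \<noteq> M" using z s t by auto
    then have ab: "\<bar>s - t\<bar> < P" "s \<noteq> t" using s t M by auto
    show "p z \<noteq> q z"
      using eqI[OF _ _ ab(1)] ab(2) s t p(2) q(2) by metis
  qed
  then have "isotopic_sets K0 ?D" using 1 isotopic_sets_trans by blast
  from isotopic_sets_transport[OF J this] show ?thesis
    unfolding JK JD ambient_isotopic_eq .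
qed

section \<open>Plane curves of turning number two\<close>

text \<open>Used with F the horizontal gap between two disjoint strands: the one on the right at
  level q is still on the right at level p.\<close>

lemma positive_of_nonvanishing:
  fixes F :: "real \<Rightarrow> real"
  assumes "p \<le> q" "continuous_on {p..q} F" "\<And>z. z \<in> {p..q} \<Longrightarrow> F z \<noteq> 0" "F q > 0"
  shows "F p > 0"
proof (rule ccontr)
  assume "\<not> F p > 0"
  then obtain z where "p \<le> z" "z \<le> q" "F z = 0"
    using IVT'[of F p 0 q, OF _ _ assms(1,2)] assms(4) by fastforce
  then show False using assms(3)[of z] by simp
qed

text \<open>Two strands of a plane curve meeting at a local maximum of the height \<open>Y\<close>, where \<open>X\<close>
  decreases: the first strand stays to the right of the second one.\<close>

lemma cap_order:
  fixes X Y :: "real \<Rightarrow> real"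
  assumes abc: "a < b" "b < c" and X: "continuous_on {a..c} X" and Y: "continuous_on {a..c} Y"
    and up: "strict_mono_on {a..b} Y" and down: "strict_mono_on {b..c} (\<lambda>t. - Y t)"
    and lu: "a \<le> l" "l < b" "b < u" "u \<le> c" and left: "strict_mono_on {l..u} (\<lambda>t. - X t)"
    and inj: "\<And>s t. s \<in> {a..b} \<Longrightarrow> t \<in> {b..c} \<Longrightarrow> X s = X t \<Longrightarrow> Y s = Y t \<Longrightarrow> s = t"
    and st: "s \<in> {a..<b}" "t \<in> {b<..c}" "Y s = Y t"
  shows "X s > X t"
proof -
  have cY: "continuous_on {a..b} Y" "continuous_on {b..c} Y" and cX: "continuous_on {a..b} X" "continuous_on {b..c} X"
    using X Y abc by (auto elim!: continuous_on_subset)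
  obtain A where A: "continuous_on {Y a..Y b} A" "\<And>t. t \<in> {a..b} \<Longrightarrow> A (Y t) = X t" "Y ` {a..b} = {Y a..Y b}"
    using strict_mono_strand[OF _ cY(1) cX(1) up] abc by auto
  obtain B where B: "continuous_on {Y c..Y b} B" "\<And>t. t \<in> {b..c} \<Longrightarrow> B (Y t) = X t" "Y ` {b..c} = {Y c..Y b}"
    using strict_antimono_strand[OF _ cY(2) cX(2) down] abc by auto
  have Yl: "Y a \<le> Y l" "Y l < Y b" "Y s < Y b" "Y a \<le> Y s"
    using strict_mono_on_leD[OF up, of a l] strict_mono_onD[OF up, of l b] strict_mono_onD[OF up, of s b]
      strict_mono_on_leD[OF up, of a s] lu st abc by auto
  have Yu: "Y c \<le> Y u" "Y u < Y b" "Y c \<le> Y t"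
    using strict_mono_on_leD[OF down, of u c] strict_mono_onD[OF down, of b u] strict_mono_on_leD[OF down, of t c]
      lu st abc by auto
  \<comment> \<open>A level so close to the top that both strands at this height have parameters in
    [l, u]. There X is decreasing, so the order is known at level q; it persists down to level
    \<open>Y s\<close> because the strands meet only at the top.\<close>
  define q where "q = max (Y s) (max (Y l) (Y u))"
  have q: "Y s \<le> q" "q < Y b" "Y l \<le> q" "Y u \<le> q" using Yl Yu by (auto simp: q_def)
  have ne: "A z - B z \<noteq> 0" if z: "z \<in> {Y s..q}" for z
  proof
    assume eq: "A z - B z = 0"
    have "z \<in> {Y a..Y b}" "z \<in> {Y c..Y b}" using z Yl Yu q st(3) by auto
    then obtain s' t' where *: "s' \<in> {a..b}" "z = Y s'" "t' \<in> {b..c}" "z = Y t'"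
      using A(3) B(3) by (metis imageE)
    have "X s' = X t'" using A(2)[OF *(1)] B(2)[OF *(3)] eq *(2,4) by simp
    then have "s' = t'" by (rule inj[OF *(1,3) _ trans[OF *(2)[symmetric] *(4)]])
    then have "s' = b" using *(1,3) by auto
    then show False using *(2) z q by auto
  qed
  have "A q - B q > 0"
  proof -
    have "q \<in> {Y a..Y b}" "q \<in> {Y c..Y b}" using q Yl Yu by auto
    then obtain s' t' where *: "s' \<in> {a..b}" "q = Y s'" "t' \<in> {b..c}" "q = Y t'"
      using A(3) B(3) by (metis imageE)
    have "s' \<ge> l"
      using strict_mono_onD[OF up, of s' l] * q lu by force
    moreover have "t' \<le> u"
      using strict_mono_onD[OF down, of u t'] * q lu by force
    moreover have "s' < b" "b < t'" using * q by (auto simp: order_less_le)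
    ultimately have "X s' > X t'" using strict_mono_onD[OF left, of s' t'] lu by auto
    then show ?thesis using A(2)[of s'] B(2)[of t'] * by auto
  qed
  moreover have "continuous_on {Y s..q} (\<lambda>z. A z - B z)"
    by (intro continuous_on_diff continuous_on_subset[OF A(1)] continuous_on_subset[OF B(1)])
      (use q Yl Yu st(3) in auto)
  ultimately have "A (Y s) - B (Y s) > 0"
    using positive_of_nonvanishing[of "Y s" q "\<lambda>z. A z - B z"] q(1) ne by blast
  then show ?thesis using A(2)[of s] B(2)[of t] st by auto
qed

text \<open>With y as height, one period has two minima and two maxima, and \<open>cap\<close>
  orders the two arcs adjacent to each of them. Compare the two descending arcs, or the two
  ascending ones, whichever pair contains an arc from the higher minimum's side to be matched with
  the lower maximum. Their order at the level of the lower maximum is dictated by the higher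
  minimum, and their order at the level of the higher minimum by the lower maximum. These orders are
  opposite, although disjoint arcs cannot change sides.\<close>

lemma turning_number_two_not_simple:
  fixes x y \<theta> r :: "real \<Rightarrow> real"
  assumes dx: "\<And>t. (x has_real_derivative r t * cos (\<theta> t)) (at t)"
    and dy: "\<And>t. (y has_real_derivative r t * sin (\<theta> t)) (at t)"
    and r: "\<And>t. r t > 0" and mono: "strict_mono \<theta>" and c\<theta>: "continuous_on UNIV \<theta>"
    and \<theta>P: "\<And>t. \<theta> (t + P) = \<theta> t + 4 * pi" and P: "P > 0"
    and per: "\<And>t. x (t + P) = x t" "\<And>t. y (t + P) = y t"
    and inj: "\<And>s t. x s = x t \<Longrightarrow> y s = y t \<Longrightarrow> \<bar>s - t\<bar> < P \<Longrightarrow> s = t"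
  shows False
proof -
  have cx: "continuous_on A x" and cy: "continuous_on A y" for A
    using DERIV_isCont[OF dx] DERIV_isCont[OF dy] by (simp_all add: continuous_at_imp_continuous_on)
  have IVT\<theta>: "\<exists>t\<ge>a. \<theta> t = c" if "\<theta> a \<le> c" "c \<le> \<theta> a + 4 * pi" for a c
    using IVT'[of \<theta> a c "a + P"] that P continuous_on_subset[OF c\<theta>] \<theta>P[of a] by auto
  have ymono: "strict_mono_on {a..b} (\<lambda>t. e * y t)"
    if "sin (\<theta> a) = 0" "cos (\<theta> a) = e" "e \<in> {1, -1}" "\<theta> b = \<theta> a + pi" for a b e
  proof (rule strict_mono_onI)
    fix s t assume st: "s \<in> {a..b}" "t \<in> {a..b}" "s < t"
    show "e * y s < e * y t"
    proof (rule DERIV_pos_imp_increasing_open[OF st(3)])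
      fix u assume u: "s < u" "u < t"
      have "\<theta> a < \<theta> u" "\<theta> u < \<theta> b" using u st by (auto intro!: strict_monoD[OF mono])
      then have "sin (\<theta> u - \<theta> a) > 0" using that(4) by (intro sin_gt_zero) auto
      moreover have "e * sin (\<theta> u) = sin (\<theta> u - \<theta> a)"
        using that(1-3) by (simp add: sin_diff)
      ultimately have "r u * (e * sin (\<theta> u)) > 0" using r by simp
      moreover have "((\<lambda>t. e * y t) has_real_derivative r u * (e * sin (\<theta> u))) (at u)"
        by (auto intro!: derivative_eq_intros dy)
      ultimately show "\<exists>d. ((\<lambda>t. e * y t) has_real_derivative d) (at u) \<and> d > 0" by blast
    qed (intro continuous_intros cy)
  qed
  have xmono: "strict_mono_on {a..b} (\<lambda>t. e * x t)"
    if "sin (\<theta> c) = 0" "cos (\<theta> c) = e" "e \<in> {1, -1}" "\<theta> a = \<theta> c - pi / 2" "\<theta> b = \<theta> c + pi / 2" for a b c e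
  proof (rule strict_mono_onI)
    fix s t assume st: "s \<in> {a..b}" "t \<in> {a..b}" "s < t"
    show "e * x s < e * x t"
    proof (rule DERIV_pos_imp_increasing_open[OF st(3)])
      fix u assume u: "s < u" "u < t"
      have "\<theta> a < \<theta> u" "\<theta> u < \<theta> b" using u st by (auto intro!: strict_monoD[OF mono])
      then have "cos (\<theta> u - \<theta> c) > 0" using that(4,5) by (intro cos_gt_zero_pi) auto
      moreover have "e * cos (\<theta> u) = cos (\<theta> u - \<theta> c)"
        using that(1-3) by (simp add: cos_diff)
      ultimately have "r u * (e * cos (\<theta> u)) > 0" using r by simp
      moreover have "((\<lambda>t. e * x t) has_real_derivative r u * (e * cos (\<theta> u))) (at u)"
        by (auto intro!: derivative_eq_intros dx)
      ultimately show "\<exists>d. ((\<lambda>t. e * x t) has_real_derivative d) (at u) \<and> d > 0" by blast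
    qed (intro continuous_intros cx)
  qed
  \<comment> \<open>\<open>e\<close> is 1 at a minimum and -1 at a maximum of y. Multiplying both
    coordinates by \<open>- e\<close> turns a minimum by a half turn into a maximum traversed
    leftwards, so \<open>cap_order\<close> serves both cases.\<close>
  have cap: "e * x s < e * x t"
    if abc: "\<theta> b = \<theta> a + pi" "\<theta> c = \<theta> b + pi" and e: "sin (\<theta> b) = 0" "cos (\<theta> b) = e" "e \<in> {1, -1}"
      and st: "s \<in> {a..<b}" "t \<in> {b<..c}" "y s = y t" for a b c e s t
  proof -
    have ea: "sin (\<theta> a) = 0" "cos (\<theta> a) = - e" using abc(1) e by (auto simp: sin_add cos_add)
    obtain l where l: "\<theta> l = \<theta> b - pi / 2"
      using IVT\<theta>[of a "\<theta> b - pi / 2"] abc by auto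
    obtain u where u: "\<theta> u = \<theta> b + pi / 2"
      using IVT\<theta>[of b "\<theta> b + pi / 2"] abc by auto
    have "\<theta> a < \<theta> l" "\<theta> l < \<theta> b" "\<theta> b < \<theta> u" "\<theta> u < \<theta> c" "\<theta> a < \<theta> b" "\<theta> b < \<theta> c" "\<theta> c < \<theta> (a + P)"
      using abc l u pi_gt_zero \<theta>P[of a] by linarith+
    then have ord: "a < l" "l < b" "b < u" "u < c" "a < b" "b < c" and cP: "c < a + P"
      by (simp_all only: strict_mono_less[OF mono])
    have "- e * x t < - e * x s"
    proof (rule cap_order[where a = a and b = b and c = c and X = "\<lambda>t. - e * x t" and Y = "\<lambda>t. - e * y t"
          and l = l and u = u])
      show "strict_mono_on {a..b} (\<lambda>t. - e * y t)"
        using ymono[of a "- e" b] ea e abc by auto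
      show "strict_mono_on {b..c} (\<lambda>t. - (- e * y t))"
        using ymono[of b e c] e abc by auto
      show "strict_mono_on {l..u} (\<lambda>t. - (- e * x t))"
        using xmono[of b e l u] e l u by auto
      show "a \<le> l" "l < b" "b < u" "u \<le> c" "a < b" "b < c"
        using ord by simp_all
      fix s t assume *: "s \<in> {a..b}" "t \<in> {b..c}" "- e * x s = - e * x t" "- e * y s = - e * y t"
      have "x s = x t" "y s = y t" using *(3,4) e by auto
      moreover have "\<bar>s - t\<bar> < P" using *(1,2) cP by auto
      ultimately show "s = t" by (rule inj)
    next
      show "continuous_on {a..c} (\<lambda>t. - e * x t)" "continuous_on {a..c} (\<lambda>t. - e * y t)"
        by (intro continuous_on_mult continuous_on_const cx cy)+
    qed (use st in simp_all)
    then show ?thesis by simp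
  qed
  \<comment> \<open>Here \<open>t2\<close> is the higher of the two minima. The opposite situation
    is the same one with the labels advanced by one full turn of the tangent, from \<open>t0\<close>
    to \<open>t2\<close>.\<close>
  have main: False
    if e: "sin (\<theta> t0) = 0" "cos (\<theta> t0) = 1" and th: "\<theta> t1 = \<theta> t0 + pi" "\<theta> t2 = \<theta> t1 + pi" "\<theta> t3 = \<theta> t2 + pi"
      and y02: "y t0 \<le> y t2" for t0 t1 t2 t3
  proof -
    define t4 where "t4 = t0 + P"
    have th4: "\<theta> t4 = \<theta> t3 + pi" using \<theta>P[of t0] th by (simp add: t4_def)
    have e1: "sin (\<theta> t1) = 0" "cos (\<theta> t1) = -1" using e th by (auto simp: sin_add cos_add)
    have e2: "sin (\<theta> t2) = 0" "cos (\<theta> t2) = 1" using e1 th by (auto simp: sin_add cos_add)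
    have e3: "sin (\<theta> t3) = 0" "cos (\<theta> t3) = -1" using e2 th by (auto simp: sin_add cos_add)
    have "\<theta> t0 < \<theta> t1" "\<theta> t1 < \<theta> t2" "\<theta> t2 < \<theta> t3" "\<theta> t3 < \<theta> t4" using th th4 by simp_all
    then have ord: "t0 < t1" "t1 < t2" "t2 < t3" "t3 < t4" by (simp_all only: strict_mono_less[OF mono])
    have upA: "strict_mono_on {t0..t1} y" and upC: "strict_mono_on {t2..t3} y"
      using ymono[of t0 1 t1] ymono[of t2 1 t3] e e2 th by auto
    have dnB: "strict_mono_on {t1..t2} (\<lambda>t. - y t)" and dnD: "strict_mono_on {t3..t4} (\<lambda>t. - y t)"
      using ymono[of t1 "-1" t2] ymono[of t3 "-1" t4] e1 e3 th th4 by auto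
    have y40: "y t4 = y t0" by (simp add: t4_def per)
    have ys: "y t2 < y t1" "y t2 < y t3" "y t0 < y t1" "y t0 < y t3"
      using strict_mono_onD[OF upA, of t0 t1] strict_mono_onD[OF upC, of t2 t3]
        strict_mono_onD[OF dnB, of t1 t2] strict_mono_onD[OF dnD, of t3 t4] ord y40 by auto
    have hit: "\<exists>t\<in>{a..b}. y t = z" if "y a \<le> z \<and> z \<le> y b \<or> y b \<le> z \<and> z \<le> y a" "a \<le> b" for a b z
      using IVT'[of y a z b] IVT2'[of y b z a] that cy by force
    show False
    proof (cases "y t3 \<le> y t1")
      case True
      obtain B where B: "continuous_on {y t2..y t1} B" "\<And>t. t \<in> {t1..t2} \<Longrightarrow> B (y t) = x t"
        by (rule strict_antimono_strand[OF less_imp_le[OF ord(2)] cy cx dnB]) (rule that)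
      obtain D where D: "continuous_on {y t4..y t3} D" "\<And>t. t \<in> {t3..t4} \<Longrightarrow> D (y t) = x t"
        by (rule strict_antimono_strand[OF less_imp_le[OF ord(4)] cy cx dnD]) (rule that)
      obtain s where s: "s \<in> {t1..t2}" "y s = y t3" using hit[of t2 "y t3" t1] hit[of t1 "y t3" t2] True ys ord by auto
      obtain t where t: "t \<in> {t3..t4}" "y t = y t2" using hit[of t3 "y t2" t4] y02 y40 ys ord by auto
      have "s \<noteq> t2" using s ys by auto
      then have "1 * x s < 1 * x t3"
        using cap[of t2 t1 t3 1 s t3] e2 th s ord by auto
      then have pos: "D (y t3) - B (y t3) > 0" using B(2)[OF s(1)] D(2)[of t3] s(2) ord by auto
      have "D (y t2) - B (y t2) > 0"
      proof (rule positive_of_nonvanishing[where q = "y t3" and F = "\<lambda>z. D z - B z"])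
        show "continuous_on {y t2..y t3} (\<lambda>z. D z - B z)"
          using ys True y02 y40
          by (intro continuous_intros continuous_on_subset[OF D(1)] continuous_on_subset[OF B(1)]) auto
        fix z assume z: "z \<in> {y t2..y t3}"
        obtain s where s: "s \<in> {t1..t2}" "y s = z" using hit[of t1 z t2] z True ord by auto
        obtain t where t: "t \<in> {t3..t4}" "y t = z" using hit[of t3 z t4] z y02 y40 ord by auto
        have "s \<noteq> t" "\<bar>s - t\<bar> < P" using s t ord by (auto simp: t4_def)
        then show "D z - B z \<noteq> 0" using inj[of s t] B(2)[OF s(1)] D(2)[OF t(1)] s t by auto
      qed (use ys pos in auto)
      then have "x t > x t2" using D(2)[OF t(1)] t B(2)[of t2] ord by auto
      moreover have "t \<noteq> t3" using t ys by auto
      then have "-1 * x t2 < -1 * x t"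
        using cap[of t3 t2 t4 "-1" t2 t] e3 th th4 t ord by auto
      ultimately show False by simp
    next
      case False
      obtain A where A: "continuous_on {y t0..y t1} A" "\<And>t. t \<in> {t0..t1} \<Longrightarrow> A (y t) = x t"
        by (rule strict_mono_strand[OF less_imp_le[OF ord(1)] cy cx upA]) (rule that)
      obtain C where C: "continuous_on {y t2..y t3} C" "\<And>t. t \<in> {t2..t3} \<Longrightarrow> C (y t) = x t"
        by (rule strict_mono_strand[OF less_imp_le[OF ord(3)] cy cx upC]) (rule that)
      obtain u where u: "u \<in> {t2..t3}" "y u = y t1" using hit[of t2 "y t1" t3] False ys ord by auto
      obtain s where s: "s \<in> {t0..t1}" "y s = y t2" using hit[of t0 "y t2" t1] y02 ys ord by auto
      have "u \<noteq> t2" using u ys by auto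
      then have "1 * x t1 < 1 * x u"
        using cap[of t2 t1 t3 1 t1 u] e2 th u ord by auto
      then have pos: "C (y t1) - A (y t1) > 0" using C(2)[OF u(1)] A(2)[of t1] u(2) ord by auto
      have "C (y t2) - A (y t2) > 0"
      proof (rule positive_of_nonvanishing[where q = "y t1" and F = "\<lambda>z. C z - A z"])
        show "continuous_on {y t2..y t1} (\<lambda>z. C z - A z)"
          using ys False y02
          by (intro continuous_intros continuous_on_subset[OF C(1)] continuous_on_subset[OF A(1)]) auto
        fix z assume z: "z \<in> {y t2..y t1}"
        obtain s where s: "s \<in> {t0..t1}" "y s = z" using hit[of t0 z t1] z y02 ord by auto
        obtain t where t: "t \<in> {t2..t3}" "y t = z" using hit[of t2 z t3] z False ord by auto
        have "s \<noteq> t" "\<bar>s - t\<bar> < P" using s t ord by (auto simp: t4_def)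
        then show "C z - A z \<noteq> 0" using inj[of s t] A(2)[OF s(1)] C(2)[OF t(1)] s t by auto
      qed (use ys pos in auto)
      then have "x t2 > x s" using A(2)[OF s(1)] s C(2)[of t2] ord by auto
      moreover have "s \<noteq> t1" using s ys by auto
      then have "-1 * x s < -1 * x t2"
        using cap[of t1 t0 t2 "-1" s t2] e1 th s ord by auto
      ultimately show False by simp
    qed
  qed
  \<comment> \<open>A multiple of 2 pi as heading makes \<open>t0\<close> a minimum of y passed in
    the direction of increasing x.\<close>
  define N where "N = \<lceil>\<theta> 0 / (2 * pi)\<rceil>"
  have "\<theta> 0 / (2 * pi) \<le> of_int N" "of_int N < \<theta> 0 / (2 * pi) + 1" unfolding N_def by linarith+
  then have "\<theta> 0 \<le> 2 * pi * of_int N" "2 * pi * of_int N \<le> \<theta> 0 + 4 * pi" by (auto simp: field_simps)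
  then obtain t0 where t0: "\<theta> t0 = 2 * pi * of_int N" using IVT\<theta> by blast
  then have e: "sin (\<theta> t0) = 0" "cos (\<theta> t0) = 1" by (simp_all add: sin_int_2pin cos_int_2pin)
  obtain t1 where t1: "\<theta> t1 = \<theta> t0 + pi" using IVT\<theta>[of t0 "\<theta> t0 + pi"] by auto
  obtain t2 where t2: "\<theta> t2 = \<theta> t1 + pi" using IVT\<theta>[of t1 "\<theta> t1 + pi"] by auto
  obtain t3 where t3: "\<theta> t3 = \<theta> t2 + pi" using IVT\<theta>[of t2 "\<theta> t2 + pi"] by auto
  show False
  proof (cases "y t0 \<le> y t2")
    case True
    then show False using main[OF e t1 t2 t3] by blast
  next
    case False
    have "sin (\<theta> t2) = 0" "cos (\<theta> t2) = 1" using e t1 t2 by (auto simp: sin_add cos_add)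
    then show False
      using main[of t2 t3 "t0 + P" "t1 + P"] False t1 t2 t3 by (auto simp: \<theta>P per)
  qed
qed

section \<open>The Crofton formula\<close>

lemma measurable_fst_snd_borel [measurable (raw)]:
  fixes f :: "'a \<Rightarrow> 'b::second_countable_topology \<times> 'c::second_countable_topology"
  assumes "f \<in> M \<rightarrow>\<^sub>M borel"
  shows "(\<lambda>x. fst (f x)) \<in> M \<rightarrow>\<^sub>M borel" "(\<lambda>x. snd (f x)) \<in> M \<rightarrow>\<^sub>M borel"
  using assms by (simp_all add: borel_prod[symmetric])

lemma nn_integral_lborel_prod:
  fixes F :: "real \<times> real \<Rightarrow> ennreal"
  assumes [measurable]: "F \<in> borel_measurable borel"
  shows "(\<integral>\<^sup>+v. F v \<partial>lborel) = (\<integral>\<^sup>+x. (\<integral>\<^sup>+y. F (x, y) \<partial>lborel) \<partial>lborel)"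
    and "(\<integral>\<^sup>+v. F v \<partial>lborel) = (\<integral>\<^sup>+y. (\<integral>\<^sup>+x. F (x, y) \<partial>lborel) \<partial>lborel)"
proof -
  have F: "F \<in> borel_measurable (lborel \<Otimes>\<^sub>M lborel)" by (simp add: lborel_prod)
  show 1: "(\<integral>\<^sup>+v. F v \<partial>lborel) = (\<integral>\<^sup>+x. (\<integral>\<^sup>+y. F (x, y) \<partial>lborel) \<partial>lborel)"
    using lborel.nn_integral_fst[OF F] by (simp add: lborel_prod)
  show "(\<integral>\<^sup>+v. F v \<partial>lborel) = (\<integral>\<^sup>+y. (\<integral>\<^sup>+x. F (x, y) \<partial>lborel) \<partial>lborel)"
    unfolding 1 using lborel_pair.Fubini'[of "\<lambda>x y. F (x, y)"] F by simp
qed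

lemma nn_integral_translate:
  fixes f :: "real \<Rightarrow> ennreal"
  assumes "f \<in> borel_measurable borel"
  shows "(\<integral>\<^sup>+x. f (x + c) \<partial>lborel) = (\<integral>\<^sup>+x. f x \<partial>lborel)"
  using nn_integral_real_affine[OF assms, of 1 c] by (simp add: add.commute)

lemma nn_integral_shear:
  fixes F :: "real \<times> real \<Rightarrow> ennreal"
  assumes [measurable]: "F \<in> borel_measurable borel"
  shows "(\<integral>\<^sup>+v. F (fst v + c * snd v, snd v) \<partial>lborel) = (\<integral>\<^sup>+v. F v \<partial>lborel)"
    and "(\<integral>\<^sup>+v. F (fst v, snd v + c * fst v) \<partial>lborel) = (\<integral>\<^sup>+v. F v \<partial>lborel)"
proof -
  have "(\<integral>\<^sup>+x. F (x + c * y, y) \<partial>lborel) = (\<integral>\<^sup>+x. F (x, y) \<partial>lborel)" for y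
    by (rule nn_integral_translate[of "\<lambda>x. F (x, y)"]) measurable
  then show "(\<integral>\<^sup>+v. F (fst v + c * snd v, snd v) \<partial>lborel) = (\<integral>\<^sup>+v. F v \<partial>lborel)"
    using nn_integral_lborel_prod(2)[of "\<lambda>v. F (fst v + c * snd v, snd v)"] nn_integral_lborel_prod(2)[of F] by simp
  have "(\<integral>\<^sup>+y. F (x, y + c * x) \<partial>lborel) = (\<integral>\<^sup>+y. F (x, y) \<partial>lborel)" for x
    by (rule nn_integral_translate[of "\<lambda>y. F (x, y)"]) measurable
  then show "(\<integral>\<^sup>+v. F (fst v, snd v + c * fst v) \<partial>lborel) = (\<integral>\<^sup>+v. F v \<partial>lborel)"
    using nn_integral_lborel_prod(1)[of "\<lambda>v. F (fst v, snd v + c * fst v)"] nn_integral_lborel_prod(1)[of F] by simp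
qed

text \<open>A rotation is a product of three shears, each of which preserves area by translation
  invariance on lines. The horizontal shears have slope (1 - c) / s, the tangent of half the angle.
  The factorization divides by s, so the identity and the half turn are treated apart.\<close>

lemma nn_integral_rotate:
  fixes F :: "real \<times> real \<Rightarrow> ennreal"
  assumes F [measurable]: "F \<in> borel_measurable borel" and cs: "c\<^sup>2 + s\<^sup>2 = 1"
  shows "(\<integral>\<^sup>+v. F (c * fst v + s * snd v, c * snd v - s * fst v) \<partial>lborel) = (\<integral>\<^sup>+v. F v \<partial>lborel)"
proof (cases "s = 0")
  case True
  then have "c = 1 \<or> c = -1" using cs by (simp add: power2_eq_1_iff)
  then show ?thesis
  proof
    assume c: "c = -1"
    have neg: "(\<integral>\<^sup>+x. f (- x) \<partial>lborel) = (\<integral>\<^sup>+x. f x \<partial>lborel)" if "f \<in> borel_measurable borel" for f :: "real \<Rightarrow> ennreal"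
      using nn_integral_real_affine[OF that, of "-1" 0] by simp
    have "(\<integral>\<^sup>+x. (\<integral>\<^sup>+y. F (- x, - y) \<partial>lborel) \<partial>lborel) = (\<integral>\<^sup>+x. (\<integral>\<^sup>+y. F (- x, y) \<partial>lborel) \<partial>lborel)"
      by (intro nn_integral_cong neg) simp
    also have "\<dots> = (\<integral>\<^sup>+x. (\<integral>\<^sup>+y. F (x, y) \<partial>lborel) \<partial>lborel)"
      by (intro neg[of "\<lambda>x. \<integral>\<^sup>+y. F (x, y) \<partial>lborel"]) simp
    finally show ?thesis
      using nn_integral_lborel_prod(1)[of "\<lambda>v. F (- fst v, - snd v)"] nn_integral_lborel_prod(1)[OF F] c True
      by simp
  qed (use True in simp)
next
  case False
  define p where "p = (1 - c) / s"
  have ps: "p * s = 1 - c" using False by (simp add: p_def)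
  let ?F1 = "\<lambda>v. F (fst v + p * snd v, snd v)"
  let ?F2 = "\<lambda>v. ?F1 (fst v, snd v + (- s) * fst v)"
  let ?F3 = "\<lambda>v. ?F2 (fst v + p * snd v, snd v)"
  have "(\<integral>\<^sup>+v. ?F3 v \<partial>lborel) = (\<integral>\<^sup>+v. ?F2 v \<partial>lborel)" by (rule nn_integral_shear) measurable
  also have "\<dots> = (\<integral>\<^sup>+v. ?F1 v \<partial>lborel)" by (rule nn_integral_shear) measurable
  also have "\<dots> = (\<integral>\<^sup>+v. F v \<partial>lborel)" by (rule nn_integral_shear) measurable
  also have "?F3 = (\<lambda>v. F (c * fst v + s * snd v, c * snd v - s * fst v))"
  proof
    fix v :: "real \<times> real"
    have a: "snd v - s * (fst v + p * snd v) = c * snd v - s * fst v"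
    proof -
      have "snd v - s * (fst v + p * snd v) = snd v * (1 - p * s) - s * fst v" by (simp add: algebra_simps)
      then show ?thesis unfolding ps by simp
    qed
    have b: "fst v + p * snd v + p * (c * snd v - s * fst v) = c * fst v + s * snd v"
    proof -
      have "p * (1 + c) = s"
      proof -
        have "s * (p * (1 + c)) = (p * s) * (1 + c)" by (simp add: algebra_simps)
        also have "\<dots> = s * s" unfolding ps using cs by (simp add: algebra_simps power2_eq_square)
        finally show ?thesis using False by simp
      qed
      moreover have "fst v + p * snd v + p * (c * snd v - s * fst v) = fst v * (1 - p * s) + (p * (1 + c)) * snd v"
        by (simp add: algebra_simps)
      ultimately show ?thesis unfolding ps by simp
    qed
    show "?F3 v = F (c * fst v + s * snd v, c * snd v - s * fst v)"
      using a b by simp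
  qed
  finally show ?thesis .
qed

text \<open>The hyperbolic area density in the Klein model, cut off at radius \<open>R\<close>.\<close>

definition weight :: "real \<Rightarrow> real \<times> real \<Rightarrow> real" where
  "weight R v = (if (fst v)\<^sup>2 + (snd v)\<^sup>2 < R\<^sup>2 then 1 / (sqrt (1 - (fst v)\<^sup>2 - (snd v)\<^sup>2))^3 else 0)"

lemma weight_measurable [measurable]: "weight R \<in> borel_measurable borel"
  unfolding weight_def by measurable

lemma weight_nonneg: "R < 1 \<Longrightarrow> R > 0 \<Longrightarrow> 0 \<le> weight R v"
  using power_strict_mono[of R 1 2] by (auto simp: weight_def)

lemma weight_le:
  assumes "0 < R" "R < 1"
  shows "weight R v \<le> 1 / (sqrt (1 - R\<^sup>2))^3"
proof -
  have "R\<^sup>2 < 1" using power_strict_mono[of R 1 2] assms by simp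
  then show ?thesis
    by (auto simp: weight_def intro!: divide_left_mono power_mono mult_pos_pos zero_less_power)
qed

lemma weight_ge: "(fst v)\<^sup>2 + (snd v)\<^sup>2 < R\<^sup>2 \<Longrightarrow> 0 < R \<Longrightarrow> R < 1 \<Longrightarrow> 1 \<le> weight R v"
proof -
  assume *: "(fst v)\<^sup>2 + (snd v)\<^sup>2 < R\<^sup>2" "0 < R" "R < 1"
  have "R\<^sup>2 < 1" using power_strict_mono[of R 1 2] * by simp
  moreover have "(fst v)\<^sup>2 \<ge> 0" "(snd v)\<^sup>2 \<ge> 0" by auto
  ultimately have "sqrt (1 - (fst v)\<^sup>2 - (snd v)\<^sup>2) > 0" "sqrt (1 - (fst v)\<^sup>2 - (snd v)\<^sup>2) \<le> 1" using *(1) by auto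
  then have "0 < (sqrt (1 - (fst v)\<^sup>2 - (snd v)\<^sup>2))^3" "(sqrt (1 - (fst v)\<^sup>2 - (snd v)\<^sup>2))^3 \<le> 1"
    by (auto intro: power_le_one)
  then show ?thesis using *(1) by (simp add: weight_def)
qed

lemma weight_rotate: "c\<^sup>2 + s\<^sup>2 = 1 \<Longrightarrow> weight R (c * x + s * y, c * y - s * x) = weight R (x, y)"
proof -
  assume cs: "c\<^sup>2 + s\<^sup>2 = 1"
  have "(c * x + s * y)\<^sup>2 + (c * y - s * x)\<^sup>2 = (c\<^sup>2 + s\<^sup>2) * (x\<^sup>2 + y\<^sup>2)"
    by (simp add: power2_eq_square algebra_simps)
  then have "(c * x + s * y)\<^sup>2 + (c * y - s * x)\<^sup>2 = x\<^sup>2 + y\<^sup>2" using cs by simp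
  moreover from this have "1 - (c * x + s * y)\<^sup>2 - (c * y - s * x)\<^sup>2 = 1 - x\<^sup>2 - y\<^sup>2" by linarith
  ultimately show ?thesis unfolding weight_def fst_conv snd_conv by presburger
qed

text \<open>In coordinates (x, y) for v rotated by the angle \<open>\<theta> t\<close>, the value of
  f_v at t is \<open>h t - x\<close> and its derivative is \<open>\<omega> t * (p t - y)\<close>. So
  v has a zero at t exactly on the chord x = \<open>h t\<close>, and
  \<open>\<bar>p - y\<bar>\<close> is the Crofton Jacobian along that chord.\<close>

definition chord_weight :: "real \<Rightarrow> real \<Rightarrow> real \<Rightarrow> ennreal" where
  "chord_weight R x p = (\<integral>\<^sup>+y. weight R (x, y) * \<bar>p - y\<bar> \<partial>lborel)"

text \<open>A bound uniform in x and p, to serve as a majorant in dominated convergence: the factor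
  \<open>\<bar>p - y\<bar>\<close> is at most 2 on an interval of length 2.\<close>

lemma chord_weight_bound:
  assumes R: "0 < R" "R < 1" and p: "\<bar>p\<bar> \<le> 1"
  shows "chord_weight R x p \<le> ennreal (4 / (sqrt (1 - R\<^sup>2))^3)"
proof -
  have "R\<^sup>2 < 1" using power_strict_mono[of R 1 2] R by simp
  then have c: "0 < sqrt (1 - R\<^sup>2)^3" by simp
  have wl: "weight R (x, y) * \<bar>p - y\<bar> \<le> 2 / (sqrt (1 - R\<^sup>2))^3 * indicator {-1..1} y" for y
  proof (cases "y \<in> {-1..1}")
    case True
    then have "weight R (x, y) * \<bar>p - y\<bar> \<le> 1 / (sqrt (1 - R\<^sup>2))^3 * 2"
      using p by (intro mult_mono weight_le R) (auto simp: less_imp_le[OF c] less_imp_le[OF \<open>R\<^sup>2 < 1\<close>])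
    then show ?thesis using True by simp
  next
    case False
    then have "\<bar>y\<bar> \<ge> 1" by auto
    then have "y\<^sup>2 \<ge> 1" using abs_le_square_iff[of 1 y] by simp
    moreover have "x\<^sup>2 \<ge> 0" by simp
    ultimately have "\<not> x\<^sup>2 + y\<^sup>2 < R\<^sup>2" using \<open>R\<^sup>2 < 1\<close> by linarith
    then show ?thesis using False by (simp add: weight_def)
  qed
  have "chord_weight R x p \<le> (\<integral>\<^sup>+y. ennreal (2 / (sqrt (1 - R\<^sup>2))^3) * indicator {-1..1::real} y \<partial>lborel)"
    unfolding chord_weight_def
  proof (intro nn_integral_mono)
    fix y
    show "ennreal (weight R (x, y) * \<bar>p - y\<bar>) \<le> ennreal (2 / (sqrt (1 - R\<^sup>2))^3) * indicator {-1..1} y"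
      using ennreal_leI[OF wl[of y]] by (auto simp: indicator_def split: if_splits)
  qed
  also have "\<dots> = ennreal (2 / (sqrt (1 - R\<^sup>2))^3) * ennreal 2"
    by (subst nn_integral_cmult_indicator) auto
  also have "\<dots> = ennreal (4 / (sqrt (1 - R\<^sup>2))^3)"
    using less_imp_le[OF c] by (subst ennreal_mult'[symmetric]) auto
  finally show ?thesis .
qed

text \<open>At x = \<open>h t\<close> and p = \<open>p t\<close> the subtracted term is twice the
  total curvature integrand per unit of \<open>\<theta>\<close>. The constant term comes from the
  two ends of the chord and is later balanced against the area of the disc.\<close>

lemma chord_weight_eq:
  assumes R: "0 < R" "R < 1" and xp: "x\<^sup>2 + p\<^sup>2 < R\<^sup>2"
  shows "chord_weight R x p = ennreal (2 / sqrt (1 - R\<^sup>2) - 2 * sqrt (1 - x\<^sup>2 - p\<^sup>2) / (1 - x\<^sup>2))"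
proof -
  have R1: "R\<^sup>2 < 1" using power_strict_mono[of R 1 2] R by simp
  define c where "c = 1 - x\<^sup>2"
  define Y where "Y = sqrt (R\<^sup>2 - x\<^sup>2)"
  have p0: "p\<^sup>2 \<ge> 0" by simp
  have Rx: "R\<^sup>2 - x\<^sup>2 > 0" using xp p0 by linarith
  have Y2: "Y\<^sup>2 = R\<^sup>2 - x\<^sup>2" and Y0: "Y > 0" using Rx by (simp_all add: Y_def)
  have c0: "c > 0" using Rx R1 by (simp add: c_def)
  have "p\<^sup>2 < Y\<^sup>2" using xp Y2 by linarith
  then have pY: "\<bar>p\<bar> < Y" using Y0 power2_less_imp_less[of "\<bar>p\<bar>" Y] by simp
  have inY: "c - y\<^sup>2 > 0" if "\<bar>y\<bar> \<le> Y" for y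
  proof -
    have "y\<^sup>2 \<le> Y\<^sup>2" using that Y0 abs_le_square_iff[of y Y] by simp
    then show ?thesis using Y2 R1 by (simp add: c_def)
  qed
  \<comment> \<open>An antiderivative of (y - p) / (c - y^2)^(3/2). The integral is split at y = p,
    where the absolute value changes sign, so \<open>G p\<close> enters twice.\<close>
  define G where "G y = (c - p * y) / (c * sqrt (c - y\<^sup>2))" for y
  have G: "(G has_real_derivative (y - p) / (sqrt (c - y\<^sup>2))^3) (at y)" if y: "\<bar>y\<bar> \<le> Y" for y
  proof -
    define q where "q = sqrt (c - y\<^sup>2)"
    have q: "q > 0" "q\<^sup>2 = c - y\<^sup>2" using inY[OF y] by (simp_all add: q_def)
    have dq: "((\<lambda>y. sqrt (c - y\<^sup>2)) has_real_derivative (- y / q)) (at y)"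
      using inY[OF y] unfolding q_def by (auto intro!: derivative_eq_intros simp: field_simps)
    have "((\<lambda>y. (c - p * y) / (c * sqrt (c - y\<^sup>2))) has_real_derivative
        ((- p) * (c * sqrt (c - y\<^sup>2)) - (c - p * y) * (c * (- y / q))) / ((c * sqrt (c - y\<^sup>2)) * (c * sqrt (c - y\<^sup>2)))) (at y)"
    proof (rule DERIV_divide)
      show "((\<lambda>y. c - p * y) has_real_derivative - p) (at y)" by (auto intro!: derivative_eq_intros)
      show "((\<lambda>y. c * sqrt (c - y\<^sup>2)) has_real_derivative c * (- y / q)) (at y)" by (rule DERIV_cmult[OF dq])
    qed (use c0 q in \<open>simp add: q_def\<close>)
    then have "(G has_real_derivative ((- p) * (c * q) - (c - p * y) * (c * (- y / q))) / (c * q)\<^sup>2) (at y)"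
      by (simp only: G_def[abs_def] q_def power2_eq_square)
    also have "((- p) * (c * q) - (c - p * y) * (c * (- y / q))) / (c * q)\<^sup>2 = (y - p) / q^3"
    proof -
      have "((- p) * (c * q) - (c - p * y) * (c * (- y / q))) = (c / q) * (- p * q\<^sup>2 + (c - p * y) * y)"
        using q by (simp add: field_simps power2_eq_square)
      also have "\<dots> = (c / q) * (c * (y - p))" unfolding q by (simp add: algebra_simps power2_eq_square)
      finally have num: "((- p) * (c * q) - (c - p * y) * (c * (- y / q))) = (c / q) * (c * (y - p))" .
      show ?thesis unfolding num using q(1) c0 by (simp add: field_simps power2_eq_square power3_eq_cube)
    qed
    finally show ?thesis by (simp add: q_def)
  qed
  have Gv: "(G has_vector_derivative (y - p) / (sqrt (c - y\<^sup>2))^3) (at y within S)" if "\<bar>y\<bar> \<le> Y" for y S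
    using has_field_derivative_at_within[OF G[OF that]] by (simp add: has_real_derivative_iff_has_vector_derivative)
  have 1: "((\<lambda>y. (y - p) / (sqrt (c - y\<^sup>2))^3) has_integral (G Y - G p)) {p..Y}"
    using pY by (intro fundamental_theorem_of_calculus Gv) auto
  have 2: "((\<lambda>y. - ((y - p) / (sqrt (c - y\<^sup>2))^3)) has_integral - (G p - G (- Y))) {- Y..p}"
    using pY by (intro has_integral_neg fundamental_theorem_of_calculus Gv) auto
  have h1: "((\<lambda>y. \<bar>p - y\<bar> / (sqrt (c - y\<^sup>2))^3) has_integral (G Y - G p)) {p..Y}"
    by (rule has_integral_eq[OF _ 1]) auto
  have h2: "((\<lambda>y. \<bar>p - y\<bar> / (sqrt (c - y\<^sup>2))^3) has_integral - (G p - G (- Y))) {- Y..p}"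
    by (rule has_integral_eq[OF _ 2]) (auto simp: minus_divide_left)
  have 3: "((\<lambda>y. \<bar>p - y\<bar> / (sqrt (c - y\<^sup>2))^3) has_integral - (G p - G (- Y)) + (G Y - G p)) {- Y..Y}"
    using pY by (intro has_integral_combine[OF _ _ h2 h1]) auto
  have val: "- (G p - G (- Y)) + (G Y - G p) = 2 / sqrt (1 - R\<^sup>2) - 2 * sqrt (1 - x\<^sup>2 - p\<^sup>2) / (1 - x\<^sup>2)"
  proof -
    have cY: "c - Y\<^sup>2 = 1 - R\<^sup>2" using Y2 by (simp add: c_def)
    have "G Y + G (- Y) = 2 / sqrt (1 - R\<^sup>2)"
      unfolding G_def using c0 R1 by (simp add: cY field_simps)
    moreover have "G p = sqrt (1 - x\<^sup>2 - p\<^sup>2) / (1 - x\<^sup>2)"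
    proof -
      have "c - p\<^sup>2 > 0" using inY[of p] pY by simp
      then have "(c - p * p) / (c * sqrt (c - p\<^sup>2)) = sqrt (c - p\<^sup>2) / c"
        using c0 real_sqrt_mult_self[of "c - p\<^sup>2"] by (simp add: field_simps power2_eq_square)
      then show ?thesis by (simp add: G_def c_def)
    qed
    ultimately show ?thesis by simp
  qed
  have "(\<integral>\<^sup>+y. indicator {- Y..Y} y * (\<bar>p - y\<bar> / (sqrt (c - y\<^sup>2))^3) \<partial>lborel)
      = ennreal (2 / sqrt (1 - R\<^sup>2) - 2 * sqrt (1 - x\<^sup>2 - p\<^sup>2) / (1 - x\<^sup>2))"
  proof (rule nn_integral_has_integral_lebesgue[OF _ 3[unfolded val]])
    show "0 \<le> \<bar>p - y\<bar> / (sqrt (c - y\<^sup>2))^3" if "y \<in> {- Y..Y}" for y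
      using inY[of y] that by (intro divide_nonneg_nonneg zero_le_power) (auto simp: abs_le_iff)
  qed
  also have "(\<integral>\<^sup>+y. indicator {- Y..Y} y * (\<bar>p - y\<bar> / (sqrt (c - y\<^sup>2))^3) \<partial>lborel) = chord_weight R x p"
    unfolding chord_weight_def
  proof (rule nn_integral_cong_AE)
    have eq: "indicator {- Y..Y} y * (\<bar>p - y\<bar> / (sqrt (c - y\<^sup>2))^3) = weight R (x, y) * \<bar>p - y\<bar>"
      if "y \<notin> {- Y, Y}" for y
    proof (cases "y \<in> {- Y..Y}")
      case True
      then have "\<bar>y\<bar> < \<bar>Y\<bar>" using that by auto
      then have "y\<^sup>2 < Y\<^sup>2" using abs_le_square_iff[of Y y] by linarith
      then have "x\<^sup>2 + y\<^sup>2 < R\<^sup>2" using Y2 by simp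
      then show ?thesis using True by (simp add: weight_def c_def)
    next
      case False
      then have "\<not> \<bar>y\<bar> \<le> \<bar>Y\<bar>" using Y0 by auto
      then have "\<not> y\<^sup>2 \<le> Y\<^sup>2" using abs_le_square_iff[of y Y] by simp
      then have "\<not> x\<^sup>2 + y\<^sup>2 < R\<^sup>2" using Y2 by simp
      then show ?thesis using False by (simp add: weight_def)
    qed
    have "AE y in lborel. y \<notin> {- Y, Y}"
      by (intro AE_not_in countable_imp_null_set_lborel) auto
    then show "AE y in lborel. ennreal (indicator {- Y..Y} y * (\<bar>p - y\<bar> / (sqrt (c - y\<^sup>2))^3)) = ennreal (weight R (x, y) * \<bar>p - y\<bar>)"
      by eventually_elim (rule arg_cong[where f = ennreal, OF eq])
  qed
  finally show ?thesis .
qed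

text \<open>This is the area 2 pi (cosh rho - 1) of a hyperbolic disc of radius rho, where R = tanh
  rho and hence cosh rho = 1 / sqrt (1 - R^2). It is computed by vertical slices.\<close>

lemma nn_integral_weight:
  assumes R: "0 < R" "R < 1"
  shows "(\<integral>\<^sup>+v. weight R v \<partial>lborel) = ennreal (2 * pi * (1 / sqrt (1 - R\<^sup>2) - 1))"
proof -
  have R1: "R\<^sup>2 < 1" using power_strict_mono[of R 1 2] R by simp
  define s where "s = sqrt (1 - R\<^sup>2)"
  have s: "s > 0" "s\<^sup>2 = 1 - R\<^sup>2" using R1 by (simp_all add: s_def)
  have inner: "(\<integral>\<^sup>+y. weight R (x, y) \<partial>lborel) = ennreal (indicator {- R..R} x * (2 * sqrt (R\<^sup>2 - x\<^sup>2) / ((1 - x\<^sup>2) * s)))" for x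
  proof (cases "\<bar>x\<bar> < R")
    case False
    then have "\<bar>R\<bar> \<le> \<bar>x\<bar>" using R by simp
    then have Rx: "R\<^sup>2 \<le> x\<^sup>2" using abs_le_square_iff by blast
    have "\<not> x\<^sup>2 + y\<^sup>2 < R\<^sup>2" for y using Rx zero_le_power2[of y] by linarith
    then have "(\<integral>\<^sup>+y. weight R (x, y) \<partial>lborel) = 0" by (simp add: weight_def)
    moreover have "indicator {- R..R} x * (2 * sqrt (R\<^sup>2 - x\<^sup>2) / ((1 - x\<^sup>2) * s)) = 0"
    proof (cases "x \<in> {- R..R}")
      case True
      then have "x = R \<or> x = - R" using False by auto
      then show ?thesis by auto
    qed simp
    ultimately show ?thesis by (simp only: ennreal_0)
  next
    case True
    define c where "c = 1 - x\<^sup>2"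
    define Y where "Y = sqrt (R\<^sup>2 - x\<^sup>2)"
    have "\<bar>x\<bar> < \<bar>R\<bar>" using True by simp
    then have Rx: "R\<^sup>2 - x\<^sup>2 > 0" using abs_le_square_iff[of R x] by linarith
    have Y2: "Y\<^sup>2 = R\<^sup>2 - x\<^sup>2" and Y0: "Y > 0" using Rx by (simp_all add: Y_def)
    have c0: "c > 0" using Rx R1 by (simp add: c_def)
    have inY: "c - y\<^sup>2 > 0" if "\<bar>y\<bar> \<le> Y" for y
    proof -
      have "y\<^sup>2 \<le> Y\<^sup>2" using that Y0 abs_le_square_iff[of y Y] by simp
      then show ?thesis using Y2 R1 by (simp add: c_def)
    qed
    define G where "G y = y / (c * sqrt (c - y\<^sup>2))" for y
    have G: "(G has_real_derivative 1 / (sqrt (c - y\<^sup>2))^3) (at y)" if y: "\<bar>y\<bar> \<le> Y" for y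
    proof -
      define q where "q = sqrt (c - y\<^sup>2)"
      have q: "q > 0" "q\<^sup>2 = c - y\<^sup>2" using inY[OF y] by (simp_all add: q_def)
      have dq: "((\<lambda>y. sqrt (c - y\<^sup>2)) has_real_derivative (- y / q)) (at y)"
        using inY[OF y] unfolding q_def by (auto intro!: derivative_eq_intros simp: field_simps)
      have "((\<lambda>y. y / (c * sqrt (c - y\<^sup>2))) has_real_derivative
          (1 * (c * sqrt (c - y\<^sup>2)) - y * (c * (- y / q))) / ((c * sqrt (c - y\<^sup>2)) * (c * sqrt (c - y\<^sup>2)))) (at y)"
      proof (rule DERIV_divide)
        show "((\<lambda>y. y) has_real_derivative 1) (at y)" by (rule DERIV_ident)
        show "((\<lambda>y. c * sqrt (c - y\<^sup>2)) has_real_derivative c * (- y / q)) (at y)" by (rule DERIV_cmult[OF dq])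
      qed (use c0 q in \<open>simp add: q_def\<close>)
      then have "(G has_real_derivative (1 * (c * q) - y * (c * (- y / q))) / (c * q)\<^sup>2) (at y)"
        by (simp only: G_def[abs_def] q_def power2_eq_square)
      also have "(1 * (c * q) - y * (c * (- y / q))) / (c * q)\<^sup>2 = 1 / q^3"
      proof -
        have "(1 * (c * q) - y * (c * (- y / q))) = (c / q) * (q\<^sup>2 + y\<^sup>2)"
          using q(1) by (simp add: field_simps power2_eq_square)
        also have "\<dots> = (c / q) * c" unfolding q by simp
        finally have num: "(1 * (c * q) - y * (c * (- y / q))) = (c / q) * c" .
        show ?thesis unfolding num using q(1) c0 by (simp add: field_simps power2_eq_square power3_eq_cube)
      qed
      finally show ?thesis by (simp add: q_def)
    qed
    have Gv: "(G has_vector_derivative 1 / (sqrt (c - y\<^sup>2))^3) (at y within S)" if "\<bar>y\<bar> \<le> Y" for y S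
      using has_field_derivative_at_within[OF G[OF that]] by (simp add: has_real_derivative_iff_has_vector_derivative)
    have 1: "((\<lambda>y. 1 / (sqrt (c - y\<^sup>2))^3) has_integral (G Y - G (- Y))) {- Y..Y}"
      using Y0 by (intro fundamental_theorem_of_calculus Gv) auto
    have cY: "sqrt (c - Y\<^sup>2) = s" using Y2 by (simp add: c_def s_def)
    have val: "G Y - G (- Y) = 2 * Y / (c * s)"
      unfolding G_def power2_minus cY by simp
    have "(\<integral>\<^sup>+y. indicator {- Y..Y} y * (1 / (sqrt (c - y\<^sup>2))^3) \<partial>lborel) = ennreal (2 * Y / (c * s))"
    proof (rule nn_integral_has_integral_lebesgue[OF _ 1[unfolded val]])
      show "0 \<le> 1 / (sqrt (c - y\<^sup>2))^3" if "y \<in> {- Y..Y}" for y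
        using inY[of y] that by (intro divide_nonneg_nonneg zero_le_power) (auto simp: abs_le_iff)
    qed
    also have "(\<integral>\<^sup>+y. indicator {- Y..Y} y * (1 / (sqrt (c - y\<^sup>2))^3) \<partial>lborel) = (\<integral>\<^sup>+y. weight R (x, y) \<partial>lborel)"
    proof (rule nn_integral_cong_AE)
      have eq: "indicator {- Y..Y} y * (1 / (sqrt (c - y\<^sup>2))^3) = weight R (x, y)"
        if "y \<notin> {- Y, Y}" for y
      proof (cases "y \<in> {- Y..Y}")
        case True
        then have "\<bar>y\<bar> < \<bar>Y\<bar>" using that by auto
        then have "y\<^sup>2 < Y\<^sup>2" using abs_le_square_iff[of Y y] by linarith
        then have "x\<^sup>2 + y\<^sup>2 < R\<^sup>2" using Y2 by simp
        then show ?thesis using True by (simp add: weight_def c_def)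
      next
        case False
        then have "\<not> \<bar>y\<bar> \<le> \<bar>Y\<bar>" using Y0 by auto
        then have "\<not> y\<^sup>2 \<le> Y\<^sup>2" using abs_le_square_iff[of y Y] by simp
        then have "\<not> x\<^sup>2 + y\<^sup>2 < R\<^sup>2" using Y2 by simp
        then show ?thesis using False by (simp add: weight_def)
      qed
      have "AE y in lborel. y \<notin> {- Y, Y}"
        by (intro AE_not_in countable_imp_null_set_lborel) auto
      then show "AE y in lborel. ennreal (indicator {- Y..Y} y * (1 / (sqrt (c - y\<^sup>2))^3)) = ennreal (weight R (x, y))"
        by eventually_elim (rule arg_cong[where f = ennreal, OF eq])
    qed
    finally have "(\<integral>\<^sup>+y. weight R (x, y) \<partial>lborel) = ennreal (2 * Y / (c * s))" .
    moreover have "x \<in> {- R..R}" using True by auto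
    ultimately show ?thesis by (simp add: Y_def c_def)
  qed
  \<comment> \<open>Since R^2 - x^2 = (1 - x^2) - s^2, the slice function splits into 1 / sqrt (R^2
    - x^2) minus s^2 / ((1 - x^2) sqrt (R^2 - x^2)). The terms \<open>arcsin (x / R)\<close> and
    \<open>s * arcsin (u x)\<close> are antiderivatives of these two.\<close>
  define u where "u x = s * x / (R * sqrt (1 - x\<^sup>2))" for x
  define F where "F x = arcsin (x / R) - s * arcsin (u x)" for x
  have x1: "1 - x\<^sup>2 > 0" if "x \<in> {- R..R}" for x
  proof -
    have "\<bar>x\<bar> \<le> \<bar>R\<bar>" using that by auto
    then have "x\<^sup>2 \<le> R\<^sup>2" using abs_le_square_iff by blast
    then show ?thesis using R1 by linarith
  qed
  have u2: "1 - (u x)\<^sup>2 = (R\<^sup>2 - x\<^sup>2) / (R\<^sup>2 * (1 - x\<^sup>2))" if "x \<in> {- R..R}" for x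
  proof -
    have "(u x)\<^sup>2 = (1 - R\<^sup>2) * x\<^sup>2 / (R\<^sup>2 * (1 - x\<^sup>2))"
      using x1[OF that] by (simp add: u_def power_divide power_mult_distrib s)
    then show ?thesis using x1[OF that] R by (simp add: field_simps)
  qed
  have Fc: "continuous_on {- R..R} F"
  proof -
    have "\<bar>u x\<bar> \<le> 1" if "x \<in> {- R..R}" for x
    proof -
      have "\<bar>x\<bar> \<le> \<bar>R\<bar>" using that by auto
      then have "x\<^sup>2 \<le> R\<^sup>2" using abs_le_square_iff by blast
      then have "1 - (u x)\<^sup>2 \<ge> 0" unfolding u2[OF that] using x1[OF that] by simp
      then show ?thesis using abs_le_square_iff[of "u x" 1] by simp
    qed
    then have "continuous_on {- R..R} (\<lambda>x. arcsin (u x))"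
    proof (intro continuous_on_arcsin ballI)
      show "continuous_on {- R..R} u"
        unfolding u_def using x1 R by (intro continuous_intros) (auto simp: less_imp_neq)
    qed (auto simp: abs_le_iff)
    moreover have "continuous_on {- R..R} (\<lambda>x. arcsin (x / R))"
      using R by (intro continuous_on_arcsin continuous_intros) (auto simp: field_simps)
    ultimately show ?thesis
      unfolding F_def by (intro continuous_on_diff continuous_on_mult continuous_on_const)
  qed
  have Fd: "(F has_real_derivative sqrt (R\<^sup>2 - x\<^sup>2) / (1 - x\<^sup>2)) (at x)" if x: "x \<in> {- R<..<R}" for x
  proof -
    define c where "c = 1 - x\<^sup>2"
    define Y where "Y = sqrt (R\<^sup>2 - x\<^sup>2)"
    define q where "q = sqrt c"
    have xi: "x \<in> {- R..R}" and "\<bar>x\<bar> < \<bar>R\<bar>" using x by auto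
    then have Rx: "R\<^sup>2 - x\<^sup>2 > 0" using abs_le_square_iff[of R x] by linarith
    have c0: "c > 0" using x1[OF xi] by (simp add: c_def)
    have Y: "Y > 0" "Y\<^sup>2 = R\<^sup>2 - x\<^sup>2" using Rx by (simp_all add: Y_def)
    have q: "q > 0" "q\<^sup>2 = c" using c0 by (simp_all add: q_def)
    have squ: "sqrt (1 - (u x)\<^sup>2) = Y / (R * q)"
      unfolding u2[OF xi] using R by (simp add: real_sqrt_divide real_sqrt_mult Y_def q_def c_def)
    then have "1 - (u x)\<^sup>2 > 0" using Y q R by (metis mult_pos_pos divide_pos_pos real_sqrt_gt_0_iff)
    then have u1: "-1 < u x" "u x < 1" using abs_square_less_1[of "u x"] by auto
    have dq: "((\<lambda>y. sqrt (1 - y\<^sup>2)) has_real_derivative (- x / q)) (at x)"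
      using c0 unfolding q_def c_def by (auto intro!: derivative_eq_intros simp: field_simps)
    have "(u has_real_derivative (s * (R * sqrt (1 - x\<^sup>2)) - s * x * (R * (- x / q))) / ((R * sqrt (1 - x\<^sup>2)) * (R * sqrt (1 - x\<^sup>2)))) (at x)"
      unfolding u_def[abs_def]
    proof (rule DERIV_divide)
      show "((\<lambda>x. s * x) has_real_derivative s) (at x)" by (auto intro!: derivative_eq_intros)
      show "((\<lambda>x. R * sqrt (1 - x\<^sup>2)) has_real_derivative R * (- x / q)) (at x)" by (rule DERIV_cmult[OF dq])
    qed (use c0 R in \<open>simp add: c_def\<close>)
    also have "(s * (R * sqrt (1 - x\<^sup>2)) - s * x * (R * (- x / q))) / ((R * sqrt (1 - x\<^sup>2)) * (R * sqrt (1 - x\<^sup>2))) = s / (R * q ^ 3)"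
    proof -
      have e: "sqrt (1 - x\<^sup>2) = q" by (simp add: q_def c_def)
      have "s * (R * q) - s * x * (R * (- x / q)) = (s * R / q) * (q\<^sup>2 + x\<^sup>2)"
        using q(1) by (simp add: field_simps power2_eq_square)
      also have "\<dots> = s * R / q" unfolding q(2) c_def by simp
      finally have num: "s * (R * q) - s * x * (R * (- x / q)) = s * R / q" .
      show ?thesis unfolding e num using q(1) R by (simp add: field_simps power3_eq_cube)
    qed
    finally have du: "(u has_real_derivative s / (R * q ^ 3)) (at x)" .
    have "(F has_real_derivative (inverse (sqrt (1 - (x / R)\<^sup>2)) * (1 / R) - s * (inverse (sqrt (1 - (u x)\<^sup>2)) * (s / (R * q ^ 3))))) (at x)"
      unfolding F_def
    proof (intro DERIV_diff DERIV_cmult)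
      show "((\<lambda>x. arcsin (u x)) has_real_derivative inverse (sqrt (1 - (u x)\<^sup>2)) * (s / (R * q ^ 3))) (at x)"
        by (rule DERIV_chain2[OF DERIV_arcsin[OF u1] du])
      show "((\<lambda>x. arcsin (x / R)) has_real_derivative inverse (sqrt (1 - (x / R)\<^sup>2)) * (1 / R)) (at x)"
      proof (rule DERIV_chain2[OF DERIV_arcsin])
        show "- 1 < x / R" "x / R < 1" using x R by (auto simp: field_simps)
        show "((\<lambda>x. x / R) has_real_derivative 1 / R) (at x)" by (rule DERIV_cdivide[OF DERIV_ident])
      qed
    qed
    also have "(inverse (sqrt (1 - (x / R)\<^sup>2)) * (1 / R) - s * (inverse (sqrt (1 - (u x)\<^sup>2)) * (s / (R * q ^ 3)))) = Y / c"
    proof -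
      have "1 - (x / R)\<^sup>2 = (R\<^sup>2 - x\<^sup>2) / R\<^sup>2" using R by (simp add: field_simps)
      then have a: "sqrt (1 - (x / R)\<^sup>2) = Y / R" using R by (simp add: real_sqrt_divide Y_def)
      have "inverse (Y / R) * (1 / R) - s * (inverse (Y / (R * q)) * (s / (R * q ^ 3))) = 1 / Y - s\<^sup>2 / (Y * q\<^sup>2)"
        using R q(1) Y(1) by (simp add: field_simps power2_eq_square power3_eq_cube)
      also have "\<dots> = (c - s\<^sup>2) / (Y * c)" unfolding q(2) using c0 Y(1) by (simp add: field_simps)
      also have "c - s\<^sup>2 = Y\<^sup>2" by (simp add: c_def s Y)
      also have "Y\<^sup>2 / (Y * c) = Y / c" using Y(1) by (simp add: power2_eq_square)
      finally show ?thesis unfolding a squ .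
    qed
    finally show ?thesis by (simp add: Y_def c_def)
  qed
  \<comment> \<open>The arcsines are not differentiable at the ends of the interval, hence the form
    of the fundamental theorem that asks only for continuity there.\<close>
  have Fint: "((\<lambda>x. sqrt (R\<^sup>2 - x\<^sup>2) / (1 - x\<^sup>2)) has_integral F R - F (- R)) {- R..R}"
    using R Fc Fd by (intro fundamental_theorem_of_calculus_interior)
      (auto simp: has_real_derivative_iff_has_vector_derivative)
  have "u R = 1" "u (- R) = - 1" using R s(1) by (auto simp: u_def s_def)
  then have Fval: "F R - F (- R) = pi * (1 - s)"
    using R by (simp add: F_def algebra_simps)
  have int: "((\<lambda>x. 2 * sqrt (R\<^sup>2 - x\<^sup>2) / ((1 - x\<^sup>2) * s)) has_integral 2 / s * (pi * (1 - s))) {- R..R}"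
    using has_integral_mult_right[OF Fint, of "2 / s"] unfolding Fval by (simp add: field_simps)
  have "(\<integral>\<^sup>+v. weight R v \<partial>lborel) = (\<integral>\<^sup>+x. ennreal (indicator {- R..R} x * (2 * sqrt (R\<^sup>2 - x\<^sup>2) / ((1 - x\<^sup>2) * s))) \<partial>lborel)"
    by (subst nn_integral_lborel_prod(1)) (simp_all only: inner, measurable)
  also have "\<dots> = ennreal (2 / s * (pi * (1 - s)))"
  proof (rule nn_integral_has_integral_lebesgue[OF _ int])
    fix x assume x: "x \<in> {- R..R}"
    then have "\<bar>x\<bar> \<le> \<bar>R\<bar>" by auto
    then have "x\<^sup>2 \<le> R\<^sup>2" using abs_le_square_iff by blast
    then show "0 \<le> 2 * sqrt (R\<^sup>2 - x\<^sup>2) / ((1 - x\<^sup>2) * s)"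
      using x1[OF x] s(1) by (intro divide_nonneg_nonneg mult_nonneg_nonneg) auto
  qed
  also have "2 / s * (pi * (1 - s)) = 2 * pi * (1 / sqrt (1 - R\<^sup>2) - 1)"
    using s(1) unfolding s_def[symmetric] by (simp add: field_simps)
  finally show ?thesis .
qed

lemma measurable_chord_weight [measurable]:
  assumes [measurable]: "f \<in> borel_measurable M" "g \<in> borel_measurable M"
  shows "(\<lambda>z. chord_weight R (f z) (g z)) \<in> borel_measurable M"
  unfolding chord_weight_def by measurable

text \<open>The derivative of \<open>arctan (n x)\<close>: integrating \<open>kernel n (g t) * \<bar>g' t\<bar>\<close> picks up \<open>\<pi>\<close> at each sign
  change of \<open>g\<close> in the limit.\<close>

definition kernel :: "nat \<Rightarrow> real \<Rightarrow> real" where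
  "kernel n x = real (Suc n) / (1 + (real (Suc n) * x)\<^sup>2)"

lemma kernel_measurable [measurable]: "kernel n \<in> borel_measurable borel"
  unfolding kernel_def by measurable

lemma kernel_nonneg: "0 \<le> kernel n x"
  by (simp add: kernel_def add_nonneg_nonneg)

lemma DERIV_arctan_kernel:
  assumes "(g has_real_derivative d) (at t)"
  shows "((\<lambda>t. arctan (real (Suc n) * g t)) has_real_derivative kernel n (g t) * d) (at t)"
  unfolding kernel_def using assms by (auto intro!: derivative_eq_intros simp: field_simps)

lemma nn_integral_inverse_1_plus_square:
  "(\<integral>\<^sup>+u. ennreal (1 / (1 + u\<^sup>2)) \<partial>lborel) \<le> ennreal pi"
proof -
  let ?f = "\<lambda>u::real. ennreal (1 / (1 + u\<^sup>2))"
  have half: "(\<integral>\<^sup>+u. ?f u * indicator {0..} u \<partial>lborel) = ennreal (pi / 2)"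
  proof -
    have "(\<integral>\<^sup>+u. ?f u * indicator {0..} u \<partial>lborel) = ennreal (pi / 2 - arctan 0)"
    proof (rule nn_integral_FTC_atLeast[OF _ _ _ tendsto_arctan_at_top])
      show "DERIV arctan x :> 1 / (1 + x\<^sup>2)" for x
        using DERIV_arctan[of x] by (simp add: inverse_eq_divide)
    qed (auto intro!: divide_nonneg_nonneg add_nonneg_nonneg)
    then show ?thesis by simp
  qed
  have neg: "(\<integral>\<^sup>+u. ?f u * indicator {..0} u \<partial>lborel) = (\<integral>\<^sup>+u. ?f u * indicator {0..} u \<partial>lborel)"
    by (subst nn_integral_real_affine[of _ "-1" 0]) (auto simp: indicator_def intro!: nn_integral_cong)
  have "(\<integral>\<^sup>+u. ?f u \<partial>lborel) \<le> (\<integral>\<^sup>+u. ?f u * indicator {0..} u + ?f u * indicator {..0} u \<partial>lborel)"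
    by (intro nn_integral_mono) (auto simp: indicator_def)
  also have "\<dots> = (\<integral>\<^sup>+u. ?f u * indicator {0..} u \<partial>lborel) + (\<integral>\<^sup>+u. ?f u * indicator {..0} u \<partial>lborel)"
    by (rule nn_integral_add) measurable
  also have "\<dots> = ennreal (pi / 2) + ennreal (pi / 2)" by (simp only: neg half)
  also have "ennreal (pi / 2) + ennreal (pi / 2) = ennreal pi"
    by (subst ennreal_plus[symmetric]) auto
  finally show ?thesis .
qed

text \<open>The substitution x = h - u / (n + 1) moves the dependence on n from the kernel into the
  argument of k, where continuity at h and a fixed integrable majorant give the limit.\<close>

lemma nn_integral_kernel:
  fixes k :: "real \<Rightarrow> ennreal"
  assumes [measurable]: "k \<in> borel_measurable borel"
  shows "(\<integral>\<^sup>+x. kernel n (h - x) * k x \<partial>lborel)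
    = (\<integral>\<^sup>+u. ennreal (1 / (1 + u\<^sup>2)) * k (h + (- 1 / real (Suc n)) * u) \<partial>lborel)"
proof -
  let ?c = "- 1 / real (Suc n)"
  have "(\<integral>\<^sup>+x. kernel n (h - x) * k x \<partial>lborel)
      = ennreal \<bar>?c\<bar> * (\<integral>\<^sup>+u. kernel n (h - (h + ?c * u)) * k (h + ?c * u) \<partial>lborel)"
    by (rule nn_integral_real_affine) auto
  also have "\<dots> = (\<integral>\<^sup>+u. ennreal \<bar>?c\<bar> * (kernel n (h - (h + ?c * u)) * k (h + ?c * u)) \<partial>lborel)"
    by (rule nn_integral_cmult[symmetric]) measurable
  also have "\<dots> = (\<integral>\<^sup>+u. ennreal (1 / (1 + u\<^sup>2)) * k (h + ?c * u) \<partial>lborel)"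
  proof (intro nn_integral_cong)
    fix u :: real
    have "real (Suc n) * (h - (h + ?c * u)) = u" by simp
    then have "\<bar>?c\<bar> * kernel n (h - (h + ?c * u)) = 1 / (1 + u\<^sup>2)" by (simp add: kernel_def)
    then show "ennreal \<bar>?c\<bar> * (kernel n (h - (h + ?c * u)) * k (h + ?c * u)) = ennreal (1 / (1 + u\<^sup>2)) * k (h + ?c * u)"
      by (metis abs_ge_zero ennreal_mult' mult.assoc)
  qed
  finally show ?thesis .
qed

lemma nn_integral_kernel_le:
  fixes k :: "real \<Rightarrow> ennreal"
  assumes "k \<in> borel_measurable borel" "\<And>x. k x \<le> B"
  shows "(\<integral>\<^sup>+x. kernel n (h - x) * k x \<partial>lborel) \<le> ennreal pi * B"
proof -
  have "(\<integral>\<^sup>+x. kernel n (h - x) * k x \<partial>lborel) \<le> (\<integral>\<^sup>+u. ennreal (1 / (1 + u\<^sup>2)) * B \<partial>lborel)"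
    unfolding nn_integral_kernel[OF assms(1)] by (intro nn_integral_mono mult_left_mono assms(2)) simp
  also have "\<dots> = (\<integral>\<^sup>+u. ennreal (1 / (1 + u\<^sup>2)) \<partial>lborel) * B"
    by (rule nn_integral_multc) measurable
  also have "\<dots> \<le> ennreal pi * B"
    by (intro mult_right_mono nn_integral_inverse_1_plus_square) simp
  finally show ?thesis .
qed

lemma nn_integral_kernel_tendsto:
  fixes k :: "real \<Rightarrow> ennreal"
  assumes [measurable]: "k \<in> borel_measurable borel" and B: "\<And>x. k x \<le> ennreal B" and k: "isCont k h"
  shows "(\<lambda>n. \<integral>\<^sup>+x. kernel n (h - x) * k x \<partial>lborel) \<longlonglongrightarrow> (\<integral>\<^sup>+u. ennreal (1 / (1 + u\<^sup>2)) \<partial>lborel) * k h"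
proof -
  have "(\<lambda>n. \<integral>\<^sup>+u. ennreal (1 / (1 + u\<^sup>2)) * k (h + (- 1 / real (Suc n)) * u) \<partial>lborel)
      \<longlonglongrightarrow> (\<integral>\<^sup>+u. ennreal (1 / (1 + u\<^sup>2)) * k h \<partial>lborel)"
  proof (rule nn_integral_dominated_convergence[where w = "\<lambda>u. ennreal (1 / (1 + u\<^sup>2)) * ennreal B"])
    show "AE u in lborel. ennreal (1 / (1 + u\<^sup>2)) * k (h + (- 1 / real (Suc n)) * u) \<le> ennreal (1 / (1 + u\<^sup>2)) * ennreal B" for n
      by (intro AE_I2 mult_left_mono B) simp
    have "(\<integral>\<^sup>+u. ennreal (1 / (1 + u\<^sup>2)) * ennreal B \<partial>lborel) = (\<integral>\<^sup>+u. ennreal (1 / (1 + u\<^sup>2)) \<partial>lborel) * ennreal B"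
      by (rule nn_integral_multc) measurable
    also have "\<dots> \<le> ennreal pi * ennreal B"
      by (intro mult_right_mono nn_integral_inverse_1_plus_square) simp
    also have "\<dots> < \<infinity>" by (simp add: ennreal_mult_less_top)
    finally show "(\<integral>\<^sup>+u. ennreal (1 / (1 + u\<^sup>2)) * ennreal B \<partial>lborel) < \<infinity>" .
    show "AE u in lborel. (\<lambda>n. ennreal (1 / (1 + u\<^sup>2)) * k (h + (- 1 / real (Suc n)) * u)) \<longlonglongrightarrow> ennreal (1 / (1 + u\<^sup>2)) * k h"
    proof (intro AE_I2)
      fix u :: real
      have "(\<lambda>n. h + (- 1 / real (Suc n)) * u) \<longlonglongrightarrow> h + 0 * u"
      proof (intro tendsto_intros)
        have "(\<lambda>n. - (inverse (real (Suc n)))) \<longlonglongrightarrow> - 0"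
          by (intro tendsto_intros LIMSEQ_inverse_real_of_nat)
        then show "(\<lambda>n. - 1 / real (Suc n)) \<longlonglongrightarrow> 0" by (simp add: inverse_eq_divide)
      qed
      then have "(\<lambda>n. k (h + (- 1 / real (Suc n)) * u)) \<longlonglongrightarrow> k h"
        using isCont_tendsto_compose[OF k] by simp
      then show "(\<lambda>n. ennreal (1 / (1 + u\<^sup>2)) * k (h + (- 1 / real (Suc n)) * u)) \<longlonglongrightarrow> ennreal (1 / (1 + u\<^sup>2)) * k h"
        by (intro ennreal_tendsto_cmult) auto
    qed
  qed measurable
  then show ?thesis
    unfolding nn_integral_kernel[OF assms(1)] by (subst nn_integral_multc[symmetric]) auto
qed

text \<open>The condition on (h, p) is open, so the closed formula holds for all x near h.\<close>

lemma isCont_chord_weight: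
  assumes R: "0 < R" "R < 1" and xp: "h\<^sup>2 + p\<^sup>2 < R\<^sup>2"
  shows "isCont (\<lambda>x. chord_weight R x p) h"
proof -
  have R1: "R\<^sup>2 < 1" using power_strict_mono[of R 1 2] R by simp
  have h1: "1 - h\<^sup>2 \<noteq> 0" using xp R1 zero_le_power2[of p] by linarith
  have "isCont (\<lambda>x. 2 / sqrt (1 - R\<^sup>2) - 2 * sqrt (1 - x\<^sup>2 - p\<^sup>2) / (1 - x\<^sup>2)) h"
    by (intro continuous_diff continuous_divide continuous_mult continuous_real_sqrt
        continuous_const continuous_power continuous_ident) (use h1 in auto)
  then have c: "isCont (\<lambda>x. ennreal (2 / sqrt (1 - R\<^sup>2) - 2 * sqrt (1 - x\<^sup>2 - p\<^sup>2) / (1 - x\<^sup>2))) h"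
    unfolding isCont_def by (rule tendsto_ennrealI)
  have "open {x. x\<^sup>2 + p\<^sup>2 < R\<^sup>2}" by (intro open_Collect_less continuous_intros)
  then have "eventually (\<lambda>x. x \<in> {x. x\<^sup>2 + p\<^sup>2 < R\<^sup>2}) (nhds h)" using xp by (intro eventually_nhds_in_open) auto
  then have "eventually (\<lambda>x. chord_weight R x p = ennreal (2 / sqrt (1 - R\<^sup>2) - 2 * sqrt (1 - x\<^sup>2 - p\<^sup>2) / (1 - x\<^sup>2))) (nhds h)"
    by eventually_elim (simp add: chord_weight_eq[OF R])
  from isCont_cong[OF this] c show ?thesis by simp
qed

text \<open>When g' is the derivative of g, this is the total variation of arctan ((n + 1) g) over
  [0, P]: an integrable substitute for pi times the number of zeros.\<close>

definition crossings :: "(real \<Rightarrow> real) \<Rightarrow> (real \<Rightarrow> real) \<Rightarrow> real \<Rightarrow> nat \<Rightarrow> ennreal" where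
  "crossings g g' P n = (\<integral>\<^sup>+t. ennreal (kernel n (g t) * \<bar>g' t\<bar>) * indicator {0..P} t \<partial>lborel)"

text \<open>By Tonelli the integral over v may be taken first, for fixed t. Rotating v by
  \<open>\<theta> t\<close> leaves the weight unchanged and makes the kernel depend on x alone, so
  the y-integral is \<open>chord_weight\<close>. As n grows the kernel concentrates at x =
  \<open>h t\<close>, and dominated convergence passes the limit through the integral over
  t.\<close>

theorem crofton_tendsto:
  fixes \<theta> h \<omega> p :: "real \<Rightarrow> real"
  assumes [measurable]: "\<theta> \<in> borel_measurable borel" "h \<in> borel_measurable borel"
      "\<omega> \<in> borel_measurable borel" "p \<in> borel_measurable borel"
    and R: "0 < R" "R < 1" and hp: "\<And>t. (h t)\<^sup>2 + (p t)\<^sup>2 < R\<^sup>2" and \<omega>: "\<And>t. \<omega> t \<ge> 0"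
    and fin: "(\<integral>\<^sup>+t. ennreal (\<omega> t) * indicator {0..P} t \<partial>lborel) < \<infinity>"
  shows "(\<lambda>n. \<integral>\<^sup>+v. weight R v * crossings (\<lambda>t. h t - (fst v * cos (\<theta> t) + snd v * sin (\<theta> t)))
            (\<lambda>t. \<omega> t * (p t - (snd v * cos (\<theta> t) - fst v * sin (\<theta> t)))) P n \<partial>lborel)
       \<longlonglongrightarrow> (\<integral>\<^sup>+t. ennreal (\<omega> t) * indicator {0..P} t *
             ((\<integral>\<^sup>+u. ennreal (1 / (1 + u\<^sup>2)) \<partial>lborel) * chord_weight R (h t) (p t)) \<partial>lborel)"
    (is "?L \<longlonglongrightarrow> ?J")
proof -
  let ?I = "\<lambda>t. ennreal (\<omega> t) * indicator {0..P} t"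
  let ?K = "\<lambda>n t. \<integral>\<^sup>+x. kernel n (h t - x) * chord_weight R x (p t) \<partial>lborel"
  let ?B = "4 / (sqrt (1 - R\<^sup>2))^3"
  have R1: "R\<^sup>2 < 1" using power_strict_mono[of R 1 2] R by simp
  have pb: "\<bar>p t\<bar> \<le> 1" for t
  proof -
    have "(p t)\<^sup>2 \<le> 1" using hp[of t] R1 zero_le_power2[of "h t"] by linarith
    then show ?thesis using abs_le_square_iff[of "p t" 1] by simp
  qed
  have eq: "?L n = (\<integral>\<^sup>+t. ?I t * ?K n t \<partial>lborel)" for n
  proof -
    let ?E = "\<lambda>v t. ennreal (kernel n (h t - (fst v * cos (\<theta> t) + snd v * sin (\<theta> t))) *
          \<bar>\<omega> t * (p t - (snd v * cos (\<theta> t) - fst v * sin (\<theta> t)))\<bar>) * indicator {0..P} t"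
    have "?L n = (\<integral>\<^sup>+v. (\<integral>\<^sup>+t. ennreal (weight R v) * ?E v t \<partial>lborel) \<partial>lborel)"
      unfolding crossings_def by (intro nn_integral_cong nn_integral_cmult[symmetric]) measurable
    also have "\<dots> = (\<integral>\<^sup>+t. (\<integral>\<^sup>+v. ennreal (weight R v) * ?E v t \<partial>lborel) \<partial>lborel)"
      by (rule lborel_pair.Fubini'[symmetric]) measurable
    also have "\<dots> = (\<integral>\<^sup>+t. ?I t * ?K n t \<partial>lborel)"
    proof (intro nn_integral_cong)
      fix t :: real
      let ?F = "\<lambda>v. ennreal (weight R v) * (ennreal (kernel n (h t - fst v) * \<bar>\<omega> t * (p t - snd v)\<bar>) * indicator {0..P} t)"
      have "ennreal (weight R v) * ?E v t = ?F (cos (\<theta> t) * fst v + sin (\<theta> t) * snd v, cos (\<theta> t) * snd v - sin (\<theta> t) * fst v)" for v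
        using weight_rotate[of "cos (\<theta> t)" "sin (\<theta> t)" R "fst v" "snd v"]
        by (simp add: mult.commute)
      then have "(\<integral>\<^sup>+v. ennreal (weight R v) * ?E v t \<partial>lborel)
          = (\<integral>\<^sup>+v. ?F (cos (\<theta> t) * fst v + sin (\<theta> t) * snd v, cos (\<theta> t) * snd v - sin (\<theta> t) * fst v) \<partial>lborel)"
        by (intro nn_integral_cong) simp
      also have "\<dots> = (\<integral>\<^sup>+v. ?F v \<partial>lborel)"
        by (rule nn_integral_rotate[OF _ sin_cos_squared_add2]) measurable
      also have "\<dots> = (\<integral>\<^sup>+x. (\<integral>\<^sup>+y. ?F (x, y) \<partial>lborel) \<partial>lborel)"
        by (rule nn_integral_lborel_prod) measurable
      also have "\<dots> = (\<integral>\<^sup>+x. ?I t * (kernel n (h t - x) * chord_weight R x (p t)) \<partial>lborel)"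
      proof (intro nn_integral_cong)
        fix x :: real
        have "(\<integral>\<^sup>+y. ?F (x, y) \<partial>lborel)
          = (\<integral>\<^sup>+y. (?I t * kernel n (h t - x)) * ennreal (weight R (x, y) * \<bar>p t - y\<bar>) \<partial>lborel)"
        proof (intro nn_integral_cong)
          fix y :: real
          have "\<bar>\<omega> t * (p t - y)\<bar> = \<omega> t * \<bar>p t - y\<bar>"
            using \<omega>[of t] by (simp add: abs_mult)
          then show "?F (x, y) = (?I t * kernel n (h t - x)) * ennreal (weight R (x, y) * \<bar>p t - y\<bar>)"
            using \<omega>[of t] kernel_nonneg[of n] weight_nonneg[OF R(2,1)]
            by (simp add: ennreal_mult ennreal_mult'' mult_ac)
        qed
        also have "\<dots> = (?I t * kernel n (h t - x)) * chord_weight R x (p t)"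
          unfolding chord_weight_def by (rule nn_integral_cmult) measurable
        finally show "(\<integral>\<^sup>+y. ?F (x, y) \<partial>lborel) = ?I t * (kernel n (h t - x) * chord_weight R x (p t))"
          by (simp add: mult.assoc)
      qed
      also have "\<dots> = ?I t * ?K n t"
        by (rule nn_integral_cmult) measurable
      finally show "(\<integral>\<^sup>+v. ennreal (weight R v) * ?E v t \<partial>lborel) = ?I t * ?K n t" .
    qed
    finally show ?thesis .
  qed
  show ?thesis
    unfolding eq
  proof (rule nn_integral_dominated_convergence[where w = "\<lambda>t. ?I t * (ennreal pi * ennreal ?B)"])
    show "AE t in lborel. ?I t * ?K n t \<le> ?I t * (ennreal pi * ennreal ?B)" for n
      by (intro AE_I2 mult_left_mono nn_integral_kernel_le chord_weight_bound[OF R pb]) auto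
    have "(\<integral>\<^sup>+t. ?I t * (ennreal pi * ennreal ?B) \<partial>lborel) = (\<integral>\<^sup>+t. ?I t \<partial>lborel) * (ennreal pi * ennreal ?B)"
      by (rule nn_integral_multc) measurable
    also have "\<dots> < \<infinity>" using fin by (simp add: ennreal_mult_less_top)
    finally show "(\<integral>\<^sup>+t. ?I t * (ennreal pi * ennreal ?B) \<partial>lborel) < \<infinity>" .
    show "AE t in lborel. (\<lambda>n. ?I t * ?K n t) \<longlonglongrightarrow> ?I t * ((\<integral>\<^sup>+u. ennreal (1 / (1 + u\<^sup>2)) \<partial>lborel) * chord_weight R (h t) (p t))"
    proof (intro AE_I2)
      fix t
      have "(\<lambda>n. ?K n t) \<longlonglongrightarrow> (\<integral>\<^sup>+u. ennreal (1 / (1 + u\<^sup>2)) \<partial>lborel) * chord_weight R (h t) (p t)"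
        by (rule nn_integral_kernel_tendsto[OF _ chord_weight_bound[OF R pb] isCont_chord_weight[OF R hp]]) measurable
      moreover have "?I t \<noteq> \<infinity>" by (auto simp: indicator_def)
      ultimately show "(\<lambda>n. ?I t * ?K n t) \<longlonglongrightarrow> ?I t * ((\<integral>\<^sup>+u. ennreal (1 / (1 + u\<^sup>2)) \<partial>lborel) * chord_weight R (h t) (p t))"
        by (intro ennreal_tendsto_cmult) (auto simp: less_top)
    qed
  qed measurable
qed

text \<open>Sign changes are counted cyclically, the last point being the first one shifted by P.
  For a function of period P only an even k can occur, so the step from four leads directly to
  six.\<close>

definition alternates :: "(real \<Rightarrow> real) \<Rightarrow> real \<Rightarrow> nat \<Rightarrow> bool" where
  "alternates g P k \<longleftrightarrow>
     (\<exists>s. s k = s 0 + P \<and> (\<forall>i<k. s i < s (Suc i) \<and> g (s i) * g (s (Suc i)) < 0))"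

section \<open>From sign changes to the strict Crofton bound\<close>

lemma ex_antiderivative:
  fixes f :: "real \<Rightarrow> real"
  assumes "continuous_on UNIV f"
  obtains F where "\<And>x. (F has_real_derivative f x) (at x)"
proof -
  have "\<exists>F. \<forall>x::real. -\<infinity> < ereal x \<longrightarrow> ereal x < \<infinity> \<longrightarrow> (F has_vector_derivative f x) (at x)"
    by (rule einterval_antiderivative) (use assms in \<open>auto simp: continuous_on_eq_continuous_at\<close>)
  then show ?thesis using that by (auto simp: has_real_derivative_iff_has_vector_derivative)
qed

lemma tendsto_arctan_scaled:
  assumes "a \<noteq> 0"
  shows "(\<lambda>n. arctan (real (Suc n) * a)) \<longlonglongrightarrow> sgn a * (pi / 2)"
proof -
  have pos: "(\<lambda>n. arctan (real (Suc n) * b)) \<longlonglongrightarrow> pi / 2" if "b > 0" for b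
  proof (rule filterlim_compose[OF tendsto_arctan_at_top])
    have "filterlim (\<lambda>n. b * real n) at_top sequentially"
      using filterlim_tendsto_pos_mult_at_top[OF tendsto_const that filterlim_real_sequentially] .
    then have "filterlim (\<lambda>n. b * real (Suc n)) at_top sequentially"
      by (rule filterlim_compose[OF _ filterlim_Suc])
    then show "filterlim (\<lambda>n. real (Suc n) * b) at_top sequentially" by (simp only: mult.commute)
  qed
  show ?thesis
  proof (cases "a > 0")
    case True
    then show ?thesis using pos by simp
  next
    case False
    then have "(\<lambda>n. - arctan (real (Suc n) * (- a))) \<longlonglongrightarrow> - (pi / 2)"
      using assms by (intro tendsto_minus pos) simp
    then show ?thesis using False assms by (simp add: arctan_minus del: of_nat_Suc)
  qed
qed

text \<open>Between two points where g has opposite signs, arctan ((n + 1) g) passes from near one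
  of the values -pi/2 and pi/2 to near the other. The sum \<open>x n\<close> of these jumps is at
  most the total variation and tends to pi per sign change.\<close>

lemma crossings_lower_bound:
  fixes g g' :: "real \<Rightarrow> real"
  assumes dg: "\<And>t. (g has_real_derivative g' t) (at t)" and cg': "continuous_on UNIV g'"
    and per: "\<And>t. g (t + P) = g t" "\<And>t. g' (t + P) = g' t" and P: "P > 0" and alt: "alternates g P k"
  obtains x where "x \<longlonglongrightarrow> real k * pi" "\<And>n. ennreal (x n) \<le> crossings g g' P n"
proof -
  obtain s where s: "s k = s 0 + P" "\<And>i. i < k \<Longrightarrow> s i < s (Suc i)" "\<And>i. i < k \<Longrightarrow> g (s i) * g (s (Suc i)) < 0"
    using alt unfolding alternates_def by blast
  let ?A = "\<lambda>n t. arctan (real (Suc n) * g t)"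
  define x where "x n = (\<Sum>i<k. \<bar>?A n (s (Suc i)) - ?A n (s i)\<bar>)" for n
  have cg: "continuous_on UNIV g" using DERIV_isCont[OF dg] by (simp add: continuous_at_imp_continuous_on)
  have "x \<longlonglongrightarrow> (\<Sum>i<k. \<bar>sgn (g (s (Suc i))) * (pi / 2) - sgn (g (s i)) * (pi / 2)\<bar>)"
    unfolding x_def using s(3)
    by (intro tendsto_sum tendsto_rabs tendsto_diff tendsto_arctan_scaled) force+
  also have "(\<Sum>i<k. \<bar>sgn (g (s (Suc i))) * (pi / 2) - sgn (g (s i)) * (pi / 2)\<bar>) = (\<Sum>i<k. pi)"
  proof (intro sum.cong refl)
    fix i assume "i \<in> {..<k}"
    then have "g (s i) * g (s (Suc i)) < 0" using s(3) by simp
    then show "\<bar>sgn (g (s (Suc i))) * (pi / 2) - sgn (g (s i)) * (pi / 2)\<bar> = pi"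
      by (auto simp: mult_less_0_iff)
  qed
  finally have lim: "x \<longlonglongrightarrow> real k * pi" by simp
  have le: "ennreal (x n) \<le> crossings g g' P n" for n
  proof -
    define q where "q t = kernel n (g t) * \<bar>g' t\<bar>" for t
    have q0: "0 \<le> q t" for t by (simp add: q_def kernel_nonneg)
    have "1 + (real (Suc n) * g t)\<^sup>2 \<noteq> 0" for t
      using zero_le_power2[of "real (Suc n) * g t"] by linarith
    then have "continuous_on UNIV q"
      unfolding q_def kernel_def
      by (intro continuous_on_mult continuous_on_divide continuous_on_add continuous_on_power continuous_on_const
          continuous_on_rabs cg cg') auto
    then obtain Q where Q: "\<And>t. (Q has_real_derivative q t) (at t)" using ex_antiderivative by blast
    have cr: "crossings g g' P n = ennreal (Q P - Q 0)"
    proof -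
      have "(q has_integral (Q P - Q 0)) {0..P}"
        using P Q by (intro fundamental_theorem_of_calculus)
          (auto simp flip: has_real_derivative_iff_has_vector_derivative intro: has_field_derivative_at_within)
      from nn_integral_has_integral_lebesgue[OF q0 this]
      have "(\<integral>\<^sup>+t. ennreal (indicator {0..P} t * q t) \<partial>lborel) = ennreal (Q P - Q 0)" .
      moreover have "ennreal (indicator {0..P} t * q t) = ennreal (q t) * indicator {0..P} t" for t
        by (auto simp: indicator_def)
      ultimately show ?thesis by (simp add: crossings_def q_def)
    qed
    \<comment> \<open>The alternation points span [s 0, s 0 + P] rather than [0, P]; since q is
      periodic, its integrals over the two windows agree.\<close>
    have "((\<lambda>t. Q (t + P) - Q t) has_real_derivative q (t + P) - q t) (at t)" for t
      using DERIV_shift[of Q "q (t + P)" t P] by (intro DERIV_diff Q) (simp add: Q)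
    then have "Q (s 0 + P) - Q (s 0) = Q (0 + P) - Q 0"
      by (intro DERIV_isconst_all allI) (simp add: q_def per)
    then have "Q P - Q 0 = Q (s k) - Q (s 0)" using s(1) by simp
    also have "\<dots> = (\<Sum>i<k. Q (s (Suc i)) - Q (s i))" by (rule sum_lessThan_telescope[symmetric])
    also have "\<dots> \<ge> x n"
      unfolding x_def
    proof (rule sum_mono)
      fix i assume "i \<in> {..<k}"
      then have lt: "s i \<le> s (Suc i)" using s(2) by (simp add: less_imp_le)
      have A: "(?A n has_real_derivative kernel n (g t) * g' t) (at t)" for t
        by (rule DERIV_arctan_kernel[OF dg])
      have "kernel n (g t) * g' t \<le> q t" "- (kernel n (g t) * g' t) \<le> q t" for t
        using kernel_nonneg[of n "g t"] mult_left_mono[of "- g' t" "\<bar>g' t\<bar>" "kernel n (g t)"]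
        by (auto simp: q_def intro!: mult_left_mono)
      then have nn: "0 \<le> q t - kernel n (g t) * g' t" "0 \<le> q t + kernel n (g t) * g' t" for t
        by (smt (verit))+
      have "Q (s i) - ?A n (s i) \<le> Q (s (Suc i)) - ?A n (s (Suc i))"
        by (rule DERIV_nonneg_imp_nondecreasing[OF lt]) (use DERIV_diff[OF Q A] nn(1) in blast)
      moreover have "Q (s i) + ?A n (s i) \<le> Q (s (Suc i)) + ?A n (s (Suc i))"
        by (rule DERIV_nonneg_imp_nondecreasing[OF lt]) (use DERIV_add[OF Q A] nn(2) in blast)
      ultimately show "\<bar>?A n (s (Suc i)) - ?A n (s i)\<bar> \<le> Q (s (Suc i)) - Q (s i)" by linarith
    qed
    finally show ?thesis unfolding cr by (rule ennreal_leI)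
  qed
  show ?thesis using that lim le by blast
qed

text \<open>Fatou's lemma compares the pointwise lower bounds, pi times the weight per sign change,
  with the limit from \<open>crofton_tendsto\<close>. The evaluation of that limit uses that
  \<open>\<omega>\<close> integrates to 4 pi; the resulting inequality is L <= 4 pi - e with e the
  area of \<open>U\<close>.\<close>

theorem crofton_bound:
  fixes \<theta> h \<omega> p :: "real \<Rightarrow> real"
  defines "f \<equiv> \<lambda>v t. h t - (fst v * cos (\<theta> t) + snd v * sin (\<theta> t))"
  assumes d\<theta>: "\<And>t. (\<theta> has_real_derivative \<omega> t) (at t)" and dh: "\<And>t. (h has_real_derivative \<omega> t * p t) (at t)"
    and c\<omega>: "continuous_on UNIV \<omega>" and cp: "continuous_on UNIV p" and \<omega>: "\<And>t. \<omega> t \<ge> 0"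
    and per: "\<And>t. \<theta> (t + P) = \<theta> t + 4 * pi" "\<And>t. h (t + P) = h t" "\<And>t. \<omega> (t + P) = \<omega> t" "\<And>t. p (t + P) = p t"
    and P: "P > 0" and R: "0 < R" "R < 1" and hp: "\<And>t. (h t)\<^sup>2 + (p t)\<^sup>2 < R\<^sup>2"
    and E: "countable E" and alt4: "\<And>v. v \<notin> E \<Longrightarrow> alternates (f v) P 4"
    and U: "open U" "U \<noteq> {}" "\<And>v. v \<in> U \<Longrightarrow> (fst v)\<^sup>2 + (snd v)\<^sup>2 < R\<^sup>2" and alt6: "\<And>v. v \<in> U \<Longrightarrow> alternates (f v) P 6"
    and L: "((\<lambda>t. \<omega> t * (sqrt (1 - (h t)\<^sup>2 - (p t)\<^sup>2) / (1 - (h t)\<^sup>2))) has_integral L) {0..P}"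
  shows "L < 4 * pi"
proof -
  let ?f' = "\<lambda>v t. \<omega> t * (p t - (snd v * cos (\<theta> t) - fst v * sin (\<theta> t)))"
  let ?C = "\<lambda>n v. crossings (f v) (?f' v) P n"
  define s where "s = sqrt (1 - R\<^sup>2)"
  have R1: "R\<^sup>2 < 1" using power_strict_mono[of R 1 2] R by simp
  have s: "s > 0" using R1 by (simp add: s_def)
  have c\<theta>: "continuous_on UNIV \<theta>" and ch: "continuous_on UNIV h"
    using DERIV_isCont[OF d\<theta>] DERIV_isCont[OF dh] by (simp_all add: continuous_at_imp_continuous_on)
  have [measurable]: "\<theta> \<in> borel_measurable borel" "h \<in> borel_measurable borel"
      "\<omega> \<in> borel_measurable borel" "p \<in> borel_measurable borel"
    using c\<theta> ch c\<omega> cp by (simp_all add: borel_measurable_continuous_onI)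
  have intw: "(\<omega> has_integral 4 * pi) {0..P}"
  proof -
    have "(\<omega> has_integral (\<theta> P - \<theta> 0)) {0..P}"
      using P d\<theta> by (intro fundamental_theorem_of_calculus)
        (auto simp flip: has_real_derivative_iff_has_vector_derivative intro: has_field_derivative_at_within)
    then show ?thesis using per(1)[of 0] by simp
  qed
  have nnw: "(\<integral>\<^sup>+t. ennreal (\<omega> t) * indicator {0..P} t \<partial>lborel) = ennreal (4 * pi)"
  proof -
    have "ennreal (indicator {0..P} t * \<omega> t) = ennreal (\<omega> t) * indicator {0..P} t" for t
      by (auto simp: indicator_def)
    then show ?thesis using nn_integral_has_integral_lebesgue[OF \<omega> intw] by simp
  qed
  let ?I = "\<integral>\<^sup>+u. ennreal (1 / (1 + u\<^sup>2)) \<partial>lborel"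
  let ?J = "\<integral>\<^sup>+t. ennreal (\<omega> t) * indicator {0..P} t * (?I * chord_weight R (h t) (p t)) \<partial>lborel"
  have lim: "(\<lambda>n. \<integral>\<^sup>+v. weight R v * ?C n v \<partial>lborel) \<longlonglongrightarrow> ?J"
    unfolding f_def
    by (rule crofton_tendsto) (use R hp \<omega> nnw in \<open>measurable, auto\<close>)
  have J: "?J \<le> ennreal (pi * (8 * pi / s - 2 * L))"
  proof -
    let ?k = "\<lambda>t. 2 / s - 2 * sqrt (1 - (h t)\<^sup>2 - (p t)\<^sup>2) / (1 - (h t)\<^sup>2)"
    have k0: "?k t \<ge> 0" for t
    proof -
      have h2: "1 - R\<^sup>2 \<le> 1 - (h t)\<^sup>2" using hp[of t] zero_le_power2[of "p t"] by linarith
      then have pos: "1 - (h t)\<^sup>2 > 0" using R1 by linarith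
      have "sqrt (1 - (h t)\<^sup>2 - (p t)\<^sup>2) / (1 - (h t)\<^sup>2) \<le> sqrt (1 - (h t)\<^sup>2) / (1 - (h t)\<^sup>2)"
        using pos by (intro divide_right_mono real_sqrt_le_mono) auto
      also have "\<dots> = 1 / sqrt (1 - (h t)\<^sup>2)" using pos by (simp add: real_div_sqrt field_simps)
      also have "\<dots> \<le> 1 / s" unfolding s_def using h2 R1 pos by (intro divide_left_mono real_sqrt_le_mono mult_pos_pos) auto
      finally show ?thesis by simp
    qed
    have kint: "((\<lambda>t. \<omega> t * ?k t) has_integral (2 / s * (4 * pi) - 2 * L)) {0..P}"
    proof -
      have "((\<lambda>t. 2 / s * \<omega> t - 2 * (\<omega> t * (sqrt (1 - (h t)\<^sup>2 - (p t)\<^sup>2) / (1 - (h t)\<^sup>2)))) has_integral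
          (2 / s * (4 * pi) - 2 * L)) {0..P}"
        by (intro has_integral_diff has_integral_mult_right intw L)
      then show ?thesis by (rule has_integral_eq[rotated]) (simp add: algebra_simps)
    qed
    have "?J \<le> (\<integral>\<^sup>+t. ennreal pi * ennreal (indicator {0..P} t * (\<omega> t * ?k t)) \<partial>lborel)"
    proof (intro nn_integral_mono)
      fix t
      have "?I * chord_weight R (h t) (p t) \<le> ennreal pi * ennreal (?k t)"
        unfolding chord_weight_eq[OF R hp] s_def[symmetric]
        by (intro mult_right_mono nn_integral_inverse_1_plus_square) simp
      then have "ennreal (\<omega> t) * indicator {0..P} t * (?I * chord_weight R (h t) (p t))
          \<le> ennreal (\<omega> t) * indicator {0..P} t * (ennreal pi * ennreal (?k t))"
        by (rule mult_left_mono) simp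
      also have "\<dots> = ennreal pi * ennreal (indicator {0..P} t * (\<omega> t * ?k t))"
        using \<omega>[of t] k0[of t] by (auto simp: indicator_def ennreal_mult mult_ac)
      finally show "ennreal (\<omega> t) * indicator {0..P} t * (?I * chord_weight R (h t) (p t))
          \<le> ennreal pi * ennreal (indicator {0..P} t * (\<omega> t * ?k t))" .
    qed
    also have "\<dots> = ennreal pi * (\<integral>\<^sup>+t. ennreal (indicator {0..P} t * (\<omega> t * ?k t)) \<partial>lborel)"
      by (rule nn_integral_cmult) measurable
    also have "(\<integral>\<^sup>+t. ennreal (indicator {0..P} t * (\<omega> t * ?k t)) \<partial>lborel) = ennreal (2 / s * (4 * pi) - 2 * L)"
      by (rule nn_integral_has_integral_lebesgue[OF _ kint]) (intro mult_nonneg_nonneg \<omega> k0)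
    also have "ennreal pi * ennreal (2 / s * (4 * pi) - 2 * L) = ennreal (pi * (8 * pi / s - 2 * L))"
      by (subst ennreal_mult'[symmetric]) (simp_all add: mult.commute)
    finally show ?thesis .
  qed
  \<comment> \<open>Four sign changes give the first term. The two extra ones on \<open>U\<close>
    add 2 pi times the weight, and the weight is at least 1 inside radius R.\<close>
  let ?b = "\<lambda>v. ennreal (4 * pi) * ennreal (weight R v) + ennreal (2 * pi) * indicator U v"
  have df: "(f v has_real_derivative ?f' v t) (at t)" for v t
    unfolding f_def by (auto intro!: derivative_eq_intros d\<theta> dh simp: algebra_simps)
  have lb: "?b v \<le> liminf (\<lambda>n. weight R v * ?C n v)" if v: "v \<notin> E" for v
  proof -
    have bnd: "ennreal (weight R v) * ennreal (real k * pi) \<le> liminf (\<lambda>n. weight R v * ?C n v)" if k: "alternates (f v) P k" for k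
    proof -
      have "continuous_on UNIV (?f' v)" by (intro continuous_intros c\<omega> cp c\<theta>)
      moreover have "f v (t + P) = f v t" "?f' v (t + P) = ?f' v t" for t
        using sin_cos_eq_iff[of "\<theta> t + 4 * pi" "\<theta> t"] by (auto simp: f_def per)
      ultimately obtain x where x: "x \<longlonglongrightarrow> real k * pi" "\<And>n. ennreal (x n) \<le> ?C n v"
        using crossings_lower_bound[OF df _ _ _ P k] by blast
      have "(\<lambda>n. ennreal (weight R v) * ennreal (x n)) \<longlonglongrightarrow> ennreal (weight R v) * ennreal (real k * pi)"
        by (intro ennreal_tendsto_cmult tendsto_ennrealI x) simp
      then have "ennreal (weight R v) * ennreal (real k * pi) = liminf (\<lambda>n. ennreal (weight R v) * ennreal (x n))"
        by (rule lim_imp_Liminf[OF trivial_limit_sequentially, symmetric])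
      also have "\<dots> \<le> liminf (\<lambda>n. weight R v * ?C n v)"
        by (intro Liminf_mono always_eventually allI mult_left_mono x(2)) simp
      finally show ?thesis .
    qed
    show ?thesis
    proof (cases "v \<in> U")
      case True
      have w1: "1 \<le> weight R v" using weight_ge[OF U(3)[OF True] R] .
      have "?b v \<le> ennreal (4 * pi) * ennreal (weight R v) + ennreal (2 * pi) * ennreal (weight R v)"
        using w1 True by (intro add_left_mono mult_left_mono) (auto simp: ennreal_leI)
      also have "\<dots> = ennreal (weight R v) * ennreal (real 6 * pi)"
        using w1 by (simp add: ennreal_mult[symmetric] ennreal_plus[symmetric] algebra_simps del: ennreal_plus)
      also have "\<dots> \<le> liminf (\<lambda>n. weight R v * ?C n v)" by (rule bnd[OF alt6[OF True]])
      finally show ?thesis .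
    next
      case False
      then show ?thesis using bnd[OF alt4[OF v]] by (simp add: mult.commute)
    qed
  qed
  have [measurable]: "U \<in> sets borel" using U(1) by simp
  have "ennreal (4 * pi) * ennreal (2 * pi * (1 / s - 1)) + ennreal (2 * pi) * emeasure lborel U = (\<integral>\<^sup>+v. ?b v \<partial>lborel)"
  proof -
    have "(\<integral>\<^sup>+v. ?b v \<partial>lborel) = (\<integral>\<^sup>+v. ennreal (4 * pi) * ennreal (weight R v) \<partial>lborel) + (\<integral>\<^sup>+v. ennreal (2 * pi) * indicator U v \<partial>lborel)"
      by (rule nn_integral_add) measurable
    also have "(\<integral>\<^sup>+v. ennreal (4 * pi) * ennreal (weight R v) \<partial>lborel) = ennreal (4 * pi) * ennreal (2 * pi * (1 / s - 1))"
      unfolding s_def nn_integral_weight[OF R, symmetric] by (rule nn_integral_cmult) measurable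
    also have "(\<integral>\<^sup>+v. ennreal (2 * pi) * indicator U v \<partial>lborel) = ennreal (2 * pi) * emeasure lborel U"
      by (rule nn_integral_cmult_indicator) simp
    finally show ?thesis by simp
  qed
  also have "\<dots> \<le> (\<integral>\<^sup>+v. liminf (\<lambda>n. weight R v * ?C n v) \<partial>lborel)"
  proof (rule nn_integral_mono_AE)
    have "AE v in lborel. v \<notin> E" by (intro AE_not_in countable_imp_null_set_lborel E)
    then show "AE v in lborel. ?b v \<le> liminf (\<lambda>n. weight R v * ?C n v)"
      by eventually_elim (rule lb)
  qed
  also have "\<dots> \<le> liminf (\<lambda>n. \<integral>\<^sup>+v. weight R v * ?C n v \<partial>lborel)"
    by (rule nn_integral_liminf) (unfold f_def crossings_def, measurable)
  also have "\<dots> = ?J" by (rule lim_imp_Liminf[OF trivial_limit_sequentially lim])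
  also have "\<dots> \<le> ennreal (pi * (8 * pi / s - 2 * L))" by (rule J)
  finally have main: "ennreal (4 * pi) * ennreal (2 * pi * (1 / s - 1)) + ennreal (2 * pi) * emeasure lborel U
      \<le> ennreal (pi * (8 * pi / s - 2 * L))" .
  have "emeasure lborel U \<noteq> 0"
  proof
    assume "emeasure lborel U = 0"
    then have "U \<in> null_sets lborel" by (auto simp: null_sets_def)
    then have "negligible U" using negligible_iff_null_sets null_sets_completionI by blast
    then show False using open_not_negligible U by blast
  qed
  \<comment> \<open>Finiteness follows from \<open>main\<close> itself, whose right side is finite;
    it allows the area to be treated as a real number.\<close>
  moreover have "emeasure lborel U < \<infinity>"
  proof -
    have "ennreal (2 * pi) * emeasure lborel U \<le> ennreal (pi * (8 * pi / s - 2 * L))"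
      using main by (meson add_increasing dual_order.trans le_add_same_cancel2 order_refl zero_le le_add2)
    then have "ennreal (2 * pi) * emeasure lborel U < top" by (rule order_le_less_trans) simp
    then show ?thesis by (auto simp: ennreal_mult_less_top)
  qed
  ultimately obtain e where e: "e > 0" "emeasure lborel U = ennreal e"
    by (cases "emeasure lborel U") (auto simp: order_less_le)
  have "s \<le> 1" unfolding s_def using R1 by (simp add: real_sqrt_le_1_iff)
  then have "1 / s - 1 \<ge> 0" using s by (simp add: field_simps)
  then have "ennreal (4 * pi * (2 * pi * (1 / s - 1)) + 2 * pi * e) \<le> ennreal (pi * (8 * pi / s - 2 * L))"
    using main e by (simp add: ennreal_mult[symmetric] ennreal_plus[symmetric] del: ennreal_plus)
  moreover have "0 < 4 * pi * (2 * pi * (1 / s - 1)) + 2 * pi * e"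
    using \<open>1 / s - 1 \<ge> 0\<close> e by (intro add_nonneg_pos mult_nonneg_nonneg) auto
  ultimately have "4 * pi * (2 * pi * (1 / s - 1)) + 2 * pi * e \<le> pi * (8 * pi / s - 2 * L)"
    by (metis ennreal_le_iff2 not_less)
  then have "pi * (2 * L) \<le> pi * (8 * pi - 2 * e)" by (simp add: algebra_simps)
  then show ?thesis using e by simp
qed

section \<open>Sign changes and heights\<close>

lemma alternates_uminus: "alternates (\<lambda>t. - g t) P k \<longleftrightarrow> alternates g P k"
  by (simp add: alternates_def)

lemma alternates_4_iff:
  "alternates g P 4 \<longleftrightarrow> (\<exists>a b c d. a < b \<and> b < c \<and> c < d \<and> d < a + P \<and>
     g a * g b < 0 \<and> g b * g c < 0 \<and> g c * g d < 0 \<and> g d * g (a + P) < 0)"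
    (is "_ = ?R")
proof
  assume "alternates g P 4"
  then obtain s where s: "s 4 = s 0 + P" "\<And>i. i < 4 \<Longrightarrow> s i < s (Suc i) \<and> g (s i) * g (s (Suc i)) < 0"
    unfolding alternates_def by blast
  show ?R
    using s(1) s(2)[of 0] s(2)[of 1] s(2)[of 2] s(2)[of 3]
    by (intro exI[of _ "s 0"] exI[of _ "s 1"] exI[of _ "s 2"] exI[of _ "s 3"]) (simp add: eval_nat_numeral)
next
  assume ?R
  then obtain a b c d where *: "a < b" "b < c" "c < d" "d < a + P"
    "g a * g b < 0" "g b * g c < 0" "g c * g d < 0" "g d * g (a + P) < 0" by blast
  have "\<forall>i<4. [a, b, c, d, a + P] ! i < [a, b, c, d, a + P] ! Suc i
      \<and> g ([a, b, c, d, a + P] ! i) * g ([a, b, c, d, a + P] ! Suc i) < 0"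
    using * by (simp add: eval_nat_numeral All_less_Suc)
  then show "alternates g P 4"
    unfolding alternates_def by (intro exI[of _ "\<lambda>i. [a, b, c, d, a + P] ! i"]) (simp add: eval_nat_numeral)
qed

lemma alternates_6I:
  assumes "a < b" "b < c" "c < d" "d < e" "e < f" "f < a + P"
    "g a * g b < 0" "g b * g c < 0" "g c * g d < 0" "g d * g e < 0" "g e * g f < 0" "g f * g (a + P) < 0"
  shows "alternates g P 6"
proof -
  have "\<forall>i<6. [a, b, c, d, e, f, a + P] ! i < [a, b, c, d, e, f, a + P] ! Suc i
      \<and> g ([a, b, c, d, e, f, a + P] ! i) * g ([a, b, c, d, e, f, a + P] ! Suc i) < 0"
    using assms by (simp add: eval_nat_numeral All_less_Suc)
  then show ?thesis
    unfolding alternates_def by (intro exI[of _ "\<lambda>i. [a, b, c, d, e, f, a + P] ! i"]) (simp add: eval_nat_numeral)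
qed

text \<open>If f were negative at s, the height would drop just after s to some \<open>L s'\<close>.
  Then L must rise from m to s, since L m <= L s' < L s, and again from s' to M, since L s' < L s <=
  L M; it also falls after M. The mean value theorem turns this into signs +, -, +, - of f, four
  changes in one period.\<close>

lemma nonneg_between_extrema:
  fixes L f r :: "real \<Rightarrow> real"
  assumes dL: "\<And>t. (L has_real_derivative r t * f t) (at t)" and r: "\<And>t. r t > 0"
    and per: "\<And>t. f (t + P) = f t"
    and ext: "\<And>t. L m \<le> L t" "\<And>t. L t \<le> L M" "L (m + P) = L m" "L m < L M" and mM: "m < M" "M < m + P"
    and alt: "\<not> alternates f P 4" and s: "m < s" "s < M"
  shows "f s \<ge> 0"
proof (rule ccontr)
  assume neg: "\<not> f s \<ge> 0"
  have pos: "\<exists>t. a < t \<and> t < b \<and> f t > 0" if ab: "a < b" "L a < L b" for a b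
  proof -
    obtain t where t: "a < t" "t < b" "L b - L a = (b - a) * (r t * f t)"
      using MVT2[OF ab(1), of L "\<lambda>t. r t * f t"] dL by blast
    then have "(b - a) * (r t * f t) > 0" using ab by simp
    then have "f t > 0" using ab(1) r[of t] by (simp add: zero_less_mult_iff)
    then show ?thesis using t by blast
  qed
  have negI: "\<exists>t. a < t \<and> t < b \<and> f t < 0" if ab: "a < b" "L a > L b" for a b
  proof -
    obtain t where t: "a < t" "t < b" "L b - L a = (b - a) * (r t * f t)"
      using MVT2[OF ab(1), of L "\<lambda>t. r t * f t"] dL by blast
    then have "(b - a) * (r t * f t) < 0" using ab by simp
    then have "f t < 0" using ab(1) r[of t] by (simp add: mult_less_0_iff)
    then show ?thesis using t by blast
  qed
  have "r s * f s < 0" using r[of s] neg by (simp add: mult_pos_neg)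
  then obtain d where d: "d > 0" "\<And>h. 0 < h \<Longrightarrow> h < d \<Longrightarrow> L (s + h) < L s"
    using DERIV_neg_dec_right[OF dL] by blast
  define \<eta> where "\<eta> = min d (M - s) / 2"
  define s' where "s' = s + \<eta>"
  have "0 < \<eta>" "\<eta> < d" "\<eta> < M - s" using d(1) s by (auto simp: \<eta>_def min_def)
  then have s': "s < s'" "s' < M" "L s' < L s"
    using d(2)[of \<eta>] by (simp_all add: s'_def)
  obtain t1 where t1: "m < t1" "t1 < s" "f t1 > 0"
    using pos[of m s] s s' ext(1)[of s'] by (meson order_le_less_trans)
  obtain t3 where t3: "s' < t3" "t3 < M" "f t3 > 0"
    using pos[of s' M] s' ext(2)[of s] by (meson order_less_le_trans)
  obtain t4 where t4: "M < t4" "t4 < m + P" "f t4 < 0"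
    using negI[of M "m + P"] mM ext by auto
  have "t1 < s" "s < t3" "t3 < t4" "t4 < t1 + P" using t1 t3 t4 s' by auto
  moreover have "f t1 * f s < 0" "f s * f t3 < 0" "f t3 * f t4 < 0" "f t4 * f (t1 + P) < 0"
    using t1 t3 t4 neg per[of t1] by (simp_all add: mult_less_0_iff)
  ultimately show False using alt unfolding alternates_4_iff by blast
qed

text \<open>Take m and M at the global extrema of L. The preceding lemma gives weak monotonicity on
  both arcs, and it is strict because L is constant on no interval when f vanishes on none.\<close>

lemma monotone_arcs:
  fixes L f r :: "real \<Rightarrow> real"
  assumes dL: "\<And>t. (L has_real_derivative r t * f t) (at t)" and r: "\<And>t. r t > 0"
    and per: "\<And>t. f (t + P) = f t" "\<And>t. L (t + P) = L t" and P: "P > 0"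
    and alt: "\<not> alternates f P 4" and nz: "\<And>a b. a < b \<Longrightarrow> \<exists>t. a < t \<and> t < b \<and> f t \<noteq> 0"
  obtains m M where "m < M" "M < m + P" "strict_mono_on {m..M} L" "strict_mono_on {M..m + P} (\<lambda>t. - L t)"
proof -
  have cL: "continuous_on UNIV L" using DERIV_isCont[OF dL] by (simp add: continuous_at_imp_continuous_on)
  have not_const: "\<exists>t. a < t \<and> t < b \<and> L t \<noteq> c" if ab: "a < b" for a b c
  proof (rule ccontr)
    assume "\<not> ?thesis"
    then have c: "L t = c" if "a < t" "t < b" for t using that by blast
    obtain t where t: "a < t" "t < b" "f t \<noteq> 0" using nz[OF ab] by blast
    have "((\<lambda>t. c) has_real_derivative r t * f t) (at t)"
      by (rule has_field_derivative_transform_within_open[OF dL, where S = "{a<..<b}"]) (use t c in auto)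
    then have "r t * f t = 0" by (rule DERIV_unique) (rule DERIV_const)
    then show False using t r[of t] by simp
  qed
  have comp: "compact (L ` {0..P})" "L ` {0..P} \<noteq> {}"
    using P by (auto intro!: compact_continuous_image continuous_on_subset[OF cL])
  have rng: "L ` {0..P} = range L" using periodic_image[of L P 0] per(2) P by simp
  obtain m where m: "\<And>t. L m \<le> L t"
    using compact_attains_inf[OF comp] unfolding rng by blast
  obtain M0 where M0: "\<And>t. L t \<le> L M0"
    using compact_attains_sup[OF comp] unfolding rng by blast
  have "L M0 \<in> L ` {m..m + P}" using periodic_image[of L P m] per(2) P by simp
  then obtain M where M: "M \<in> {m..m + P}" "L M = L M0" by auto
  have "L m < L M"
  proof (rule ccontr)
    assume "\<not> L m < L M"
    then have "L t = L m" for t using m[of t] M0[of t] M(2) by linarith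
    then show False using not_const[OF zero_less_one, of "L m"] by blast
  qed
  then have "M \<noteq> m" "M \<noteq> m + P" using per(2) by auto
  then have mM: "m < M" "M < m + P" using M(1) by auto
  have up: "f s \<ge> 0" if "m < s" "s < M" for s
    by (rule nonneg_between_extrema[OF dL r per(1) m _ _ \<open>L m < L M\<close> mM alt that])
      (use M0 M(2) per(2) in auto)
  have dL': "((\<lambda>t. - L t) has_real_derivative r t * (- f t)) (at t)" for t
    using DERIV_minus[OF dL[of t]] by simp
  \<comment> \<open>The descending arc of L is the ascending arc of -L, with its minimum at
    \<open>M\<close> and its maximum at \<open>m + P\<close>.\<close>
  have down: "- f s \<ge> 0" if "M < s" "s < m + P" for s
    by (rule nonneg_between_extrema[OF dL' r _ _ _ _ _ _ _ _ that])
      (use m M0 M(2) per mM \<open>L m < L M\<close> alt in \<open>auto simp: alternates_uminus\<close>)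
  have mono: "strict_mono_on {a..b} G"
    if dG: "\<And>t. (G has_real_derivative G' t) (at t)" and nn: "\<And>t. a < t \<Longrightarrow> t < b \<Longrightarrow> G' t \<ge> 0"
      and nc: "\<And>a b c. a < b \<Longrightarrow> \<exists>t. a < t \<and> t < b \<and> G t \<noteq> c" for G G' a b
  proof (rule strict_mono_onI)
    have le: "G x \<le> G y" if "a \<le> x" "x \<le> y" "y \<le> b" for x y
    proof (cases "x = y")
      case False
      then have "x < y" using that by simp
      then obtain z where z: "x < z" "z < y" "G y - G x = (y - x) * G' z"
        using MVT2[of x y G G'] dG by blast
      have "(y - x) * G' z \<ge> 0" using nn[of z] z that by (intro mult_nonneg_nonneg) auto
      then show ?thesis using z by simp
    qed simp
    fix x y assume xy: "x \<in> {a..b}" "y \<in> {a..b}" "x < y"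
    obtain t where t: "x < t" "t < y" "G t \<noteq> G x" using nc[OF xy(3)] by blast
    have "G x \<le> G t" "G t \<le> G y" using le[of x t] le[of t y] xy t by auto
    then show "G x < G y" using t(3) by simp
  qed
  show ?thesis
  proof
    show "strict_mono_on {m..M} L"
      by (rule mono[OF dL]) (use up r not_const in \<open>auto intro!: mult_nonneg_nonneg simp: less_imp_le\<close>)
    show "strict_mono_on {M..m + P} (\<lambda>t. - L t)"
    proof (rule mono[OF dL'])
      show "0 \<le> r t * - f t" if "M < t" "t < m + P" for t
        using down[OF that] r[of t] by (intro mult_nonneg_nonneg) auto
      show "\<exists>t>a. t < b \<and> - L t \<noteq> c" if "a < b" for a b c
        using not_const[OF that, of "- c"] by auto
    qed
  qed (use mM in auto)
qed

text \<open>Cutting the circle at a zero t0 leaves at least three of the four alternation points, up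
  to choice, in the pattern -, +, -. If t0 is a local minimum of value zero, lowering it slightly
  creates +, -, + next to t0, and together these make six.\<close>

lemma alternates_around_zero:
  assumes per: "\<And>t. g (t + P) = g t" and P: "P > 0" and alt: "alternates g P 4" and t0: "g t0 = 0"
  obtains u1 u2 u3 where "t0 < u1" "u1 < u2" "u2 < u3" "u3 < t0 + P" "g u1 < 0" "g u2 > 0" "g u3 < 0"
proof -
  have "\<exists>a b c d. a < b \<and> b < c \<and> c < d \<and> d < a + P \<and> g a > 0 \<and> g b < 0 \<and> g c > 0 \<and> g d < 0"
  proof -
    obtain a b c d where *: "a < b" "b < c" "c < d" "d < a + P"
      "g a * g b < 0" "g b * g c < 0" "g c * g d < 0" "g d * g (a + P) < 0"
      using alt unfolding alternates_4_iff by blast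
    show ?thesis
    proof (cases "g a > 0")
      case True
      then have "g b < 0" "g c > 0" "g d < 0" using * by (auto simp: mult_less_0_iff)
      then show ?thesis using * True by blast
    next
      case False
      then have "g b > 0" "g c < 0" "g d > 0" "g (a + P) < 0" using * by (auto simp: mult_less_0_iff)
      moreover have "a + P < b + P" using * by simp
      ultimately show ?thesis using * by blast
    qed
  qed
  then obtain a' b' c' d' where *: "a' < b'" "b' < c'" "c' < d'" "d' < a' + P" "g a' > 0" "g b' < 0" "g c' > 0" "g d' < 0"
    by blast
  \<comment> \<open>The whole pattern is shifted by a multiple of P so that t0 lies in [a, a +
    P).\<close>
  define k where "k = \<lfloor>(t0 - a') / P\<rfloor>"
  define sh where "sh = of_int k * P"
  define a b c d where "a = a' + sh" and "b = b' + sh" and "c = c' + sh" and "d = d' + sh"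
  have gs: "g (x + sh) = g x" for x unfolding sh_def by (rule periodic_int) (rule per)
  have ord: "a < b" "b < c" "c < d" "d < a + P" and sg: "g a > 0" "g b < 0" "g c > 0" "g d < 0"
    using * by (simp_all add: a_def b_def c_def d_def gs)
  have "of_int k \<le> (t0 - a') / P" "(t0 - a') / P < of_int k + 1" unfolding k_def by linarith+
  then have "sh \<le> t0 - a'" "t0 - a' < sh + P" using P by (simp_all add: sh_def field_simps)
  then have "a \<le> t0" "t0 < a + P" by (simp_all add: a_def)
  moreover have "t0 \<noteq> a" "t0 \<noteq> b" "t0 \<noteq> c" "t0 \<noteq> d" using t0 sg by auto
  ultimately consider "a < t0" "t0 < b" | "b < t0" "t0 < d" | "d < t0" "t0 < a + P" by linarith
  then show ?thesis
  proof cases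
    case 1
    then show ?thesis using that[of b c d] ord sg by auto
  next
    case 2
    then show ?thesis using that[of d "a + P" "b + P"] ord sg per by auto
  next
    case 3
    then show ?thesis using that[of "b + P" "c + P" "d + P"] ord sg per by auto
  qed
qed

text \<open>Near t0 the factor d passes from negative to positive and w keeps that sign, so f has a
  strict minimum there. The derivative of f is given in factored form so that only d has to be
  differentiated.\<close>

lemma strict_extremum_of_second_derivative:
  fixes f d w :: "real \<Rightarrow> real"
  assumes df: "\<And>t. (f has_real_derivative w t * d t) (at t)" and w: "\<And>t. w t > 0"
    and dd: "(d has_real_derivative k) (at t0)" and k: "k > 0" and 0: "f t0 = 0" "d t0 = 0"
  obtains \<eta> where "\<eta> > 0" "\<And>t. t \<noteq> t0 \<Longrightarrow> \<bar>t - t0\<bar> < \<eta> \<Longrightarrow> f t > 0"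
proof -
  obtain \<eta>1 where \<eta>1: "\<eta>1 > 0" "\<And>h. 0 < h \<Longrightarrow> h < \<eta>1 \<Longrightarrow> d t0 < d (t0 + h)"
    using DERIV_pos_inc_right[OF dd k] by blast
  obtain \<eta>2 where \<eta>2: "\<eta>2 > 0" "\<And>h. 0 < h \<Longrightarrow> h < \<eta>2 \<Longrightarrow> d (t0 - h) < d t0"
    using DERIV_pos_inc_left[OF dd k] by blast
  have "f t > 0" if t: "t \<noteq> t0" "\<bar>t - t0\<bar> < min \<eta>1 \<eta>2" for t
  proof (cases "t > t0")
    case True
    obtain z where z: "t0 < z" "z < t" "f t - f t0 = (t - t0) * (w z * d z)"
      using MVT2[OF True, of f "\<lambda>t. w t * d t"] df by blast
    have "d z > 0" using \<eta>1(2)[of "z - t0"] z t 0 by auto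
    then have "(t - t0) * (w z * d z) > 0" using True w[of z] by simp
    then show ?thesis using z 0 by simp
  next
    case False
    then have lt: "t < t0" using t by simp
    obtain z where z: "t < z" "z < t0" "f t0 - f t = (t0 - t) * (w z * d z)"
      using MVT2[OF lt, of f "\<lambda>t. w t * d t"] df by blast
    have "d z < 0" using \<eta>2(2)[of "t0 - z"] z t 0 by auto
    then have "(t0 - t) * (w z * d z) < 0" using lt w[of z] by (simp add: mult_less_0_iff mult_pos_neg)
    then show ?thesis using z 0 by simp
  qed
  then show ?thesis using that[of "min \<eta>1 \<eta>2"] \<eta>1(1) \<eta>2(1) by simp
qed

theorem total_curvature_bound_angular:
  fixes \<gamma> :: "real \<Rightarrow> real^3" and \<theta> h \<omega> p p' r :: "real \<Rightarrow> real"
  assumes c\<gamma>: "continuous_on UNIV \<gamma>"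
    and d1: "\<And>t. ((\<lambda>t. \<gamma> t $ 1) has_real_derivative r t * cos (\<theta> t)) (at t)"
    and d2: "\<And>t. ((\<lambda>t. \<gamma> t $ 2) has_real_derivative r t * sin (\<theta> t)) (at t)"
    and d3: "\<And>t. ((\<lambda>t. \<gamma> t $ 3) has_real_derivative r t * h t) (at t)"
    and r: "\<And>t. r t > 0"
    and d\<theta>: "\<And>t. (\<theta> has_real_derivative \<omega> t) (at t)"
    and dh: "\<And>t. (h has_real_derivative \<omega> t * p t) (at t)"
    and dp: "\<And>t. (p has_real_derivative p' t) (at t)"
    and c\<omega>: "continuous_on UNIV \<omega>" and cp': "continuous_on UNIV p'" and \<omega>: "\<And>t. \<omega> t > 0"
    and per\<gamma>: "\<And>t. \<gamma> (t + P) = \<gamma> t"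
    and per: "\<And>t. \<theta> (t + P) = \<theta> t + 4 * pi" "\<And>t. h (t + P) = h t" "\<And>t. \<omega> (t + P) = \<omega> t" "\<And>t. p (t + P) = p t"
    and P: "P > 0" and hp: "\<And>t. (h t)\<^sup>2 + (p t)\<^sup>2 < 1"
    and inj: "inj_on \<gamma> {0..<P}" and knot: "\<not> ambient_isotopic (\<gamma> ` {0..P}) unknot"
    and L: "((\<lambda>t. \<omega> t * (sqrt (1 - (h t)\<^sup>2 - (p t)\<^sup>2) / (1 - (h t)\<^sup>2))) has_integral L) {0..P}"
  shows "L < 4 * pi"
proof -
  have c\<theta>: "continuous_on UNIV \<theta>" and ch: "continuous_on UNIV h" and cp: "continuous_on UNIV p"
    using DERIV_isCont[OF d\<theta>] DERIV_isCont[OF dh] DERIV_isCont[OF dp]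
    by (simp_all add: continuous_at_imp_continuous_on)
  define f where "f v t = h t - (fst v * cos (\<theta> t) + snd v * sin (\<theta> t))" for v t
  define D where "D v t = p t - (snd v * cos (\<theta> t) - fst v * sin (\<theta> t))" for v t
  have df: "(f v has_real_derivative \<omega> t * D v t) (at t)" for v t
    unfolding f_def D_def by (auto intro!: derivative_eq_intros d\<theta> dh simp: algebra_simps)
  have dD: "(D v has_real_derivative p' t + \<omega> t * (fst v * cos (\<theta> t) + snd v * sin (\<theta> t))) (at t)" for v t
    unfolding D_def by (auto intro!: derivative_eq_intros d\<theta> dp simp: algebra_simps)
  have per_sc: "sin (x + 4 * pi) = sin x" "cos (x + 4 * pi) = cos x" for x
  proof -
    have "x + 4 * pi = (x + 2 * pi) + 2 * pi" by simp
    then show "sin (x + 4 * pi) = sin x" "cos (x + 4 * pi) = cos x"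
      by (simp_all only: sin_periodic cos_periodic)
  qed
  have perf: "f v (t + P) = f v t" for v t by (simp add: f_def per per_sc)
  \<comment> \<open>The curve dual to the tangent indicatrix: \<open>C t\<close> is the \<open>v\<close> for which \<open>f v\<close> has a double zero at \<open>t\<close>.\<close>
  define C where "C t = (h t * cos (\<theta> t) - p t * sin (\<theta> t), h t * sin (\<theta> t) + p t * cos (\<theta> t))" for t
  have C_iff: "f v t = 0 \<and> D v t = 0 \<longleftrightarrow> v = C t" for v t
  proof
    have sc: "cos (\<theta> t) * cos (\<theta> t) + sin (\<theta> t) * sin (\<theta> t) = 1" by (simp add: sin_cos_squared_add3)
    assume "f v t = 0 \<and> D v t = 0"
    then have hv: "h t = fst v * cos (\<theta> t) + snd v * sin (\<theta> t)" and pv: "p t = snd v * cos (\<theta> t) - fst v * sin (\<theta> t)"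
      by (simp_all add: f_def D_def)
    have "h t * cos (\<theta> t) - p t * sin (\<theta> t) = fst v * (cos (\<theta> t) * cos (\<theta> t) + sin (\<theta> t) * sin (\<theta> t))"
      unfolding hv pv by (simp only: algebra_simps; simp?)
    moreover have "h t * sin (\<theta> t) + p t * cos (\<theta> t) = snd v * (cos (\<theta> t) * cos (\<theta> t) + sin (\<theta> t) * sin (\<theta> t))"
      unfolding hv pv by (simp only: algebra_simps; simp?)
    ultimately show "v = C t" unfolding sc by (simp add: C_def)
  next
    have sc: "cos (\<theta> t) * cos (\<theta> t) + sin (\<theta> t) * sin (\<theta> t) = 1" by (simp add: sin_cos_squared_add3)
    assume v: "v = C t"
    have "f v t = h t - h t * (cos (\<theta> t) * cos (\<theta> t) + sin (\<theta> t) * sin (\<theta> t))"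
      unfolding v f_def C_def fst_conv snd_conv by (simp only: algebra_simps; simp?)
    moreover have "D v t = p t - p t * (cos (\<theta> t) * cos (\<theta> t) + sin (\<theta> t) * sin (\<theta> t))"
      unfolding v D_def C_def fst_conv snd_conv by (simp only: algebra_simps; simp?)
    ultimately show "f v t = 0 \<and> D v t = 0" unfolding sc by simp
  qed
  \<comment> \<open>If \<open>f v\<close> vanishes on an interval, then every point of it is a
    double zero, so v = \<open>C q\<close> for any rational q in that interval. Hence all bad v lie
    in this countable set.\<close>
  define E where "E = C ` \<rat>"
  have E: "countable E" unfolding E_def by (intro countable_image countable_rat)
  define g where "g v t = \<gamma> t $ 3 - (fst v * \<gamma> t $ 1 + snd v * \<gamma> t $ 2)" for v t
  have dg: "(g v has_real_derivative r t * f v t) (at t)" for v t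
    unfolding g_def f_def by (auto intro!: derivative_eq_intros d1 d2 d3 simp: algebra_simps)
  have perg: "g v (t + P) = g v t" for v t by (simp add: g_def per\<gamma>)
  have alt4: "alternates (f v) P 4" if v: "v \<notin> E" for v
  proof (rule ccontr)
    assume na: "\<not> alternates (f v) P 4"
    have nz: "\<exists>t. a < t \<and> t < b \<and> f v t \<noteq> 0" if ab: "a < b" for a b
    proof (rule ccontr)
      assume "\<not> ?thesis"
      then have z: "f v t = 0" if "t \<in> {a<..<b}" for t using that by auto
      obtain q where q: "q \<in> \<rat>" "q \<in> {a<..<b}" using Rats_dense_in_real[OF ab] by auto
      have "((\<lambda>t. 0) has_real_derivative \<omega> q * D v q) (at q)"
        by (rule has_field_derivative_transform_within_open[OF df, where S = "{a<..<b}"]) (use q z in auto)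
      then have "\<omega> q * D v q = 0" by (rule DERIV_unique) (rule DERIV_const)
      then have "f v q = 0 \<and> D v q = 0" using z[OF q(2)] \<omega>[of q] by simp
      then show False using v q C_iff unfolding E_def by blast
    qed
    obtain m M where "m < M" "M < m + P" "strict_mono_on {m..M} (g v)" "strict_mono_on {M..m + P} (\<lambda>t. - g v t)"
      using monotone_arcs[OF dg r perf perg P na nz] by blast
    then show False
      using unknot_of_monotone_height[OF c\<gamma> per\<gamma> P inj, of m M "fst v" "snd v"] knot
      unfolding g_def by blast
  qed
  \<comment> \<open>The velocity of \<open>C\<close> is \<open>k t\<close> times (-sin, cos) of
    \<open>\<theta> t\<close>, and \<open>k t\<close> is also the derivative of \<open>D v\<close>
    at t for v = \<open>C t\<close>. So \<open>k\<close> tells both whether \<open>C\<close> moves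
    and whether the double zero is a strict extremum.\<close>
  define k where "k t = p' t + \<omega> t * h t" for t
  have ck: "continuous_on UNIV k" unfolding k_def by (intro continuous_intros cp' c\<omega> ch)
  have dC: "((\<lambda>t. fst (C t)) has_real_derivative - k t * sin (\<theta> t)) (at t)"
    "((\<lambda>t. snd (C t)) has_real_derivative k t * cos (\<theta> t)) (at t)" for t
    unfolding C_def k_def by (auto intro!: derivative_eq_intros d\<theta> dh dp simp: algebra_simps)
  have cC: "continuous_on UNIV C"
    unfolding C_def by (intro continuous_intros ch cp c\<theta>)
  \<comment> \<open>If \<open>k\<close> vanished everywhere, \<open>C\<close> would be a constant v
    with \<open>f v\<close> identically zero, and \<open>g v\<close> would be constant. The curve
    would lie in a plane that is a graph over the first two coordinates, so its projection would be
    a simple closed plane curve whose heading gains 4 pi.\<close>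
  have "\<exists>t. k t \<noteq> 0"
  proof (rule ccontr)
    assume "\<not> ?thesis"
    then have k0: "k t = 0" for t by simp
    have "fst (C t) = fst (C 0)" "snd (C t) = snd (C 0)" for t
      using dC k0 by (intro DERIV_isconst_all[of _ t 0]; simp)+
    then have "C t = C 0" for t by (simp add: prod_eq_iff)
    then have "f (C 0) t = 0" for t using C_iff by metis
    then have "(g (C 0) has_real_derivative 0) (at t)" for t using dg[of "C 0" t] by simp
    then have g_const: "g (C 0) s = g (C 0) t" for s t by (intro DERIV_isconst_all) auto
    show False
    proof (rule turning_number_two_not_simple[OF d1 d2 r _ c\<theta> per(1) P])
      show "strict_mono \<theta>"
      proof (rule strict_monoI)
        fix s t :: real assume "s < t"
        then show "\<theta> s < \<theta> t" by (rule DERIV_pos_imp_increasing) (use d\<theta> \<omega> in blast)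
      qed
      fix s t assume *: "\<gamma> s $ 1 = \<gamma> t $ 1" "\<gamma> s $ 2 = \<gamma> t $ 2" "\<bar>s - t\<bar> < P"
      then have "\<gamma> s $ 3 = \<gamma> t $ 3" using g_const[of s t] by (simp add: g_def)
      then have "\<gamma> s = \<gamma> t" using * by (simp add: vec_eq_iff forall_3)
      then show "s = t" using inj_on_periodic[of \<gamma>, OF per\<gamma> P inj] *(3) by blast
    qed (simp_all add: per\<gamma>)
  qed
  then obtain t1 where t1: "k t1 \<noteq> 0" by blast
  have "open {t. k t \<noteq> 0}"
    using ck by (intro open_Collect_neq continuous_on_const) auto
  then obtain d where d: "d > 0" "ball t1 d \<subseteq> {t. k t \<noteq> 0}" using t1 openE by blast
  \<comment> \<open>Near \<open>t1\<close> the curve \<open>C\<close> is not constant, since its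
    velocity at \<open>t1\<close> is nonzero. Its image there is connected with more than one point,
    hence uncountable, and cannot lie in \<open>E\<close>. Avoiding \<open>E\<close> guarantees that
    \<open>f (C t0)\<close> itself has four sign changes.\<close>
  have "\<exists>t0\<in>ball t1 d. C t0 \<notin> E"
  proof (rule ccontr)
    assume "\<not> ?thesis"
    then have "C ` ball t1 d \<subseteq> E" by auto
    then have cnt: "countable (C ` ball t1 d)" using E countable_subset by blast
    have conn: "connected (C ` ball t1 d)"
      by (intro connected_continuous_image continuous_on_subset[OF cC]) auto
    have eq: "C x = C t1" if x: "x \<in> ball t1 d" for x
    proof (rule ccontr)
      assume "C x \<noteq> C t1"
      moreover have "C x \<in> C ` ball t1 d" "C t1 \<in> C ` ball t1 d" using x d(1) by auto
      ultimately have "uncountable (C ` ball t1 d)" using connected_uncountable[OF conn] by blast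
      then show False using cnt by blast
    qed
    have "((\<lambda>t. fst (C t1)) has_real_derivative - k t1 * sin (\<theta> t1)) (at t1)"
      by (rule has_field_derivative_transform_within_open[OF dC(1) open_ball centre_in_ball[THEN iffD2, OF d(1)]])
        (simp only: eq)
    then have "- k t1 * sin (\<theta> t1) = 0" by (rule DERIV_unique) (rule DERIV_const)
    moreover have "((\<lambda>t. snd (C t1)) has_real_derivative k t1 * cos (\<theta> t1)) (at t1)"
      by (rule has_field_derivative_transform_within_open[OF dC(2) open_ball centre_in_ball[THEN iffD2, OF d(1)]])
        (simp only: eq)
    then have "k t1 * cos (\<theta> t1) = 0" by (rule DERIV_unique) (rule DERIV_const)
    ultimately show False using t1 sin_cos_squared_add[of "\<theta> t1"] by auto
  qed
  then obtain t0 where t0: "k t0 \<noteq> 0" "C t0 \<notin> E" using d by blast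
  \<comment> \<open>By periodicity and compactness the supremum of h^2 + p^2 is attained, hence
    below 1; \<open>R\<^sup>2\<close> is taken halfway between it and 1.\<close>
  obtain R where R: "0 < R" "R < 1" and hpR: "\<And>t. (h t)\<^sup>2 + (p t)\<^sup>2 < R\<^sup>2"
  proof -
    let ?q = "\<lambda>t. (h t)\<^sup>2 + (p t)\<^sup>2"
    have comp: "compact (?q ` {0..P})" "?q ` {0..P} \<noteq> {}"
      using P by (auto intro!: compact_continuous_image continuous_intros continuous_on_subset[OF ch] continuous_on_subset[OF cp])
    have rng: "?q ` {0..P} = range ?q" using periodic_image[of ?q P 0] per P by simp
    obtain M where M: "\<And>t. ?q t \<le> ?q M"
      using compact_attains_sup[OF comp] unfolding rng by blast
    define R where "R = sqrt ((?q M + 1) / 2)"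
    have q0: "0 \<le> ?q M" by simp
    then have "R\<^sup>2 = (?q M + 1) / 2" unfolding R_def by (intro real_sqrt_pow2) simp
    then have "?q t < R\<^sup>2" for t
      using order_le_less_trans[OF M[of t], of "R\<^sup>2"] hp[of M] by simp
    moreover have "0 < R"
      unfolding R_def by (intro real_sqrt_gt_zero divide_pos_pos add_nonneg_pos[OF q0]) auto
    moreover have "R < 1" using hp[of M] by (simp add: R_def)
    ultimately show ?thesis using that by blast
  qed
  \<comment> \<open>The sign that makes the double zero of \<open>e * f v0\<close> at
    \<open>t0\<close> a strict local minimum.\<close>
  define e where "e = sgn (k t0)"
  have e: "e = 1 \<or> e = -1" "e * k t0 > 0" using t0(1) by (auto simp: e_def sgn_if)
  define v0 where "v0 = C t0"
  have f00: "f v0 t0 = 0" "D v0 t0 = 0" using C_iff[of v0 t0] by (simp_all add: v0_def)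
  obtain \<eta>0 where \<eta>0: "\<eta>0 > 0" "\<And>t. t \<noteq> t0 \<Longrightarrow> \<bar>t - t0\<bar> < \<eta>0 \<Longrightarrow> e * f v0 t > 0"
  proof (rule strict_extremum_of_second_derivative[where f = "\<lambda>t. e * f v0 t" and w = \<omega> and d = "\<lambda>t. e * D v0 t"])
    show "((\<lambda>t. e * f v0 t) has_real_derivative \<omega> t * (e * D v0 t)) (at t)" for t
      using DERIV_cmult[OF df[of v0 t], of e] by (simp add: mult_ac)
    have "fst v0 * cos (\<theta> t0) + snd v0 * sin (\<theta> t0) = h t0" using f00(1) by (simp add: f_def)
    then show "((\<lambda>t. e * D v0 t) has_real_derivative e * k t0) (at t0)"
      using DERIV_cmult[OF dD[of v0 t0], of e] by (simp add: k_def)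
  qed (use \<omega> e f00 in auto)
  have "alternates (\<lambda>t. e * f v0 t) P 4"
    using alt4[of v0] t0(2) e(1) alternates_uminus[of "f v0" P 4] by (auto simp: v0_def)
  then obtain u1 u2 u3 where u: "t0 < u1" "u1 < u2" "u2 < u3" "u3 < t0 + P"
      "e * f v0 u1 < 0" "e * f v0 u2 > 0" "e * f v0 u3 < 0"
    using alternates_around_zero[of "\<lambda>t. e * f v0 t" P t0] perf P f00(1) by auto
  define \<eta> where "\<eta> = min \<eta>0 (min (u1 - t0) (t0 + P - u3)) / 2"
  have \<eta>: "0 < \<eta>" "\<eta> < \<eta>0" "\<eta> < u1 - t0" "\<eta> < t0 + P - u3" using \<eta>0(1) u by (auto simp: \<eta>_def min_def)
  have near: "e * f v0 (t0 - \<eta>) > 0" "e * f v0 (t0 + \<eta>) > 0"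
    using \<eta>0(2)[of "t0 - \<eta>"] \<eta>0(2)[of "t0 + \<eta>"] \<eta> by auto
  \<comment> \<open>The conditions prescribe the signs +, -, +, -, +, - of \<open>e * f v\<close> at
    six successive points of one period, besides keeping v inside the cutoff disc.\<close>
  define U where "U = {v. (fst v)\<^sup>2 + (snd v)\<^sup>2 < R\<^sup>2} \<inter> {v. 0 < e * f v (t0 - \<eta>)} \<inter> {v. e * f v t0 < 0} \<inter>
      {v. 0 < e * f v (t0 + \<eta>)} \<inter> {v. e * f v u1 < 0} \<inter> {v. 0 < e * f v u2} \<inter> {v. e * f v u3 < 0}"
  have U: "open U"
    unfolding U_def f_def by (intro open_Int open_Collect_less continuous_intros)
  have "U \<noteq> {}"
  proof -
    \<comment> \<open>Moving v0 by x in this direction changes the value at \<open>t0\<close> from 0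
      to - e x, so \<open>e * f v\<close> becomes negative there. The other conditions of
      \<open>U\<close>, collected in \<open>W\<close>, are open and hold at v0, so they survive for
      small x.\<close>
    define v where "v x = v0 + x *\<^sub>R (e * cos (\<theta> t0), e * sin (\<theta> t0))" for x :: real
    have v0: "v 0 = v0" by (simp add: v_def flip: zero_prod_def)
    have cv: "continuous_on UNIV v" unfolding v_def by (intro continuous_intros)
    define W where "W = {v. (fst v)\<^sup>2 + (snd v)\<^sup>2 < R\<^sup>2} \<inter> {v. 0 < e * f v (t0 - \<eta>)} \<inter>
      {v. 0 < e * f v (t0 + \<eta>)} \<inter> {v. e * f v u1 < 0} \<inter> {v. 0 < e * f v u2} \<inter> {v. e * f v u3 < 0}"
    have "open W"
      unfolding W_def f_def by (intro open_Int open_Collect_less continuous_intros)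
    then have oW: "open (v -` W)" by (rule open_vimage[OF _ cv])
    have "(fst v0)\<^sup>2 + (snd v0)\<^sup>2 = ((h t0)\<^sup>2 + (p t0)\<^sup>2) * ((sin (\<theta> t0))\<^sup>2 + (cos (\<theta> t0))\<^sup>2)"
      unfolding v0_def C_def by (simp add: power2_eq_square algebra_simps del: sin_cos_squared_add sin_cos_squared_add2 sin_cos_squared_add3)
    then have "(fst v0)\<^sup>2 + (snd v0)\<^sup>2 < R\<^sup>2" using hpR[of t0] by simp
    then have "0 \<in> v -` W" using near u by (simp add: W_def v0)
    then obtain \<delta> where \<delta>: "\<delta> > 0" "ball 0 \<delta> \<subseteq> v -` W" using oW openE by blast
    have "\<delta> / 2 \<in> ball 0 \<delta>" using \<delta>(1) by simp
    then have "v (\<delta> / 2) \<in> W" using \<delta>(2) by blast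
    moreover have "e * f (v (\<delta> / 2)) t0 < 0"
    proof -
      have "f (v x) t0 = f v0 t0 - e * x * ((sin (\<theta> t0))\<^sup>2 + (cos (\<theta> t0))\<^sup>2)" for x
        unfolding v_def f_def by (simp add: power2_eq_square algebra_simps del: sin_cos_squared_add sin_cos_squared_add2 sin_cos_squared_add3)
      then have "f (v (\<delta> / 2)) t0 = - e * (\<delta> / 2)" using f00 by simp
      then show ?thesis using e(1) \<delta>(1) by auto
    qed
    ultimately show ?thesis unfolding U_def W_def by blast
  qed
  have alt6: "alternates (f v) P 6" if "v \<in> U" for v
  proof -
    have *: "0 < e * f v (t0 - \<eta>)" "e * f v t0 < 0" "0 < e * f v (t0 + \<eta>)" "e * f v u1 < 0" "0 < e * f v u2" "e * f v u3 < 0"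
      using that by (auto simp: U_def)
    have sg: "a * b < 0" "b * a < 0" if "0 < e * a" "e * b < 0" for a b
      using that e(1) by (auto simp: mult_less_0_iff)
    show ?thesis
    proof (rule alternates_6I[of "t0 - \<eta>" t0 "t0 + \<eta>" u1 u2 u3])
      show "f v u3 * f v (t0 - \<eta> + P) < 0" unfolding perf by (rule sg(2)[OF *(1,6)])
    qed (use \<eta> u sg * in simp_all)
  qed
  show ?thesis
    by (rule crofton_bound[OF d\<theta> dh c\<omega> cp less_imp_le[OF \<omega>] per P R hpR E alt4[unfolded f_def] U \<open>U \<noteq> {}\<close> _ alt6[unfolded f_def] L])
      (simp_all add: U_def)
qed

section \<open>Angular parametrization of strong spacelike curves\<close>

lemma lorentz_bilinear:
  "lorentz (a *\<^sub>R x + b *\<^sub>R y) (a *\<^sub>R x + b *\<^sub>R y) = a\<^sup>2 * lorentz x x + 2 * a * b * lorentz x y + b\<^sup>2 * lorentz y y"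
  by (simp add: lorentz_def power2_eq_square algebra_simps)

lemma DERIV_periodic:
  fixes f :: "real \<Rightarrow> real"
  assumes "\<And>t. (f has_real_derivative g t) (at t)" "\<And>t. f (t + P) = f t"
  shows "g (t + P) = g t"
proof -
  have "((\<lambda>t. f (t + P)) has_real_derivative g (t + P)) (at t)"
    using assms(1)[of "t + P"] by (simp add: DERIV_shift)
  then show ?thesis using DERIV_unique[OF _ assms(1)] assms(2) by simp
qed

lemma smooth_curve_components:
  assumes "smooth_curve \<gamma>"
  shows "((\<lambda>t. (velocity ^^ n) \<gamma> t $ i) has_real_derivative (velocity ^^ Suc n) \<gamma> t $ i) (at t)"
proof -
  have "(velocity ^^ n) \<gamma> differentiable (at t)"
    using assms unfolding smooth_curve_def by (simp add: differentiable_on_def)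
  then have "((velocity ^^ n) \<gamma> has_vector_derivative (velocity ^^ Suc n) \<gamma> t) (at t)"
    by (simp add: velocity_def vector_derivative_works)
  from bounded_linear.has_vector_derivative[OF bounded_linear_vec_nth this]
  show ?thesis by (simp add: has_real_derivative_iff_has_vector_derivative)
qed

text \<open>A vector of the plane killed by the projection to the first two coordinates would not be spacelike.\<close>

lemma spacelike_plane_projection:
  fixes X A :: "real^3"
  assumes V: "spacelike_subspace V" "dim V = 2" and sub: "X \<in> V" "A \<in> V" and span: "V \<subseteq> span {X, A}"
    and X: "(X $ 1)\<^sup>2 + (X $ 2)\<^sup>2 > 0"
  shows "X $ 1 * A $ 2 - X $ 2 * A $ 1 \<noteq> 0"
proof
  assume w: "X $ 1 * A $ 2 - X $ 2 * A $ 1 = 0"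
  have sV: "subspace V" using V(1) by (simp add: spacelike_subspace_def)
  have zero: "z = 0" if "z \<in> V" "z $ 1 = 0" "z $ 2 = 0" for z
  proof (rule ccontr)
    assume "z \<noteq> 0"
    then have "lorentz z z > 0" using V(1) that(1) by (simp add: spacelike_subspace_def)
    then show False using that by (simp add: lorentz_def)
  qed
  \<comment> \<open>When the determinant vanishes, these vectors for i = 1, 2 have no first two
    coordinates and must be zero, so A is a multiple of X and the plane would have dimension at most
    one.\<close>
  have in_V: "(X $ i) *\<^sub>R A - (A $ i) *\<^sub>R X \<in> V" for i
    using sV sub by (intro subspace_diff subspace_scale)
  have z: "(X $ 1) *\<^sub>R A - (A $ 1) *\<^sub>R X = 0" "(X $ 2) *\<^sub>R A - (A $ 2) *\<^sub>R X = 0"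
    by (rule zero[OF in_V]; use w in \<open>simp add: mult.commute\<close>)+
  have "\<exists>i. X $ i \<noteq> 0 \<and> (X $ i) *\<^sub>R A = (A $ i) *\<^sub>R X"
  proof (cases "X $ 1 = 0")
    case True
    then have "X $ 2 \<noteq> 0" using X by auto
    then show ?thesis using z(2) by auto
  next
    case False
    then show ?thesis using z(1) by auto
  qed
  then obtain i where i: "X $ i \<noteq> 0" "(X $ i) *\<^sub>R A = (A $ i) *\<^sub>R X" by blast
  then have "A = (A $ i / X $ i) *\<^sub>R X"
    by (metis divide_inverse_commute scaleR_scaleR scaleR_one left_inverse)
  then have "A \<in> span {X}" by (metis span_base span_scale singletonI)
  then have "span {X, A} \<subseteq> span {X}"
    by (intro span_minimal) (auto intro: span_base)
  then have "V \<subseteq> span {X}" using span by blast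
  then have "dim V \<le> dim {X}" by (rule dim_subset[THEN order_trans]) (simp add: dim_span)
  also have "dim {X} \<le> 1" by (rule dim_le_card'[THEN order_trans]) auto
  finally show False using V(2) by simp
qed

theorem theorem1p2:
  fixes \<gamma> :: "real \<Rightarrow> real^3" and P :: real
  assumes "strong_spacelike_curve \<gamma>"
    and "closed_curve \<gamma> P"
    and "has_index \<gamma> P 2"
    and "nontrivial_knot \<gamma> P"
  shows "total_curvature \<gamma> P < 4 * pi"
proof -
  have P: "P > 0" and per\<gamma>: "\<And>t. \<gamma> (t + P) = \<gamma> t" using assms(2) by (auto simp: closed_curve_def)
  have smooth: "smooth_curve \<gamma>" and sp: "\<And>t. velocity \<gamma> t \<noteq> 0 \<and> spacelike_subspace (span {velocity \<gamma> t})"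
    using assms(1) by (auto simp: strong_spacelike_curve_def spacelike_curve_def)
  \<comment> \<open>Velocity, acceleration and third derivative; the last one enters through the
    derivative of \<open>p\<close>.\<close>
  define X A J where "X = velocity \<gamma>" and "A = velocity X" and "J = velocity A"
  have d\<gamma>: "((\<lambda>t. \<gamma> t $ i) has_real_derivative X t $ i) (at t)"
    and dX: "((\<lambda>t. X t $ i) has_real_derivative A t $ i) (at t)"
    and dA: "((\<lambda>t. A t $ i) has_real_derivative J t $ i) (at t)"
    and dJ: "((\<lambda>t. J t $ i) has_real_derivative velocity J t $ i) (at t)" for i t
    using smooth_curve_components[OF smooth, of 0 i t] smooth_curve_components[OF smooth, of 1 i t]
      smooth_curve_components[OF smooth, of 2 i t] smooth_curve_components[OF smooth, of 3 i t]
    by (simp_all add: X_def A_def J_def eval_nat_numeral)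
  have cont: "continuous_on UNIV (\<lambda>t. X t $ i)" "continuous_on UNIV (\<lambda>t. A t $ i)" "continuous_on UNIV (\<lambda>t. J t $ i)" for i
    using DERIV_isCont[OF dX] DERIV_isCont[OF dA] DERIV_isCont[OF dJ] by (simp_all add: continuous_at_imp_continuous_on)
  have c\<gamma>: "continuous_on UNIV \<gamma>"
    using smooth by (auto simp: smooth_curve_def intro!: differentiable_imp_continuous_on dest: spec[of _ 0])
  have perX: "X (t + P) $ i = X t $ i" for t i
    by (rule DERIV_periodic[OF d\<gamma>]) (simp add: per\<gamma>)
  have perA: "A (t + P) $ i = A t $ i" for t i
    by (rule DERIV_periodic[OF dX]) (rule perX)
  define x1 x2 x3 a1 a2 a3 where "x1 t = X t $ 1" and "x2 t = X t $ 2" and "x3 t = X t $ 3"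
    and "a1 t = A t $ 1" and "a2 t = A t $ 2" and "a3 t = A t $ 3" for t
  define j1 j2 j3 where "j1 t = J t $ 1" and "j2 t = J t $ 2" and "j3 t = J t $ 3" for t
  have dx: "(x1 has_real_derivative a1 t) (at t)" "(x2 has_real_derivative a2 t) (at t)" "(x3 has_real_derivative a3 t) (at t)" for t
    unfolding x1_def[abs_def] x2_def[abs_def] x3_def[abs_def] a1_def a2_def a3_def by (rule dX)+
  have da: "(a1 has_real_derivative j1 t) (at t)" "(a2 has_real_derivative j2 t) (at t)" "(a3 has_real_derivative j3 t) (at t)" for t
    unfolding a1_def[abs_def] a2_def[abs_def] a3_def[abs_def] j1_def j2_def j3_def by (rule dA)+
  have cx: "continuous_on UNIV x1" "continuous_on UNIV x2" "continuous_on UNIV x3"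
    "continuous_on UNIV a1" "continuous_on UNIV a2" "continuous_on UNIV a3"
    "continuous_on UNIV j1" "continuous_on UNIV j2" "continuous_on UNIV j3"
    unfolding x1_def[abs_def] x2_def[abs_def] x3_def[abs_def] a1_def[abs_def] a2_def[abs_def] a3_def[abs_def]
      j1_def[abs_def] j2_def[abs_def] j3_def[abs_def] by (rule cont)+
  have perx: "x1 (t + P) = x1 t" "x2 (t + P) = x2 t" "x3 (t + P) = x3 t" "a1 (t + P) = a1 t" "a2 (t + P) = a2 t" "a3 (t + P) = a3 t" for t
    unfolding x1_def x2_def x3_def a1_def a2_def a3_def by (rule perX perA)+

  define XX where "XX t = lorentz (X t) (X t)" for t
  define \<sigma> where "\<sigma> t = speed \<gamma> t" for t
  have XX0: "XX t > 0" for t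
  proof -
    have "X t \<in> span {X t}" by (simp add: span_base)
    then show ?thesis using sp[of t] by (simp add: XX_def X_def spacelike_subspace_def)
  qed
  have XX: "XX t = (x1 t)\<^sup>2 + (x2 t)\<^sup>2 - (x3 t)\<^sup>2" for t
    by (simp add: XX_def lorentz_def x1_def x2_def x3_def power2_eq_square)
  have \<sigma>: "\<sigma> t = sqrt (XX t)" for t by (simp add: \<sigma>_def speed_def XX_def X_def)
  have \<sigma>0: "\<sigma> t > 0" and \<sigma>2: "(\<sigma> t)\<^sup>2 = XX t" for t using XX0[of t] by (simp_all add: \<sigma>)
  define XA where "XA t = lorentz (X t) (A t)" for t
  have XA: "XA t = x1 t * a1 t + x2 t * a2 t - x3 t * a3 t" for t
    by (simp add: XA_def lorentz_def x1_def x2_def x3_def a1_def a2_def a3_def)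
  have d\<sigma>: "((\<lambda>t. inverse (\<sigma> t)) has_real_derivative - XA t / (\<sigma> t)^3) (at t)" for t
  proof -
    have "((\<lambda>t. (x1 t)\<^sup>2 + (x2 t)\<^sup>2 - (x3 t)\<^sup>2) has_real_derivative 2 * XA t) (at t)"
      by (auto intro!: derivative_eq_intros dx simp: XA)
    then have "(XX has_real_derivative 2 * XA t) (at t)" unfolding XX[abs_def] .
    then have "((\<lambda>t. sqrt (XX t)) has_real_derivative inverse (sqrt (XX t)) / 2 * (2 * XA t)) (at t)"
      by (rule DERIV_chain2[where f = sqrt and g = XX, OF DERIV_real_sqrt[OF XX0]])
    then have "(\<sigma> has_real_derivative XA t / \<sigma> t) (at t)"
      unfolding \<sigma>[abs_def] by (simp add: field_simps)
    then show ?thesis using \<sigma>0[of t]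
      by (auto intro!: derivative_eq_intros simp: field_simps power2_eq_square power3_eq_cube)
  qed
  define c where "c t = - XA t / (\<sigma> t)^3" for t
  have dT: "vector_derivative (unit_tangent \<gamma>) (at t) = inverse (\<sigma> t) *\<^sub>R A t + c t *\<^sub>R X t" for t
  proof -
    have "(X has_vector_derivative A t) (at t)"
      using smooth unfolding smooth_curve_def A_def X_def
      by (metis (no_types, lifting) UNIV_I differentiable_on_def funpow_0 funpow.simps(2) comp_apply
          vector_derivative_works velocity_def)
    then have "((\<lambda>t. inverse (\<sigma> t) *\<^sub>R X t) has_vector_derivative inverse (\<sigma> t) *\<^sub>R A t + c t *\<^sub>R X t) (at t)"
      unfolding c_def using d\<sigma>[of t] by (intro has_vector_derivative_scaleR) auto
    moreover have "unit_tangent \<gamma> = (\<lambda>t. inverse (\<sigma> t) *\<^sub>R X t)"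
      by (auto simp: unit_tangent_def \<sigma>_def X_def)
    ultimately show ?thesis by (simp add: vector_derivative_at)
  qed
  have cv: "curvature_vector \<gamma> t = inverse (\<sigma> t) *\<^sub>R (inverse (\<sigma> t) *\<^sub>R A t + c t *\<^sub>R X t)" for t
    unfolding curvature_vector_def dT by (simp add: \<sigma>_def)
  have ut: "unit_tangent \<gamma> t = inverse (\<sigma> t) *\<^sub>R X t" for t by (simp add: unit_tangent_def \<sigma>_def X_def)
  \<comment> \<open>The Gram determinant of velocity and acceleration for the Lorentz form. The
    squared curvature is G / XX^3, so G is positive and the integrand of the total curvature is sqrt
    G / XX.\<close>
  define G where "G t = lorentz (A t) (A t) * XX t - (XA t)\<^sup>2" for t
  have lorT: "lorentz (inverse (\<sigma> t) *\<^sub>R A t + c t *\<^sub>R X t) (inverse (\<sigma> t) *\<^sub>R A t + c t *\<^sub>R X t) = G t / (XX t)\<^sup>2" for t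
  proof -
    have sym: "lorentz (A t) (X t) = XA t" by (simp add: XA_def lorentz_def mult.commute)
    have "(inverse (\<sigma> t))\<^sup>2 * lorentz (A t) (A t) + 2 * inverse (\<sigma> t) * c t * XA t + (c t)\<^sup>2 * XX t
        = (lorentz (A t) (A t) * (\<sigma> t)\<^sup>2 - (XA t)\<^sup>2) / ((\<sigma> t)\<^sup>2)\<^sup>2"
      using \<sigma>0[of t] unfolding c_def \<sigma>2[symmetric] by (simp add: field_simps power2_eq_square power3_eq_cube)
    then show ?thesis unfolding lorentz_bilinear sym XX_def[symmetric] \<sigma>2 G_def .
  qed
  have oscul: "curvature_vector \<gamma> t \<noteq> 0" "dim (osculating_plane \<gamma> t) = 2" "spacelike_subspace (osculating_plane \<gamma> t)" for t
    using assms(1) by (auto simp: strong_spacelike_curve_def)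
  have lorK: "lorentz (curvature_vector \<gamma> t) (curvature_vector \<gamma> t) = (inverse (\<sigma> t))\<^sup>2 * (G t / (XX t)\<^sup>2)" for t
    unfolding cv lorT[symmetric] by (simp add: lorentz_def power2_eq_square algebra_simps)
  have G0: "G t > 0" for t
  proof -
    have "curvature_vector \<gamma> t \<in> osculating_plane \<gamma> t"
      by (simp add: osculating_plane_def span_base)
    then have "lorentz (curvature_vector \<gamma> t) (curvature_vector \<gamma> t) > 0"
      using oscul(1,3)[of t] by (simp add: spacelike_subspace_def)
    then show ?thesis unfolding lorK using \<sigma>0[of t] XX0[of t] by (simp add: zero_less_mult_iff zero_less_divide_iff)
  qed
  have curv: "curvature \<gamma> t * speed \<gamma> t = sqrt (G t) / XX t" for t
    unfolding curvature_def lorK \<sigma>_def[symmetric] using \<sigma>0[of t] XX0[of t] G0[of t]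
    by (simp add: real_sqrt_mult real_sqrt_divide)

  \<comment> \<open>In polar form the projected velocity has squared length \<open>q\<close>;
    \<open>w\<close> is \<open>q\<close> times the derivative of its angle, and \<open>N\<close> is
    \<open>r\<^sup>3\<close> times the derivative of \<open>h\<close>. This yields the formulas for
    \<open>\<omega>\<close> and \<open>p\<close> below.\<close>
  define q where "q t = (x1 t)\<^sup>2 + (x2 t)\<^sup>2" for t
  define r where "r t = sqrt (q t)" for t
  define w where "w t = x1 t * a2 t - x2 t * a1 t" for t
  define N where "N t = a3 t * q t - x3 t * (x1 t * a1 t + x2 t * a2 t)" for t
  have q0: "q t > 0" for t using XX0[of t] zero_le_power2[of "x3 t"] unfolding XX q_def by linarith
  have q_ne: "q t \<noteq> 0" for t using q0[of t] by simp
  have r0: "r t > 0" and r2: "(r t)\<^sup>2 = q t" for t using q0[of t] by (simp_all add: r_def)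
  have w0: "w t \<noteq> 0" for t
    unfolding w_def x1_def x2_def a1_def a2_def
  proof (rule spacelike_plane_projection[OF oscul(3,2)])
    have X_eq: "X t = \<sigma> t *\<^sub>R unit_tangent \<gamma> t" using \<sigma>0[of t] by (simp add: ut)
    show X_in: "X t \<in> osculating_plane \<gamma> t"
      unfolding osculating_plane_def by (subst X_eq) (intro span_scale span_base, simp)
    have A_eq: "A t = \<sigma> t *\<^sub>R (\<sigma> t *\<^sub>R curvature_vector \<gamma> t - c t *\<^sub>R X t)"
      unfolding cv using \<sigma>0[of t] by simp
    have "curvature_vector \<gamma> t \<in> osculating_plane \<gamma> t" by (simp add: osculating_plane_def span_base)
    then show "A t \<in> osculating_plane \<gamma> t"
      using X_in by (subst A_eq) (simp add: osculating_plane_def span_scale span_diff)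
    have "unit_tangent \<gamma> t \<in> span {X t, A t}" unfolding ut by (intro span_scale span_base) simp
    moreover have "curvature_vector \<gamma> t \<in> span {X t, A t}"
      unfolding cv by (intro span_scale span_add span_base) simp_all
    ultimately show "osculating_plane \<gamma> t \<subseteq> span {X t, A t}"
      unfolding osculating_plane_def by (intro span_minimal) auto
    show "(X t $ 1)\<^sup>2 + (X t $ 2)\<^sup>2 > 0" using q0[of t] by (simp add: q_def x1_def x2_def)
  qed

  define \<omega> where "\<omega> t = w t / q t" for t
  define h where "h t = x3 t / r t" for t
  define p where "p t = N t / (r t * w t)" for t
  have cq: "continuous_on UNIV q" unfolding q_def by (intro continuous_intros cx)
  have cr: "continuous_on UNIV r" unfolding r_def by (intro continuous_intros cq)
  have cw: "continuous_on UNIV w" unfolding w_def by (intro continuous_intros cx)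
  have cN: "continuous_on UNIV N" unfolding N_def by (intro continuous_intros cx cq)
  have c\<omega>: "continuous_on UNIV \<omega>" unfolding \<omega>_def by (intro continuous_on_divide cw cq ballI q_ne)
  have dq: "(q has_real_derivative 2 * (x1 t * a1 t + x2 t * a2 t)) (at t)" for t
    unfolding q_def by (auto intro!: derivative_eq_intros dx)
  have dr: "(r has_real_derivative (x1 t * a1 t + x2 t * a2 t) / r t) (at t)" for t
  proof -
    define m where "m = x1 t * a1 t + x2 t * a2 t"
    have "((\<lambda>t. sqrt (q t)) has_real_derivative inverse (sqrt (q t)) / 2 * (2 * m)) (at t)"
      using DERIV_chain2[where f = sqrt and g = q, OF DERIV_real_sqrt[OF q0] dq] unfolding m_def .
    also have "inverse (sqrt (q t)) / 2 * (2 * m) = m / sqrt (q t)" by (simp add: field_simps)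
    finally show ?thesis unfolding r_def[abs_def] m_def .
  qed
  have quot: "((\<lambda>t. x t / r t) has_real_derivative (a * q t - x t * (x1 t * a1 t + x2 t * a2 t)) / (r t)^3) (at t)"
    if "(x has_real_derivative a) (at t)" for x a t
  proof -
    have "((\<lambda>t. x t / r t) has_real_derivative (a * r t - x t * ((x1 t * a1 t + x2 t * a2 t) / r t)) / (r t * r t)) (at t)"
      using r0[of t] by (intro DERIV_divide that dr) simp
    also have "(a * r t - x t * ((x1 t * a1 t + x2 t * a2 t) / r t)) / (r t * r t) = (a * (r t)\<^sup>2 - x t * (x1 t * a1 t + x2 t * a2 t)) / (r t)^3"
      using r0[of t] by (simp add: field_simps power2_eq_square power3_eq_cube)
    finally show ?thesis unfolding r2 .
  qed
  have r3: "(r t)^3 = r t * q t" for t unfolding r2[symmetric] by (simp add: power3_eq_cube power2_eq_square)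
  have dh: "(h has_real_derivative \<omega> t * p t) (at t)" for t
    using quot[OF dx(3)[of t]] w0[of t] r0[of t] q0[of t] unfolding h_def[abs_def] N_def[symmetric] r3
    by (simp add: \<omega>_def p_def field_simps)
  have du: "((\<lambda>t. x1 t / r t) has_real_derivative - \<omega> t * (x2 t / r t)) (at t)" for t
  proof -
    have "a1 t * q t - x1 t * (x1 t * a1 t + x2 t * a2 t) = - w t * x2 t"
      by (simp add: q_def w_def power2_eq_square algebra_simps)
    then show ?thesis using quot[OF dx(1)[of t]] unfolding r3 by (simp add: \<omega>_def mult.commute)
  qed
  have dv: "((\<lambda>t. x2 t / r t) has_real_derivative \<omega> t * (x1 t / r t)) (at t)" for t
  proof -
    have "a2 t * q t - x2 t * (x1 t * a1 t + x2 t * a2 t) = w t * x1 t"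
      by (simp add: q_def w_def power2_eq_square algebra_simps)
    then show ?thesis using quot[OF dx(2)[of t]] unfolding r3 by (simp add: \<omega>_def mult.commute)
  qed
  define w' where "w' t = x1 t * j2 t - x2 t * j1 t" for t
  define N' where "N' t = j3 t * q t + a3 t * (2 * (x1 t * a1 t + x2 t * a2 t)) - (a3 t * (x1 t * a1 t + x2 t * a2 t)
      + x3 t * (a1 t * a1 t + x1 t * j1 t + (a2 t * a2 t + x2 t * j2 t)))" for t
  define p' where "p' t = (N' t * (r t * w t) - N t * ((x1 t * a1 t + x2 t * a2 t) / r t * w t + r t * w' t)) / ((r t * w t) * (r t * w t))" for t
  have dw: "(w has_real_derivative w' t) (at t)" for t
    unfolding w_def w'_def by (auto intro!: derivative_eq_intros dx da simp: algebra_simps)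
  have dN: "(N has_real_derivative N' t) (at t)" for t
    unfolding N_def N'_def by (auto intro!: derivative_eq_intros dx da dq simp: algebra_simps)
  have dp: "(p has_real_derivative p' t) (at t)" for t
  proof -
    have "((\<lambda>t. r t * w t) has_real_derivative (x1 t * a1 t + x2 t * a2 t) / r t * w t + r t * w' t) (at t)"
      using DERIV_mult[OF dr dw, of t] by (simp add: algebra_simps)
    from DERIV_divide[OF dN this] show ?thesis
      unfolding p_def[abs_def] p'_def using r0[of t] w0[of t] by simp
  qed
  have cp': "continuous_on UNIV p'"
  proof -
    have "continuous_on UNIV w'" unfolding w'_def by (intro continuous_intros cx)
    moreover have "continuous_on UNIV N'" unfolding N'_def by (intro continuous_intros cx cq)
    moreover have "r t \<noteq> 0" for t using r0[of t] by simp
    ultimately show ?thesis unfolding p'_def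
      using w0 by (intro continuous_on_divide continuous_on_diff continuous_on_mult continuous_on_add cx cr cw cN) auto
  qed
  have perq: "q (t + P) = q t" "r (t + P) = r t" "w (t + P) = w t" "N (t + P) = N t" for t
    by (simp_all add: q_def r_def w_def N_def perx)
  have per: "\<omega> (t + P) = \<omega> t" "h (t + P) = h t" "p (t + P) = p t" for t
    by (simp_all add: \<omega>_def h_def p_def perq perx)
  have hp_eq: "1 - (h t)\<^sup>2 - (p t)\<^sup>2 = G t / (w t)\<^sup>2" for t
  proof -
    \<comment> \<open>The Lorentzian Lagrange identity: up to sign, G is the Lorentz square of the
      Euclidean cross product of velocity and acceleration, whose third component is
      \<open>w\<close>.\<close>
    have G_eq: "G t = (w t)\<^sup>2 - (x2 t * a3 t - x3 t * a2 t)\<^sup>2 - (x3 t * a1 t - x1 t * a3 t)\<^sup>2"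
      unfolding G_def XX XA_def lorentz_def w_def x1_def x2_def x3_def a1_def a2_def a3_def
      by (simp add: power2_eq_square algebra_simps)
    have id: "(x3 t)\<^sup>2 * (w t)\<^sup>2 + (N t)\<^sup>2 = q t * ((x2 t * a3 t - x3 t * a2 t)\<^sup>2 + (x3 t * a1 t - x1 t * a3 t)\<^sup>2)"
      unfolding N_def w_def q_def by (simp add: power2_eq_square algebra_simps)
    have "(h t)\<^sup>2 + (p t)\<^sup>2 = ((x3 t)\<^sup>2 * (w t)\<^sup>2 + (N t)\<^sup>2) / (q t * (w t)\<^sup>2)"
      using w0[of t] q0[of t] by (simp add: h_def p_def power_divide power_mult_distrib r2 field_simps)
    also have "\<dots> = ((w t)\<^sup>2 - G t) / (w t)\<^sup>2"
      unfolding id G_eq using q0[of t] by simp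
    also have "\<dots> = 1 - G t / (w t)\<^sup>2" using w0[of t] by (simp add: diff_divide_distrib)
    finally show ?thesis by simp
  qed
  have hp: "(h t)\<^sup>2 + (p t)\<^sup>2 < 1" for t
  proof -
    have "G t / (w t)\<^sup>2 > 0" using G0[of t] w0[of t] by simp
    then show ?thesis unfolding hp_eq[symmetric] by linarith
  qed

  \<comment> \<open>The angle is built by integrating its expected derivative, with the starting
    value adjusted by \<open>\<tau>\<close>; that it is the polar angle of the projected velocity is
    checked afterwards.\<close>
  obtain \<theta>0 where \<theta>0: "\<And>t. (\<theta>0 has_real_derivative \<omega> t) (at t)" using ex_antiderivative[OF c\<omega>] by blast
  have uv1: "(x1 t / r t)\<^sup>2 + (x2 t / r t)\<^sup>2 = 1" for t
    using q0[of t] by (simp add: power_divide r2 flip: add_divide_distrib) (simp add: q_def)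
  obtain \<tau> where \<tau>: "x1 0 / r 0 = cos \<tau>" "x2 0 / r 0 = sin \<tau>"
    using sincos_total_2pi[OF uv1[of 0]] by metis
  define \<theta> where "\<theta> t = \<theta>0 t - \<theta>0 0 + \<tau>" for t
  have d\<theta>: "(\<theta> has_real_derivative \<omega> t) (at t)" for t
    unfolding \<theta>_def by (auto intro!: derivative_eq_intros \<theta>0)
  \<comment> \<open>Cosine and sine of the difference between the true direction and
    \<open>\<theta>\<close>. Both have derivative zero and start at 1 and 0, so the directions agree
    for all t.\<close>
  define S where "S t = x1 t / r t * cos (\<theta> t) + x2 t / r t * sin (\<theta> t)" for t
  define D where "D t = x2 t / r t * cos (\<theta> t) - x1 t / r t * sin (\<theta> t)" for t
  have dcos: "((\<lambda>t. cos (\<theta> t)) has_real_derivative - sin (\<theta> t) * \<omega> t) (at t)"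
    and dsin: "((\<lambda>t. sin (\<theta> t)) has_real_derivative cos (\<theta> t) * \<omega> t) (at t)" for t
    by (auto intro!: derivative_eq_intros d\<theta>)
  have "(S has_real_derivative 0) (at t)" "(D has_real_derivative 0) (at t)" for t
    using DERIV_add[OF DERIV_mult[OF du dcos] DERIV_mult[OF dv dsin], of t]
      DERIV_diff[OF DERIV_mult[OF dv dcos] DERIV_mult[OF du dsin], of t]
    unfolding S_def[abs_def] D_def[abs_def] by (simp_all add: mult_ac)
  then have "S t = S 0" "D t = D 0" for t by (intro DERIV_isconst_all; blast)+
  moreover have "S 0 = 1" "D 0 = 0"
    by (simp_all add: S_def D_def \<tau> \<theta>_def flip: power2_eq_square)
  ultimately have S1: "S t = 1" and D0: "D t = 0" for t by auto
  have uc: "x1 t / r t = cos (\<theta> t)" and us: "x2 t / r t = sin (\<theta> t)" for t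
  proof -
    have sc: "cos (\<theta> t) * cos (\<theta> t) + sin (\<theta> t) * sin (\<theta> t) = 1" by (simp add: sin_cos_squared_add3)
    have "cos (\<theta> t) * S t - sin (\<theta> t) * D t = x1 t / r t * (cos (\<theta> t) * cos (\<theta> t) + sin (\<theta> t) * sin (\<theta> t))"
      unfolding S_def D_def by (simp only: algebra_simps; simp?)
    then show "x1 t / r t = cos (\<theta> t)" unfolding sc by (simp add: S1 D0)
    have "sin (\<theta> t) * S t + cos (\<theta> t) * D t = x2 t / r t * (cos (\<theta> t) * cos (\<theta> t) + sin (\<theta> t) * sin (\<theta> t))"
      unfolding S_def D_def by (simp only: algebra_simps; simp?)
    then show "x2 t / r t = sin (\<theta> t)" unfolding sc by (simp add: S1 D0)
  qed
  have x_polar: "x1 t = r t * cos (\<theta> t)" "x2 t = r t * sin (\<theta> t)" "x3 t = r t * h t" for t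
    using r0[of t] by (simp_all add: uc[symmetric] us[symmetric] h_def)
  have c\<theta>: "continuous_on UNIV \<theta>" using DERIV_isCont[OF d\<theta>] by (simp add: continuous_at_imp_continuous_on)
  \<comment> \<open>Periodicity of the velocity makes the gain a multiple 2 pi n. Dividing the
    velocity by the speed does not change its longitude, so \<open>\<theta>\<close> is a longitude
    along the tangent indicatrix and uniqueness of the index gives n = 2.\<close>
  have \<theta>P: "\<theta> P = \<theta> 0 + 4 * pi"
  proof -
    have "sin (\<theta> P) = sin (\<theta> 0) \<and> cos (\<theta> P) = cos (\<theta> 0)"
      using perx[of 0] perq[of 0] by (simp add: uc[symmetric] us[symmetric])
    then obtain n :: int where n: "\<theta> P = \<theta> 0 + 2 * pi * of_int n" by (auto simp: sin_cos_eq_iff)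
    have "longitude_along (unit_tangent \<gamma>) P \<theta>"
      unfolding longitude_along_def
    proof (intro conjI ballI)
      show "continuous_on {0..P} \<theta>" by (rule continuous_on_subset[OF c\<theta>]) simp
      fix t
      define \<phi> where "\<phi> = arsinh (x3 t / \<sigma> t)"
      have "(r t / \<sigma> t)\<^sup>2 = (x3 t / \<sigma> t)\<^sup>2 + 1"
        using \<sigma>0[of t] XX0[of t] XX[of t] by (simp add: power_divide r2 \<sigma>2 q_def field_simps)
      then have "cosh \<phi> = r t / \<sigma> t"
        unfolding \<phi>_def cosh_arsinh_real using r0[of t] \<sigma>0[of t]
        by (metis divide_nonneg_nonneg less_imp_le real_sqrt_unique)
      moreover have "sinh \<phi> = x3 t / \<sigma> t" by (simp add: \<phi>_def)
      ultimately have "unit_tangent \<gamma> t = de_sitter_point \<phi> (\<theta> t)"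
        unfolding ut de_sitter_point_def
        using x_polar[of t] by (simp add: vec_eq_iff forall_3 x1_def x2_def x3_def divide_inverse)
      then show "\<exists>\<phi>. unit_tangent \<gamma> t = de_sitter_point \<phi> (\<theta> t)" by blast
    qed
    then have "has_index \<gamma> P n" unfolding has_index_def using n by (intro exI[of _ \<theta>]) simp
    then have "n = 2" using has_index_unique[of P \<gamma> n 2] assms(3) P by simp
    then show ?thesis using n by simp
  qed
  \<comment> \<open>\<open>\<omega>\<close> is continuous and never zero, so it has a constant sign;
    were it negative, \<open>\<theta>\<close> would decrease instead of gaining 4 pi. Thus the
    positive index selects the orientation.\<close>
  have \<omega>0: "\<omega> t > 0" for t
  proof (rule ccontr)
    assume "\<not> \<omega> t > 0"
    have nz: "\<omega> s \<noteq> 0" for s using w0[of s] q0[of s] by (simp add: \<omega>_def)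
    have neg: "\<omega> t < 0" using \<open>\<not> \<omega> t > 0\<close> nz[of t] by simp
    have "connected (range \<omega>)" by (intro connected_continuous_image c\<omega>) simp
    then have "0 \<in> range \<omega>" if "\<omega> s > 0" for s
      using connectedD_interval[of "range \<omega>" "\<omega> t" "\<omega> s" 0] neg that by auto
    then have "\<omega> s < 0" for s using nz by (metis linorder_neqE_linordered_idom rangeE)
    then have "\<theta> P < \<theta> 0" by (intro DERIV_neg_imp_decreasing[OF P]) (use d\<theta> in blast)
    then show False using \<theta>P pi_gt_zero by linarith
  qed
  have per\<theta>: "\<theta> (t + P) = \<theta> t + 4 * pi" for t
  proof -
    have "((\<lambda>t. \<theta> (t + P) - \<theta> t) has_real_derivative 0) (at t)" for t
      using DERIV_diff[OF _ d\<theta>, of "\<lambda>t. \<theta> (t + P)" "\<omega> (t + P)" t] d\<theta>[of "t + P"]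
      by (simp add: DERIV_shift per)
    then have "\<theta> (t + P) - \<theta> t = \<theta> (0 + P) - \<theta> 0" by (intro DERIV_isconst_all[of "\<lambda>t. \<theta> (t + P) - \<theta> t"]) blast
    then show ?thesis using \<theta>P by simp
  qed

  have integrand: "curvature \<gamma> t * speed \<gamma> t = \<omega> t * (sqrt (1 - (h t)\<^sup>2 - (p t)\<^sup>2) / (1 - (h t)\<^sup>2))" for t
  proof -
    have w: "w t > 0" using \<omega>0[of t] q0[of t] by (simp add: \<omega>_def zero_less_divide_iff)
    have "1 - (h t)\<^sup>2 = XX t / q t" using q0[of t] by (simp add: h_def power_divide r2 XX field_simps) (simp add: q_def)
    then have "\<omega> t * (sqrt (1 - (h t)\<^sup>2 - (p t)\<^sup>2) / (1 - (h t)\<^sup>2)) = w t / q t * ((sqrt (G t) / w t) / (XX t / q t))"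
      unfolding hp_eq \<omega>_def using w by (simp add: real_sqrt_divide)
    also have "\<dots> = sqrt (G t) / XX t" using w q0[of t] XX0[of t] by simp
    finally show ?thesis unfolding curv by simp
  qed
  have "(\<lambda>t. \<omega> t * (sqrt (1 - (h t)\<^sup>2 - (p t)\<^sup>2) / (1 - (h t)\<^sup>2))) integrable_on {0..P}"
  proof (rule integrable_continuous_interval)
    have ch: "continuous_on UNIV h" and cp: "continuous_on UNIV p"
      using DERIV_isCont[OF dh] DERIV_isCont[OF dp] by (simp_all add: continuous_at_imp_continuous_on)
    have "1 - (h t)\<^sup>2 \<noteq> 0" for t using hp[of t] zero_le_power2[of "p t"] by linarith
    then have "continuous_on UNIV (\<lambda>t. \<omega> t * (sqrt (1 - (h t)\<^sup>2 - (p t)\<^sup>2) / (1 - (h t)\<^sup>2)))"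
      by (intro continuous_on_mult continuous_on_divide continuous_on_diff continuous_on_power continuous_on_const
          continuous_on_real_sqrt c\<omega> ch cp) auto
    then show "continuous_on {0..P} (\<lambda>t. \<omega> t * (sqrt (1 - (h t)\<^sup>2 - (p t)\<^sup>2) / (1 - (h t)\<^sup>2)))"
      by (rule continuous_on_subset) simp
  qed
  then have L: "((\<lambda>t. \<omega> t * (sqrt (1 - (h t)\<^sup>2 - (p t)\<^sup>2) / (1 - (h t)\<^sup>2))) has_integral total_curvature \<gamma> P) {0..P}"
    unfolding total_curvature_def integrand by (rule integrable_integral)
  have knot: "inj_on \<gamma> {0..<P}" "\<not> ambient_isotopic (\<gamma> ` {0..P}) unknot"
    using assms(4) by (auto simp: nontrivial_knot_def)
  show ?thesis
  proof (rule total_curvature_bound_angular[OF c\<gamma> _ _ _ r0 d\<theta> dh dp c\<omega> cp' \<omega>0 per\<gamma> per\<theta> per(2,1,3) P hp knot L])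
    show "((\<lambda>t. \<gamma> t $ 1) has_real_derivative r t * cos (\<theta> t)) (at t)" for t
      using d\<gamma>[of 1 t] x_polar(1)[of t] by (simp add: x1_def)
    show "((\<lambda>t. \<gamma> t $ 2) has_real_derivative r t * sin (\<theta> t)) (at t)" for t
      using d\<gamma>[of 2 t] x_polar(2)[of t] by (simp add: x2_def)
    show "((\<lambda>t. \<gamma> t $ 3) has_real_derivative r t * h t) (at t)" for t
      using d\<gamma>[of 3 t] x_polar(3)[of t] by (simp add: x3_def)
  qed
qed

end
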